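(* Let $n\ge 2$, let $\lambda>0$, and let $\mu$ be a finite nonnegative Borel measure on $\mathbb{R}^n$ with compact support such that $\mu(E)=0$ whenever $\mathcal{H}^{n-1}(E)<+\infty$. Let $\Sigma\subset\mathbb{R}^n$ be a nonempty closed connected set with $\mathcal{H}^1(\Sigma)<+\infty$. Then for every $X\in C_0^\infty(\mathbb{R}^n;\mathbb{R}^n)$, letting $\{\phi_\varepsilon\}$ be a one-parameter group of diffeomorphisms of $\mathbb{R}^n$ with $\phi_\varepsilon(x)=x+\varepsilon X(x)+o(\varepsilon)$ as $\varepsilon\to0$, and $\Sigma_\varepsilon:=\phi_\varepsilon(\Sigma)$, one has $$\frac{\partial}{\partial\varepsilon}\mathcal{F}(\Sigma_\varepsilon)\Big|_{\varepsilon=0}=\int_{\mathbb{R}^n}\left\langle X(\pi^\Sigma(x)),\frac{\pi^\Sigma(x)-x}{|\pi^\Sigma(x)-x|}\right\rangle d\mu(x)-\lambda\langle H_\Sigma,X\rangle=-\int_{\mathbb{R}^n}\left\langle X(\pi^\Sigma(x)),\nabla\mathrm{dist}(x,\Sigma)\right\rangle d\mu(x)-\lambda\langle H_\Sigma,X\rangle.$$ In particular, if $\Sigma$ is a minimizer of $\mathcal{F}$ among all nonempty closed connected subsets of $\mathbb{R}^n$, then $$\int_{\mathbb{R}^n}\left\langle X(\pi^\Sigma(x)),\frac{\pi^\Sigma(x)-x}{|\pi^\Sigma(x)-x|}\right\rangle d\mu(x)=\lambda\langle H_\Sigma,X\rangle\qquad\text{for all }X\in C_0^\infty(\mathbb{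R}^n;\mathbb{R}^n).$$
   Context: $\mathcal{H}^k$ denotes $k$-dimensional Hausdorff measure, and $C_0^\infty(\mathbb{R}^n;\mathbb{R}^n)$ the smooth compactly supported vector fields. For nonempty closed connected $\Sigma\subset\mathbb{R}^n$ the average distance functional is $$\mathcal{F}(\Sigma):=\int_{\mathbb{R}^n}\mathrm{dist}(x,\Sigma)\,d\mu(x)+\lambda\mathcal{H}^1(\Sigma).$$ The map $\pi^\Sigma$ is the projection to $\Sigma$: $\pi^\Sigma(x)\in\Sigma$ is a nearest point of $\Sigma$ to $x$. It is uniquely defined outside the ridge set (the set of points whose minimum distance to $\Sigma$ is attained at more than one point of $\Sigma$). The ridge set coincides with the set of non-differentiability points of $\mathrm{dist}(\cdot,\Sigma)$ outside $\Sigma$ and is $(\mathcal{H}^{n-1},n-1)$-rectifiable; under the hypotheses both it and $\Sigma$ are $\mu$-negligible, so the integrands are defined $\mu$-a.e. The generalized mean curvature $H_\Sigma$ of $\Sigma$ (a closed connected set of finite $\mathcal{H}^1$ measure is countably $(\mathcal{H}^1,1)$-rectifiable) is the vector-valued distribution defined by $$\langle H_\Sigma,X\rangle:=-\int_\Sigma\mathrm{div}^\Sigma X\,d\mathcal{H}^1,\qquad X\in C_0^\infty(\mathbb{R}^n;\mathbb{R}^n),$$ where $\mathrm{div}^\Sigma$ is the tangential divergence, i.e. $\mathrm{div}^\Sigma X(x)=\langle DX(x)\tau,\tau\rangle$ for a unit vector $\tau$ spanning the approximate tangent line to $\Sigma$ at $x$ (defined for $\mathcal{H}^1$-a.e. $x\in\Sigma$).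 *)

theory Defs
  imports "HOL-Analysis.Analysis" "HOL-Library.Landau_Symbols"
begin

text \<open>
  Hausdorff outer measure, normalised by the volume of the unit ball, so that in a Euclidean space
  of dimension \<open>k\<close> it agrees with Lebesgue outer measure and on rectifiable curves the case
  \<open>k = 1\<close> is length. The covering sets have to be bounded because \<^const>\<open>diameter\<close> is
  meaningless on unbounded sets; the empty set has weight \<open>0\<close> also for \<open>k = 0\<close>.
\<close>

definition hausdorff_weight :: "nat \<Rightarrow> 'a::metric_space set \<Rightarrow> ennreal" where
  "hausdorff_weight k C =
     (if C = {} then 0 else ennreal (unit_ball_vol (real k) * (diameter C / 2) ^ k))"

definition hausdorff_premeasure :: "real \<Rightarrow> nat \<Rightarrow> 'a::metric_space set \<Rightarrow> ennreal" where
  "hausdorff_premeasure \<delta> k A =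
     (INF C \<in> {C :: nat \<Rightarrow> 'a set.
                 A \<subseteq> (\<Union>i. C i) \<and> (\<forall>i. bounded (C i) \<and> diameter (C i) \<le> \<delta>)}.
        \<Sum>i. hausdorff_weight k (C i))"

definition hausdorff :: "nat \<Rightarrow> 'a::metric_space set \<Rightarrow> ennreal" where
  "hausdorff k A = (SUP \<delta> \<in> {0<..}. hausdorff_premeasure \<delta> k A)"

text \<open>
  The complete measure that Caratheodory's construction induces on the measurable sets of the
  outer measure. Completeness matters below, since the tangent vector is an arbitrary value
  outside a null set.
\<close>

definition hausdorff_measure :: "nat \<Rightarrow> 'a::metric_space measure" where
  "hausdorff_measure k =
     measure_of UNIV (lambda_system UNIV UNIV (hausdorff k)) (hausdorff k)"


text \<open>On a finite-dimensional space this recursion characterises the functions of class \<open>C\<^sup>k\<close>.\<close>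

fun times_cont_diff :: "nat \<Rightarrow> ('a::euclidean_space \<Rightarrow> 'b::real_normed_vector) \<Rightarrow> bool" where
  "times_cont_diff 0 f \<longleftrightarrow> continuous_on UNIV f"
| "times_cont_diff (Suc k) f \<longleftrightarrow>
     (\<forall>x. f differentiable (at x)) \<and>
     (\<forall>v. times_cont_diff k (\<lambda>x. frechet_derivative f (at x) v))"

definition smooth_map :: "('a::euclidean_space \<Rightarrow> 'b::real_normed_vector) \<Rightarrow> bool" where
  "smooth_map f \<longleftrightarrow> (\<forall>k. times_cont_diff k f)"

definition test_field :: "('a::euclidean_space \<Rightarrow> 'a) \<Rightarrow> bool" where
  "test_field X \<longleftrightarrow> smooth_map X \<and> compact (closure {x. X x \<noteq> 0})"

definition diffeomorphism :: "('a::euclidean_space \<Rightarrow> 'a) \<Rightarrow> bool" where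
  "diffeomorphism f \<longleftrightarrow> bij f \<and> smooth_map f \<and> smooth_map (inv f)"

text \<open>
  No regularity in the parameter is required. Together with the expansion
  \<open>\<phi> \<epsilon> x = x + \<epsilon> X x + o(\<epsilon>)\<close> the group law makes \<open>\<phi>\<close> the flow of \<open>X\<close>, so for a test field
  \<open>X\<close> joint smoothness is then automatic.
\<close>

definition one_parameter_group :: "(real \<Rightarrow> 'a::euclidean_space \<Rightarrow> 'a) \<Rightarrow> bool" where
  "one_parameter_group \<phi> \<longleftrightarrow>
     (\<forall>\<epsilon>. diffeomorphism (\<phi> \<epsilon>)) \<and> \<phi> 0 = id \<and> (\<forall>s t. \<phi> (s + t) = \<phi> s \<circ> \<phi> t)"


text \<open>
  The line spanned by the unit vector \<open>\<tau>\<close> is the approximate tangent line to \<open>S\<close> at \<open>x\<close>: the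
  upper density of \<open>S\<close> at \<open>x\<close> is positive, and the part of \<open>S\<close> outside any cone around \<open>x + span {\<tau>}\<close>
  has density \<open>0\<close> at \<open>x\<close> (Mattila, \<open>Geometry of Sets and Measures in Euclidean Spaces\<close>,
  Definition 15.17). Such a line is unique if it exists, so \<open>\<tau>\<close> is unique up to sign.
\<close>

definition approx_tangent :: "'a::euclidean_space set \<Rightarrow> 'a \<Rightarrow> 'a \<Rightarrow> bool" where
  "approx_tangent S x \<tau> \<longleftrightarrow>
     norm \<tau> = 1 \<and>
     0 < Limsup (at_right 0) (\<lambda>r. hausdorff 1 (S \<inter> cball x r) / ennreal (2 * r)) \<and>
     (\<forall>s. 0 < s \<and> s < 1 \<longrightarrow>
        ((\<lambda>r. hausdorff 1 {y \<in> S \<inter> cball x r. s * norm (y - x) \<le> infdist (y - x) (span {\<tau>})}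
               / ennreal (2 * r)) \<longlongrightarrow> 0) (at_right 0))"

definition tangent_vector :: "'a::euclidean_space set \<Rightarrow> 'a \<Rightarrow> 'a" where
  "tangent_vector S x = (SOME \<tau>. approx_tangent S x \<tau>)"

definition tangential_div :: "'a::euclidean_space set \<Rightarrow> ('a \<Rightarrow> 'a) \<Rightarrow> 'a \<Rightarrow> real" where
  "tangential_div S X x =
     frechet_derivative X (at x) (tangent_vector S x) \<bullet> tangent_vector S x"

definition mean_curvature :: "'a::euclidean_space set \<Rightarrow> ('a \<Rightarrow> 'a) \<Rightarrow> real" where
  "mean_curvature S X = - (LINT x:S|hausdorff_measure 1. tangential_div S X x)"


definition avg_distance :: "'a::euclidean_space measure \<Rightarrow> real \<Rightarrow> 'a set \<Rightarrow> ennreal" where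
  "avg_distance \<mu> lam S =
     (\<integral>\<^sup>+ x. ennreal (infdist x S) \<partial>\<mu>) + ennreal lam * hausdorff 1 S"

definition avg_distance_minimizer :: "'a::euclidean_space measure \<Rightarrow> real \<Rightarrow> 'a set \<Rightarrow> bool" where
  "avg_distance_minimizer \<mu> lam S \<longleftrightarrow>
     S \<noteq> {} \<and> closed S \<and> connected S \<and>
     (\<forall>T. T \<noteq> {} \<and> closed T \<and> connected T \<longrightarrow> avg_distance \<mu> lam S \<le> avg_distance \<mu> lam T)"

definition gradient :: "('a::euclidean_space \<Rightarrow> real) \<Rightarrow> 'a \<Rightarrow> 'a" where
  "gradient f x = (THE g. GDERIV f x :> g)"

text \<open>
  \<^const>\<open>closest_point\<close> is an arbitrary nearest point on the ridge set, and \<^const>\<open>gradient\<close> is an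
  arbitrary vector where the distance is not differentiable. Both exceptional sets are
  \<open>\<mu>\<close>-negligible but the arbitrary values need not be Borel measurable there, so integrals of
  such expressions are taken with respect to the completion of \<open>\<mu>\<close>.
\<close>

definition projection_term :: "'a::euclidean_space measure \<Rightarrow> 'a set \<Rightarrow> ('a \<Rightarrow> 'a) \<Rightarrow> real" where
  "projection_term \<mu> S X =
     (LINT x|completion \<mu>.
        X (closest_point S x) \<bullet>
          ((closest_point S x - x) /\<^sub>R norm (closest_point S x - x)))"

definition gradient_term :: "'a::euclidean_space measure \<Rightarrow> 'a set \<Rightarrow> ('a \<Rightarrow> 'a) \<Rightarrow> real" where
  "gradient_term \<mu> S X =
     (LINT x|completion \<mu>. X (closest_point S x) \<bullet> gradient (\<lambda>y. infdist y S) x)"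

end

theory Submission
  imports Defs "HOL-Complex_Analysis.Great_Picard"
begin

text \<open>
  The distance term is differentiated under the integral. Where the nearest point \<open>p\<close> of \<open>x\<close> is
  unique, the distance from \<open>x\<close> to \<open>\<phi> \<epsilon> ` S\<close> has derivative \<open>X p \<bullet> sgn (p - x)\<close> at \<open>0\<close>. Monotonicity
  of the projection places the points with two nearest points on countably many Lipschitz graphs over
  coordinate hyperplanes, which are \<open>\<mu>\<close>-null.

  For the length term, walks through finer and finer nets of \<open>S\<close> converge to a Lipschitz curve that
  parametrises \<open>S\<close>. The dyadic energies \<open>\<Sum>|\<Delta>\<gamma>|\<^sup>2 / \<Delta>t\<close> of this curve increase to a finite limit; on
  a level close to the limit, a Vitali covering shows that outside a set of small measure all chords
  within a dyadic cell have almost the slope of the cell. This replaces differentiability almost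
  everywhere, and splits \<open>S\<close>, up to a null set, into compact pieces \<open>K\<close> all of whose chords are within
  \<open>\<delta>\<close> of one direction \<open>\<tau>\<close>. On such a piece \<open>\<phi> \<epsilon>\<close> multiplies distances by
  \<open>1 + \<epsilon> (DX \<tau> \<bullet> \<tau>)\<close> up to an error \<open>O(\<delta>|\<epsilon>| + \<epsilon>\<^sup>2)\<close>, and hence it multiplies \<open>\<H>\<^sup>1\<close> by the same factor.
  At density points of \<open>K\<close> the approximate tangent of \<open>S\<close> is within \<open>O(\<delta>)\<close> of \<open>\<tau>\<close>, so summing over the
  pieces with \<open>\<delta> = |\<epsilon>|\<close> gives the derivative of length with a quadratic error.
\<close>

section \<open>Hausdorff measures\<close>

text \<open>The flat pieces must depend on \<open>\<epsilon>\<close>: with a fixed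
  \<open>\<delta>\<close> the error \<open>\<delta> |\<epsilon>|\<close> is of first order, so a new
  cover is chosen for every \<open>\<epsilon>\<close>. The dyadic slopes of the curve form a
  martingale, the energy gap between two levels is the squared L2 distance of the slopes, and the
  Vitali estimate is the corresponding maximal inequality of weak type. The tangent vector is an
  arbitrary choice, so the tangential divergence is not measurable by construction; it is recovered
  as an almost everywhere limit of functions with countably many values. In the same way the
  nearest-point integrand is compared with a measurable limit of difference quotients of the
  distance. The expansion of \<open>\<phi>\<close> is only pointwise in \<open>x\<close>; the group
  law turns it into a differential equation, and Gronwall's inequality yields remainders that are
  quadratic in \<open>\<epsilon>\<close> uniformly in \<open>x\<close>, also for differences of two
  points. The set itself is \<open>\<mu>\<close>-null, because finite length implies finite measure
  in dimension \<open>n - 1 \<ge> 1\<close>.\<close>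

lemma hausdorff_weight_empty [simp]: "hausdorff_weight k {} = 0"
  by (simp add: hausdorff_weight_def)

lemma hausdorff_weight_1:
  "hausdorff_weight 1 C = ennreal (diameter C)" "hausdorff_weight (Suc 0) C = ennreal (diameter C)"
  by (simp_all add: hausdorff_weight_def unit_ball_vol_1)

lemma diameter_le_dist:
  assumes "0 \<le> \<delta>" "\<And>x y. x \<in> S \<Longrightarrow> y \<in> S \<Longrightarrow> dist x y \<le> \<delta>"
  shows "diameter S \<le> \<delta>"
  using assms by (auto simp: diameter_def intro!: cSUP_least)

section \<open>Covering premeasures, the outer measure and countable subadditivity\<close>

lemma hausdorff_premeasure_le:
  assumes "A \<subseteq> (\<Union>i. C i)" "\<And>i. bounded (C i)" "\<And>i. diameter (C i) \<le> \<delta>"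
  shows "hausdorff_premeasure \<delta> k A \<le> (\<Sum>i. hausdorff_weight k (C i))"
  unfolding hausdorff_premeasure_def by (rule INF_lower) (use assms in auto)

lemma hausdorff_premeasure_lessE:
  fixes A :: "'a::metric_space set"
  assumes "hausdorff_premeasure \<delta> k A < c"
  obtains C where "A \<subseteq> (\<Union>i::nat. C i)" "\<And>i. bounded (C i)" "\<And>i. diameter (C i) \<le> \<delta>"
    "(\<Sum>i. hausdorff_weight k (C i)) < c"
  using assms unfolding hausdorff_premeasure_def by (auto simp: INF_less_iff)

lemma hausdorff_premeasure_greatest:
  fixes A :: "'a::metric_space set"
  assumes "\<And>C. A \<subseteq> (\<Union>i::nat. C i) \<Longrightarrow> (\<And>i. bounded (C i)) \<Longrightarrow> (\<And>i. diameter (C i) \<le> \<delta>) \<Longrightarrow>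
             c \<le> (\<Sum>i. hausdorff_weight k (C i))"
  shows "c \<le> hausdorff_premeasure \<delta> k A"
  unfolding hausdorff_premeasure_def by (rule INF_greatest) (use assms in auto)

lemma hausdorff_premeasure_mono:
  "A \<subseteq> B \<Longrightarrow> hausdorff_premeasure \<delta> k A \<le> hausdorff_premeasure \<delta> k B"
  by (rule hausdorff_premeasure_greatest, rule hausdorff_premeasure_le) auto

lemma hausdorff_premeasure_antimono:
  "\<delta> \<le> \<delta>' \<Longrightarrow> hausdorff_premeasure \<delta>' k A \<le> hausdorff_premeasure \<delta> k A"
  by (rule hausdorff_premeasure_greatest, rule hausdorff_premeasure_le) (auto intro: order_trans)

lemma hausdorff_premeasure_empty [simp]: "0 \<le> \<delta> \<Longrightarrow> hausdorff_premeasure \<delta> k {} = 0"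
  using hausdorff_premeasure_le[of "{}" "\<lambda>_. {}" \<delta> k] by simp

lemma hausdorff_premeasure_le_weight:
  assumes "bounded A" "diameter A \<le> \<delta>" "0 \<le> \<delta>"
  shows "hausdorff_premeasure \<delta> k A \<le> hausdorff_weight k A"
proof -
  have "hausdorff_premeasure \<delta> k A \<le> (\<Sum>i. hausdorff_weight k (if i = (0::nat) then A else {}))"
    by (rule hausdorff_premeasure_le) (use assms in \<open>auto split: if_splits\<close>)
  also have "\<dots> = (\<Sum>i\<in>{0::nat}. hausdorff_weight k (if i = (0::nat) then A else {}))"
    by (rule suminf_finite) auto
  finally show ?thesis by simp
qed

lemma hausdorff_premeasure_UN_le:
  fixes A :: "nat \<Rightarrow> 'a::metric_space set"
  shows "hausdorff_premeasure \<delta> k (\<Union>i. A i) \<le> (\<Sum>i. hausdorff_premeasure \<delta> k (A i))"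
proof (rule ennreal_le_epsilon)
  fix e :: real
  assume fin: "(\<Sum>i. hausdorff_premeasure \<delta> k (A i)) < top" and e: "0 < e"
  let ?e = "\<lambda>i. ennreal (e * (1/2) ^ Suc i)"
  have "\<exists>C. A i \<subseteq> (\<Union>j::nat. C j) \<and> (\<forall>j. bounded (C j)) \<and> (\<forall>j. diameter (C j) \<le> \<delta>) \<and>
          (\<Sum>j. hausdorff_weight k (C j)) \<le> hausdorff_premeasure \<delta> k (A i) + ?e i" for i
  proof -
    have "hausdorff_premeasure \<delta> k (A i) \<le> (\<Sum>i. hausdorff_premeasure \<delta> k (A i))"
      using sum_le_suminf[of "\<lambda>i. hausdorff_premeasure \<delta> k (A i)" "{i}"] by simp
    then have "hausdorff_premeasure \<delta> k (A i) < top" using fin by (rule le_less_trans)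
    then have "hausdorff_premeasure \<delta> k (A i) < hausdorff_premeasure \<delta> k (A i) + ?e i"
      using e by (simp add: ennreal_add_left_cancel_less[of _ 0, simplified])
    then show ?thesis by (rule hausdorff_premeasure_lessE) (metis less_imp_le)
  qed
  then obtain C where C: "\<And>i. A i \<subseteq> (\<Union>j::nat. C i j)" "\<And>i j. bounded (C i j)"
      "\<And>i j. diameter (C i j) \<le> \<delta>"
      "\<And>i. (\<Sum>j. hausdorff_weight k (C i j)) \<le> hausdorff_premeasure \<delta> k (A i) + ?e i"
    by metis
  let ?D = "\<lambda>p. C (fst p) (snd p)"
  have "hausdorff_premeasure \<delta> k (\<Union>i. A i) \<le> (\<Sum>n. hausdorff_weight k (?D (prod_decode n)))"
  proof (rule hausdorff_premeasure_le)
    show "(\<Union>i. A i) \<subseteq> (\<Union>n. ?D (prod_decode n))"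
    proof
      fix x assume "x \<in> (\<Union>i. A i)"
      then obtain i j where "x \<in> C i j" using C(1) by blast
      then have "x \<in> ?D (prod_decode (prod_encode (i, j)))" by simp
      then show "x \<in> (\<Union>n. ?D (prod_decode n))" by blast
    qed
  qed (use C in auto)
  also have "\<dots> = (\<Sum>i. \<Sum>j. hausdorff_weight k (C i j))"
    by (rule suminf_ennreal_2dimen[where f="\<lambda>p. hausdorff_weight k (?D p)"]) simp
  also have "\<dots> \<le> (\<Sum>i. hausdorff_premeasure \<delta> k (A i) + ?e i)"
    by (intro suminf_le C) auto
  also have "\<dots> = (\<Sum>i. hausdorff_premeasure \<delta> k (A i)) + (\<Sum>i. ?e i)"
    by (intro suminf_add[symmetric]) auto
  also have "(\<Sum>i. ?e i) = ennreal e"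
    using sums_mult[OF power_half_series, of e] e by (intro suminf_ennreal_eq) auto
  finally show "hausdorff_premeasure \<delta> k (\<Union>i. A i) \<le> (\<Sum>i. hausdorff_premeasure \<delta> k (A i)) + ennreal e" .
qed

lemma hausdorff_premeasure_le_hausdorff: "0 < \<delta> \<Longrightarrow> hausdorff_premeasure \<delta> k A \<le> hausdorff k A"
  unfolding hausdorff_def by (rule SUP_upper) simp

lemma hausdorff_le:
  "(\<And>\<delta>. 0 < \<delta> \<Longrightarrow> hausdorff_premeasure \<delta> k A \<le> c) \<Longrightarrow> hausdorff k A \<le> c"
  unfolding hausdorff_def by (rule SUP_least) simp

lemma hausdorff_mono: "A \<subseteq> B \<Longrightarrow> hausdorff k A \<le> hausdorff k B"
  by (rule hausdorff_le) (meson hausdorff_premeasure_mono hausdorff_premeasure_le_hausdorff order_trans)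

lemma hausdorff_empty [simp]: "hausdorff k {} = 0"
  using hausdorff_le[of k "{}" 0] by simp

lemma hausdorff_UN_le:
  fixes A :: "nat \<Rightarrow> 'a::metric_space set"
  shows "hausdorff k (\<Union>i. A i) \<le> (\<Sum>i. hausdorff k (A i))"
  by (rule hausdorff_le, rule order_trans[OF hausdorff_premeasure_UN_le])
     (auto intro!: suminf_le hausdorff_premeasure_le_hausdorff)

lemma hausdorff_Un_le: "hausdorff k (A \<union> B) \<le> hausdorff k A + hausdorff k B"
proof -
  have "hausdorff k (A \<union> B) = hausdorff k (\<Union>i::nat. if i = 0 then A else if i = 1 then B else {})"
    by (rule arg_cong[where f="hausdorff k"]) (force split: if_splits)
  also have "\<dots> \<le> (\<Sum>i::nat. hausdorff k (if i = 0 then A else if i = 1 then B else {}))"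
    by (rule hausdorff_UN_le)
  also have "\<dots> = (\<Sum>i\<in>{0,1::nat}. hausdorff k (if i = 0 then A else if i = 1 then B else {}))"
    by (rule suminf_finite) auto
  finally show ?thesis by simp
qed

lemma hausdorff_null_UN:
  fixes A :: "nat \<Rightarrow> 'a::metric_space set"
  assumes "\<And>i. hausdorff k (A i) = 0"
  shows "hausdorff k (\<Union>i. A i) = 0"
  using hausdorff_UN_le[of k A] assms by simp

lemma hausdorff_null_subset: "A \<subseteq> B \<Longrightarrow> hausdorff k B = 0 \<Longrightarrow> hausdorff k A = 0"
  using hausdorff_mono[of A B k] by simp

text \<open>Abstract in \<open>f\<close> because it serves both the outer measure and the
  premeasure, for which no measure is at hand. Vitali families are countable but not indexed by
  numbers, and bounds for finite subfamilies are what disjointness provides.\<close>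

lemma countable_subadditive_UN_le:
  fixes f :: "'a set \<Rightarrow> ennreal"
  assumes sub: "\<And>A::nat \<Rightarrow> 'a set. f (\<Union>i. A i) \<le> (\<Sum>i. f (A i))" and f0: "f {} = 0"
    and C: "countable C"
    and le: "\<And>F. finite F \<Longrightarrow> F \<subseteq> C \<Longrightarrow> (\<Sum>i\<in>F. g i) \<le> c"
    and fg: "\<And>i. i \<in> C \<Longrightarrow> f (A i) \<le> g i"
  shows "f (\<Union>i\<in>C. A i) \<le> c"
proof -
  define B where "B n = (if n \<in> to_nat_on C ` C then A (from_nat_into C n) else {})" for n
  have B: "B (to_nat_on C i) = A i" if "i \<in> C" for i
    using that C by (simp add: B_def)
  have "(\<Union>i\<in>C. A i) = (\<Union>n. B n)"
  proof
    show "(\<Union>i\<in>C. A i) \<subseteq> (\<Union>n. B n)" using B by blast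
    show "(\<Union>n. B n) \<subseteq> (\<Union>i\<in>C. A i)"
      using C by (auto simp: B_def split: if_splits)
  qed
  then have "f (\<Union>i\<in>C. A i) \<le> (\<Sum>n. f (B n))" using sub by metis
  also have "\<dots> \<le> c"
  proof (rule suminf_le_const)
    fix n
    define F where "F = {i\<in>C. to_nat_on C i < n}"
    have inj: "inj_on (to_nat_on C) F"
      using inj_on_to_nat_on[OF C] by (rule inj_on_subset) (auto simp: F_def)
    have "finite (to_nat_on C ` F)" by (rule finite_subset[of _ "{..<n}"]) (auto simp: F_def)
    then have F: "finite F" using inj by (rule finite_imageD)
    have "(\<Sum>m<n. f (B m)) = (\<Sum>m\<in>to_nat_on C ` F. f (B m))"
      by (rule sum.mono_neutral_right) (auto simp: F_def B_def f0)
    also have "\<dots> = (\<Sum>i\<in>F. f (A i))"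
      by (subst sum.reindex[OF inj]) (auto simp: F_def B intro!: sum.cong)
    also have "\<dots> \<le> (\<Sum>i\<in>F. g i)" by (intro sum_mono fg) (auto simp: F_def)
    also have "\<dots> \<le> c" using F by (rule le) (auto simp: F_def)
    finally show "(\<Sum>m<n. f (B m)) \<le> c" .
  qed auto
  finally show ?thesis .
qed

section \<open>Caratheodory measurability of Borel sets and of null sets\<close>

lemma hausdorff_LIMSEQ:
  "(\<lambda>n. hausdorff_premeasure (inverse (real (Suc n))) k A) \<longlonglongrightarrow> hausdorff k A"
proof -
  have "incseq (\<lambda>n. hausdorff_premeasure (inverse (real (Suc n))) k A)"
    by (rule incseq_SucI, rule hausdorff_premeasure_antimono) simp
  then have "(\<lambda>n. hausdorff_premeasure (inverse (real (Suc n))) k A) \<longlonglongrightarrow>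
      (SUP n. hausdorff_premeasure (inverse (real (Suc n))) k A)"
    by (rule LIMSEQ_SUP)
  also have "(SUP n. hausdorff_premeasure (inverse (real (Suc n))) k A) = hausdorff k A"
  proof (rule antisym)
    show "(SUP n. hausdorff_premeasure (inverse (real (Suc n))) k A) \<le> hausdorff k A"
      by (rule SUP_least, rule hausdorff_premeasure_le_hausdorff) simp
    show "hausdorff k A \<le> (SUP n. hausdorff_premeasure (inverse (real (Suc n))) k A)"
    proof (rule hausdorff_le)
      fix \<delta> :: real assume "0 < \<delta>"
      then obtain n where "inverse (real (Suc n)) < \<delta>" using reals_Archimedean by blast
      then show "hausdorff_premeasure \<delta> k A \<le> (SUP n. hausdorff_premeasure (inverse (real (Suc n))) k A)"
        by (meson SUP_upper2 UNIV_I hausdorff_premeasure_antimono less_imp_le)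
    qed
  qed
  finally show ?thesis .
qed

text \<open>A set of diameter below \<open>d\<close> cannot meet both \<open>A\<close> and
  \<open>B\<close>, so a cover of the union with small mesh splits into a cover of \<open>A\<close>
  and a cover of \<open>B\<close>.\<close>

lemma hausdorff_Un_separated:
  assumes "0 < d" and sep: "\<And>x y. x \<in> A \<Longrightarrow> y \<in> B \<Longrightarrow> d \<le> dist x y"
  shows "hausdorff k (A \<union> B) = hausdorff k A + hausdorff k B"
proof (rule antisym[OF hausdorff_Un_le])
  have pre: "hausdorff_premeasure \<delta> k A + hausdorff_premeasure \<delta> k B \<le> hausdorff_premeasure \<delta> k (A \<union> B)"
    if "0 < \<delta>" "\<delta> < d" for \<delta>
  proof (rule hausdorff_premeasure_greatest)
    fix C :: "nat \<Rightarrow> 'a set"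
    assume C: "A \<union> B \<subseteq> (\<Union>i. C i)" "\<And>i. bounded (C i)" "\<And>i. diameter (C i) \<le> \<delta>"
    \<comment> \<open>Covering sets that miss \<open>A\<close> become empty, at weight 0, so that
      \<open>P\<close> remains a sequence; likewise \<open>Q\<close>.\<close>
    define P where "P i = (if C i \<inter> A \<noteq> {} then C i else {})" for i
    define Q where "Q i = (if C i \<inter> B \<noteq> {} then C i else {})" for i
    have disj: "C i \<inter> A = {} \<or> C i \<inter> B = {}" for i
    proof (rule ccontr)
      assume "\<not> ?thesis"
      then obtain x y where "x \<in> C i" "x \<in> A" "y \<in> C i" "y \<in> B" by blast
      then have "d \<le> diameter (C i)"
        using sep diameter_bounded_bound[OF C(2)] by (meson order_trans)
      then show False using C(3)[of i] that by linarith
    qed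
    have cov: "A \<subseteq> (\<Union>i. P i)" "B \<subseteq> (\<Union>i. Q i)"
    proof -
      have "x \<in> (\<Union>i. P i)" if x: "x \<in> A" for x
      proof -
        obtain i where "x \<in> C i" using x C(1) by blast
        then have "x \<in> P i" using x by (auto simp: P_def)
        then show ?thesis by blast
      qed
      then show "A \<subseteq> (\<Union>i. P i)" by blast
      have "x \<in> (\<Union>i. Q i)" if x: "x \<in> B" for x
      proof -
        obtain i where "x \<in> C i" using x C(1) by blast
        then have "x \<in> Q i" using x by (auto simp: Q_def)
        then show ?thesis by blast
      qed
      then show "B \<subseteq> (\<Union>i. Q i)" by blast
    qed
    have "hausdorff_premeasure \<delta> k A \<le> (\<Sum>i. hausdorff_weight k (P i))"
      by (rule hausdorff_premeasure_le[OF cov(1)]) (use C that in \<open>auto simp: P_def\<close>)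
    moreover have "hausdorff_premeasure \<delta> k B \<le> (\<Sum>i. hausdorff_weight k (Q i))"
      by (rule hausdorff_premeasure_le[OF cov(2)]) (use C that in \<open>auto simp: Q_def\<close>)
    ultimately have "hausdorff_premeasure \<delta> k A + hausdorff_premeasure \<delta> k B \<le>
        (\<Sum>i. hausdorff_weight k (P i)) + (\<Sum>i. hausdorff_weight k (Q i))"
      by (rule add_mono)
    also have "\<dots> = (\<Sum>i. hausdorff_weight k (P i) + hausdorff_weight k (Q i))"
      by (intro suminf_add) auto
    also have "\<dots> \<le> (\<Sum>i. hausdorff_weight k (C i))"
      using disj by (intro suminf_le) (auto simp: P_def Q_def)
    finally show "hausdorff_premeasure \<delta> k A + hausdorff_premeasure \<delta> k B \<le> (\<Sum>i. hausdorff_weight k (C i))" .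
  qed
  obtain N where N: "inverse (real (Suc N)) < d" using reals_Archimedean[OF \<open>0 < d\<close>] by blast
  show "hausdorff k A + hausdorff k B \<le> hausdorff k (A \<union> B)"
  proof (rule LIMSEQ_le[OF tendsto_add[OF hausdorff_LIMSEQ hausdorff_LIMSEQ] hausdorff_LIMSEQ], intro exI allI impI)
    fix n assume "N \<le> n"
    then have "inverse (real (Suc n)) \<le> inverse (real (Suc N))" by simp
    then show "hausdorff_premeasure (inverse (real (Suc n))) k A + hausdorff_premeasure (inverse (real (Suc n))) k B
        \<le> hausdorff_premeasure (inverse (real (Suc n))) k (A \<union> B)"
      using N by (intro pre) (simp, linarith)
  qed
qed

lemma ennreal_suminf_tail_tendsto_0:
  fixes f :: "nat \<Rightarrow> ennreal"
  assumes "(\<Sum>i. f i) < top"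
  shows "(\<lambda>n. \<Sum>i. f (i + n)) \<longlonglongrightarrow> 0"
proof -
  have "f i < top" for i
    using sum_le_suminf[of f "{i}"] assms by (simp add: le_less_trans)
  then have f: "ennreal (enn2real (f i)) = f i" for i by (simp add: less_top)
  let ?r = "\<lambda>i. enn2real (f i)"
  have sm: "summable ?r"
  proof (rule summable_suminf_not_top)
    show "(\<Sum>i. ennreal (?r i)) \<noteq> top" using assms by (simp add: f)
  qed simp
  have "(\<lambda>n. ennreal (\<Sum>i. ?r (i + n))) \<longlonglongrightarrow> ennreal 0"
    using suminf_exist_split2[OF sm] by (rule tendsto_ennrealI)
  moreover have "ennreal (\<Sum>i. ?r (i + n)) = (\<Sum>i. f (i + n))" for n
  proof -
    have "(\<Sum>i. f (i + n)) = (\<Sum>i. ennreal (?r (i + n)))" by (simp add: f)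
    also have "\<dots> = ennreal (\<Sum>i. ?r (i + n))"
      using sm summable_iff_shift[of ?r n] by (intro suminf_ennreal2) auto
    finally show ?thesis by simp
  qed
  ultimately show ?thesis by simp
qed

text \<open>Caratheodory's argument for metric outer measures. The part \<open>D n\<close> of
  \<open>A\<close> at distance at least \<open>1/(n+1)\<close> from \<open>F\<close> is separated
  from \<open>F\<close>, so additivity holds for it; what is left of \<open>- F \<inter> A\<close>
  is a tail of the rings \<open>R\<close>, and these tails have measure tending to 0.\<close>

lemma closed_in_lambda_system_hausdorff:
  fixes F :: "'a::metric_space set"
  assumes "closed F"
  shows "F \<in> lambda_system UNIV UNIV (hausdorff k)"
proof -
  have main: "hausdorff k (F \<inter> A) + hausdorff k (- F \<inter> A) \<le> hausdorff k A"
    if F: "F \<noteq> {}" and fin: "hausdorff k A < top" for A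
  proof -
    define D where "D n = {x \<in> A. inverse (real (Suc n)) \<le> infdist x F}" for n
    define R where "R n = D (Suc n) - D n" for n
    have DSuc: "D n \<subseteq> D (Suc n)" for n
    proof -
      have "inverse (real (Suc (Suc n))) \<le> inverse (real (Suc n))" by simp
      then have "inverse (real (Suc (Suc n))) \<le> infdist x F" if "inverse (real (Suc n)) \<le> infdist x F" for x
        using that by linarith
      then show ?thesis unfolding D_def by blast
    qed
    have Dm: "D m \<subseteq> D n" if "m \<le> n" for m n
      using that DSuc by (rule lift_Suc_mono_le[rotated])
    have FD: "hausdorff k (F \<inter> A) + hausdorff k (D n) \<le> hausdorff k A" for n
    proof -
      have "hausdorff k (F \<inter> A) + hausdorff k (D n) = hausdorff k ((F \<inter> A) \<union> D n)"
      proof (rule hausdorff_Un_separated[symmetric])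
        show "0 < inverse (real (Suc n))" by simp
        fix x y assume "x \<in> F \<inter> A" "y \<in> D n"
        then show "inverse (real (Suc n)) \<le> dist x y"
          using infdist_le[of x F y] by (auto simp: D_def dist_commute)
      qed
      also have "\<dots> \<le> hausdorff k A" by (rule hausdorff_mono) (auto simp: D_def)
      finally show ?thesis .
    qed
    \<comment> \<open>Consecutive rings touch, but two rings of equal parity have a whole ring
      between them, so their measures add up. The width of the ring next to the outermost index is
      \<open>?d\<close>.\<close>
    have R: "(\<Sum>m<N. hausdorff k (R (2 * m + p))) = hausdorff k (\<Union>m<N. R (2 * m + p))" for N p
    proof (induction N)
      case (Suc N)
      have "hausdorff k ((\<Union>m<N. R (2 * m + p)) \<union> R (2 * N + p)) =
              hausdorff k (\<Union>m<N. R (2 * m + p)) + hausdorff k (R (2 * N + p))"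
      proof (cases "N = 0")
        case False
        let ?d = "inverse (real (2 * N + p)) - inverse (real (Suc (2 * N + p)))"
        show ?thesis
        proof (rule hausdorff_Un_separated)
          show "0 < ?d" using False by simp
          fix x y assume x: "x \<in> (\<Union>m<N. R (2 * m + p))" and y: "y \<in> R (2 * N + p)"
          from x obtain m where "m < N" "x \<in> D (Suc (2 * m + p))" by (auto simp: R_def)
          moreover have "D (Suc (2 * m + p)) \<subseteq> D (2 * N + p - 1)" if "m < N" using that by (intro Dm) auto
          ultimately have "x \<in> D (2 * N + p - 1)" by blast
          then have "inverse (real (2 * N + p)) \<le> infdist x F" using False by (simp add: D_def)
          moreover have "infdist y F < inverse (real (Suc (2 * N + p)))"
            using y by (auto simp: R_def D_def)
          ultimately show "?d \<le> dist x y"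
            using infdist_triangle[of x F y] by linarith
        qed
      qed simp
      then show ?case using Suc by (simp add: lessThan_Suc Un_commute add.commute)
    qed simp
    have Rle: "(\<Sum>m<N. hausdorff k (R (2 * m + p))) \<le> hausdorff k A" for N p
      unfolding R by (rule hausdorff_mono) (auto simp: R_def D_def)
    have split: "(\<Sum>m<2*N. hausdorff k (R m)) =
        (\<Sum>m<N. hausdorff k (R (2 * m + 0))) + (\<Sum>m<N. hausdorff k (R (2 * m + 1)))" for N
      by (induction N) (auto simp: algebra_simps)
    \<comment> \<open>Each of the two parity classes contributes at most
      \<open>hausdorff k A\<close>, so the series converges.\<close>
    have "(\<Sum>m. hausdorff k (R m)) \<le> 2 * hausdorff k A"
    proof (rule suminf_le_const)
      fix n
      have "(\<Sum>m<n. hausdorff k (R m)) \<le> (\<Sum>m<2*n. hausdorff k (R m))"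
        by (rule sum_mono2) auto
      also have "\<dots> \<le> hausdorff k A + hausdorff k A" unfolding split by (intro add_mono Rle)
      finally show "(\<Sum>m<n. hausdorff k (R m)) \<le> 2 * hausdorff k A" by (simp add: mult_2)
    qed simp
    also have "\<dots> < top" using fin by (simp add: ennreal_mult_less_top)
    finally have tail: "(\<lambda>n. \<Sum>m. hausdorff k (R (m + n))) \<longlonglongrightarrow> 0"
      by (rule ennreal_suminf_tail_tendsto_0)
    have bound: "hausdorff k (F \<inter> A) + hausdorff k (- F \<inter> A) \<le>
        hausdorff k A + (\<Sum>m. hausdorff k (R (m + n)))" for n
    proof -
      have "- F \<inter> A \<subseteq> D n \<union> (\<Union>m. R (m + n))"
      proof
        fix x assume x: "x \<in> - F \<inter> A"
        then have "0 < infdist x F"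
          using in_closed_iff_infdist_zero[OF assms F] infdist_nonneg[of x F] by (metis ComplD IntD1 less_eq_real_def)
        then obtain j where "inverse (real (Suc j)) < infdist x F" using reals_Archimedean by blast
        then have j: "x \<in> D j" using x by (auto simp: D_def)
        \<comment> \<open>The first layer that contains \<open>x\<close> decides: either it is at
          most \<open>n\<close>, or \<open>x\<close> lies in the ring by which this layer exceeds
          the preceding one.\<close>
        define l where "l = (LEAST j. x \<in> D j)"
        have l: "x \<in> D l" unfolding l_def using j by (rule LeastI)
        show "x \<in> D n \<union> (\<Union>m. R (m + n))"
        proof (cases "l \<le> n")
          case True then show ?thesis using l Dm by blast
        next
          case False
          then obtain m where m: "l = Suc (m + n)" by (metis add.commute less_imp_Suc_add not_le)
          then have "x \<notin> D (m + n)" using not_less_Least[of "m + n" "\<lambda>j. x \<in> D j"] by (simp add: l_def)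
          then show ?thesis using l m by (auto simp: R_def)
        qed
      qed
      then have "hausdorff k (- F \<inter> A) \<le> hausdorff k (D n \<union> (\<Union>m. R (m + n)))"
        by (rule hausdorff_mono)
      also have "\<dots> \<le> hausdorff k (D n) + (\<Sum>m. hausdorff k (R (m + n)))"
        by (rule order_trans[OF hausdorff_Un_le]) (intro add_left_mono hausdorff_UN_le)
      finally have "hausdorff k (F \<inter> A) + hausdorff k (- F \<inter> A) \<le>
          (hausdorff k (F \<inter> A) + hausdorff k (D n)) + (\<Sum>m. hausdorff k (R (m + n)))"
        by (metis add_left_mono add.assoc)
      also have "\<dots> \<le> hausdorff k A + (\<Sum>m. hausdorff k (R (m + n)))"
        by (intro add_right_mono FD)
      finally show ?thesis .
    qed
    show ?thesis
      using LIMSEQ_le_const[OF tendsto_add[OF tendsto_const tail]] bound by auto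
  qed
  have "hausdorff k (F \<inter> A) + hausdorff k (- F \<inter> A) = hausdorff k A" for A
  proof (rule antisym)
    show "hausdorff k (F \<inter> A) + hausdorff k (- F \<inter> A) \<le> hausdorff k A"
      using main[of A] by (cases "F = {}"; cases "hausdorff k A = top") (auto simp: less_top)
    have "hausdorff k A = hausdorff k ((F \<inter> A) \<union> (- F \<inter> A))"
      by (rule arg_cong[where f="hausdorff k"]) auto
    then show "hausdorff k A \<le> hausdorff k (F \<inter> A) + hausdorff k (- F \<inter> A)"
      using hausdorff_Un_le[of k "F \<inter> A" "- F \<inter> A"] by simp
  qed
  then show ?thesis by (simp add: lambda_system_def Compl_eq_Diff_UNIV)
qed

lemma outer_measure_space_hausdorff: "outer_measure_space UNIV (hausdorff k)"
  by (auto simp: outer_measure_space_def positive_def increasing_def countably_subadditive_def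
      hausdorff_mono hausdorff_UN_le)

lemma sigma_algebra_UNIV: "sigma_algebra UNIV UNIV"
  using sigma_algebra_Pow[of UNIV] by simp

lemma measure_space_hausdorff:
  "measure_space UNIV (lambda_system UNIV UNIV (hausdorff k)) (hausdorff k)"
  by (rule sigma_algebra.caratheodory_lemma[OF sigma_algebra_UNIV outer_measure_space_hausdorff])

lemma space_hausdorff_measure [simp]: "space (hausdorff_measure k) = UNIV"
  by (simp add: hausdorff_measure_def)

lemma sets_hausdorff_measure: "sets (hausdorff_measure k) = lambda_system UNIV UNIV (hausdorff k)"
  unfolding hausdorff_measure_def
  using sigma_algebra.sigma_sets_eq[OF conjunct1[OF measure_space_hausdorff[of k, unfolded measure_space_def]]]
  by simp

lemma emeasure_hausdorff_measure:
  "A \<in> sets (hausdorff_measure k) \<Longrightarrow> emeasure (hausdorff_measure k) A = hausdorff k A"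
  using measure_space_hausdorff[of k] unfolding sets_hausdorff_measure
  unfolding hausdorff_measure_def
  by (auto simp: measure_space_def intro: emeasure_measure_of_sigma)

lemma borel_subset_hausdorff_measure:
  assumes "A \<in> sets borel"
  shows "A \<in> sets (hausdorff_measure k)"
proof -
  have "sets borel = sigma_sets UNIV {S::'a set. closed S}"
    unfolding borel_eq_closed by (rule sets_measure_of) simp
  moreover have "sigma_sets (space (hausdorff_measure k)) {S::'a set. closed S} \<subseteq> sets (hausdorff_measure k)"
    by (rule sets.sigma_sets_subset) (auto simp: sets_hausdorff_measure closed_in_lambda_system_hausdorff)
  ultimately show ?thesis using assms by auto
qed

lemma hausdorff_null_sets:
  assumes "hausdorff k N = 0"
  shows "N \<in> null_sets (hausdorff_measure k)"
proof -
  have "hausdorff k (N \<inter> A) + hausdorff k (- N \<inter> A) = hausdorff k A" for A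
  proof -
    have 0: "hausdorff k (N \<inter> A) = 0" using assms by (rule hausdorff_null_subset[rotated]) auto
    have "hausdorff k A \<le> hausdorff k ((N \<inter> A) \<union> (- N \<inter> A))" by (rule hausdorff_mono) auto
    then have "hausdorff k A \<le> hausdorff k (- N \<inter> A)"
      using hausdorff_Un_le[of k "N \<inter> A" "- N \<inter> A"] 0 by simp
    moreover have "hausdorff k (- N \<inter> A) \<le> hausdorff k A" by (rule hausdorff_mono) auto
    ultimately show ?thesis using 0 by simp
  qed
  then have "N \<in> sets (hausdorff_measure k)"
    by (simp add: sets_hausdorff_measure lambda_system_def Compl_eq_Diff_UNIV)
  then show ?thesis using assms emeasure_hausdorff_measure by fastforce
qed

section \<open>Length of Lipschitz images, intervals and connected sets; comparison of
  dimensions\<close>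

lemma hausdorff_Lipschitz_image:
  fixes f :: "'a::metric_space \<Rightarrow> 'b::metric_space"
  assumes L: "L-lipschitz_on A f"
  shows "hausdorff 1 (f ` A) \<le> ennreal L * hausdorff 1 A"
proof (cases "hausdorff 1 A = top")
  case True
  have L0: "0 \<le> L" using L by (rule lipschitz_on_nonneg)
  show ?thesis
  \<comment> \<open>In \<open>ennreal\<close>, \<open>0 * top = 0\<close>. So for
    \<open>L = 0\<close> the bound is not trivially infinite; the image is then at most one
    point.\<close>
  proof (cases "L = 0")
    case False then show ?thesis using True L0 by (simp add: ennreal_mult_top)
  next
    case True
    have const: "f x = f y" if "x \<in> A" "y \<in> A" for x y
      using lipschitz_onD[OF L that] True by simp
    show ?thesis
    proof (rule hausdorff_le)
      fix \<delta> :: real assume "0 < \<delta>"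
      have bd: "bounded (f ` A)" unfolding bounded_two_points
      proof (intro exI ballI)
        fix x y assume "x \<in> f ` A" "y \<in> f ` A"
        then have "x = y" using const by blast
        then show "dist x y \<le> 0" by simp
      qed
      have "diameter (f ` A) \<le> 0" 
      proof (rule diameter_le_dist)
        fix x y assume "x \<in> f ` A" "y \<in> f ` A"
        then have "x = y" using const by blast
        then show "dist x y \<le> 0" by simp
      qed simp
      then have d0: "diameter (f ` A) = 0" using diameter_ge_0[OF bd] by simp
      have "hausdorff_premeasure \<delta> 1 (f ` A) \<le> hausdorff_weight 1 (f ` A)"
        by (rule hausdorff_premeasure_le_weight) (use d0 bd \<open>0 < \<delta>\<close> in auto)
      then show "hausdorff_premeasure \<delta> 1 (f ` A) \<le> ennreal L * hausdorff 1 A"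
        by (simp add: hausdorff_weight_1 d0)
    qed
  qed
next
  case False
  have L0: "0 \<le> L" using L by (rule lipschitz_on_nonneg)
  show ?thesis
  proof (rule hausdorff_le)
    fix \<delta>' :: real assume d': "0 < \<delta>'"
    \<comment> \<open>Dividing by \<open>L + 1\<close> in place of \<open>L\<close> covers
      \<open>L = 0\<close> as well.\<close>
    define \<delta> where "\<delta> = \<delta>' / (L + 1)"
    have d: "0 < \<delta>" "L * \<delta> \<le> \<delta>'" using d' L0 by (auto simp: \<delta>_def field_simps)
    show "hausdorff_premeasure \<delta>' 1 (f ` A) \<le> ennreal L * hausdorff 1 A"
    proof (rule ennreal_le_epsilon)
      fix e :: real assume "0 < e"
      define e' where "e' = e / (L + 1)"
      have e': "0 < e'" "L * e' \<le> e" using \<open>0 < e\<close> L0 by (auto simp: e'_def field_simps)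
      have "hausdorff_premeasure \<delta> 1 A \<le> hausdorff 1 A" using d by (intro hausdorff_premeasure_le_hausdorff)
      also have "\<dots> < hausdorff 1 A + ennreal e'"
        using False e' by (simp add: ennreal_add_left_cancel_less[of _ 0, simplified] less_top)
      finally obtain C where C: "A \<subseteq> (\<Union>i::nat. C i)" "\<And>i. bounded (C i)" "\<And>i. diameter (C i) \<le> \<delta>"
          "(\<Sum>i. hausdorff_weight 1 (C i)) < hausdorff 1 A + ennreal e'"
        by (rule hausdorff_premeasure_lessE) blast
      have Lip: "dist x y \<le> L * diameter (C i)" if "x \<in> f ` (C i \<inter> A)" "y \<in> f ` (C i \<inter> A)" for x y i
      proof -
        from that obtain u v where uv: "u \<in> C i \<inter> A" "v \<in> C i \<inter> A" "x = f u" "y = f v" by auto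
        then have "dist x y \<le> L * dist u v" using lipschitz_onD[OF L] by auto
        also have "\<dots> \<le> L * diameter (C i)"
          using uv L0 diameter_bounded_bound[OF C(2)] by (intro mult_left_mono) auto
        finally show ?thesis .
      qed
      have bd: "bounded (f ` (C i \<inter> A))" for i
        using Lip unfolding bounded_two_points by blast
      have dm: "diameter (f ` (C i \<inter> A)) \<le> L * diameter (C i)" for i
      by (rule diameter_le_dist) (use Lip L0 diameter_ge_0[OF C(2)] in auto)
      have "hausdorff_premeasure \<delta>' 1 (f ` A) \<le> (\<Sum>i. hausdorff_weight 1 (f ` (C i \<inter> A)))"
      proof (rule hausdorff_premeasure_le)
        show "f ` A \<subseteq> (\<Union>i. f ` (C i \<inter> A))" using C(1) by blast
        show "diameter (f ` (C i \<inter> A)) \<le> \<delta>'" for i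
          using dm[of i] mult_left_mono[OF C(3)[of i] L0] d by linarith
      qed (rule bd)
      also have "\<dots> \<le> (\<Sum>i. ennreal L * hausdorff_weight 1 (C i))"
        using dm L0 diameter_ge_0[OF C(2)]
        by (intro suminf_le) (auto simp: hausdorff_weight_1 simp flip: ennreal_mult intro: ennreal_leI)
      also have "\<dots> = ennreal L * (\<Sum>i. hausdorff_weight 1 (C i))" by simp
      also have "\<dots> \<le> ennreal L * (hausdorff 1 A + ennreal e')"
        using C(4) by (intro mult_left_mono) auto
      also have "\<dots> = ennreal L * hausdorff 1 A + ennreal (L * e')"
        using L0 e' by (simp add: distrib_left ennreal_mult)
      also have "\<dots> \<le> ennreal L * hausdorff 1 A + ennreal e"
        using e' by (intro add_left_mono ennreal_leI)
      finally show "hausdorff_premeasure \<delta>' 1 (f ` A) \<le> ennreal L * hausdorff 1 A + ennreal e" .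
    qed
  qed
qed

text \<open>The inverse map is Lipschitz with constant \<open>1 / c\<close>.\<close>

lemma hausdorff_expand_image:
  fixes f :: "'a::metric_space \<Rightarrow> 'b::metric_space"
  assumes c: "0 < c" and exp: "\<And>x y. x \<in> A \<Longrightarrow> y \<in> A \<Longrightarrow> c * dist x y \<le> dist (f x) (f y)"
  shows "ennreal c * hausdorff 1 A \<le> hausdorff 1 (f ` A)"
proof -
  have inj: "inj_on f A"
    using exp c by (intro inj_onI) (metis dist_eq_0_iff dist_le_zero_iff mult_le_0_iff not_le)
  have "(1 / c)-lipschitz_on (f ` A) (inv_into A f)"
    using c exp inj by (intro lipschitz_onI) (auto simp: field_simps)
  from hausdorff_Lipschitz_image[OF this]
  have "hausdorff 1 A \<le> ennreal (1 / c) * hausdorff 1 (f ` A)" using inj by simp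
  then have "ennreal c * hausdorff 1 A \<le> ennreal c * (ennreal (1 / c) * hausdorff 1 (f ` A))"
    by (rule mult_left_mono) simp
  also have "\<dots> = hausdorff 1 (f ` A)"
    using c by (simp flip: ennreal_mult mult.assoc)
  finally show ?thesis .
qed

lemma hausdorff_interval_le:
  fixes a b :: real
  assumes "a \<le> b"
  shows "hausdorff 1 {a..b} \<le> ennreal (b - a)"
proof (rule hausdorff_le)
  fix \<delta> :: real assume d: "0 < \<delta>"
  obtain N :: nat where N: "(b - a) / \<delta> < real N" using reals_Archimedean2 by blast
  have N0: "0 < real N" using N assms d by (meson divide_nonneg_pos diff_ge_0_iff_ge le_less_trans)
  define h where "h = (b - a) / real N"
  have h: "0 \<le> h" "h \<le> \<delta>" "real N * h = b - a"
    using N N0 assms d by (auto simp: h_def field_simps)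
  define C where "C i = (if i < N then {a + real i * h .. a + real (Suc i) * h} else {})" for i
  have diam: "diameter {a + real i * h .. a + real (Suc i) * h} = h" for i
    using h by (simp add: algebra_simps)
  have "hausdorff_premeasure \<delta> 1 {a..b} \<le> (\<Sum>i. hausdorff_weight 1 (C i))"
  proof (rule hausdorff_premeasure_le)
    show "{a..b} \<subseteq> (\<Union>i. C i)"
    proof
      fix x assume x: "x \<in> {a..b}"
      show "x \<in> (\<Union>i. C i)"
      \<comment> \<open>The right end point belongs to the last interval; the floor used for the
        other points would give the index \<open>N\<close>.\<close>
      proof (cases "x = b")
        case True
        have "real (N - 1) * h + h = real N * h" using N0 by (simp add: of_nat_diff algebra_simps)
        then have "x \<in> C (N - 1)" using True N0 h by (auto simp: C_def of_nat_diff algebra_simps)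
        then show ?thesis by blast
      next
        case False
        then have hp: "0 < h" using x N0 by (auto simp: h_def)
        define i where "i = nat \<lfloor>(x - a) / h\<rfloor>"
        have i1: "real i \<le> (x - a) / h" using x hp by (simp add: i_def)
        have i2: "(x - a) / h < real i + 1" unfolding i_def using x hp by simp
        have "(x - a) / h < real N" using False x h hp by (simp add: field_simps)
        then have "i < N" using i1 by linarith
        moreover have "a + real i * h \<le> x" "x \<le> a + real (Suc i) * h"
          using i1 i2 hp by (auto simp: field_simps)
        ultimately have "x \<in> C i" by (simp add: C_def)
        then show ?thesis by blast
      qed
    qed
    show "diameter (C i) \<le> \<delta>" for i using diam h d by (simp add: C_def)
    show "bounded (C i)" for i by (simp add: C_def)
  qed
  also have "\<dots> = (\<Sum>i<N. hausdorff_weight 1 (C i))"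
    by (rule suminf_finite) (auto simp: C_def)
  also have "\<dots> = (\<Sum>i<N. ennreal h)"
    by (rule sum.cong) (simp_all add: C_def hausdorff_weight_1(2) diam[simplified])
  also have "\<dots> = ennreal (b - a)"
    using h by (simp add: ennreal_of_nat_eq_real_of_nat flip: ennreal_mult)
  finally show "hausdorff_premeasure \<delta> 1 {a..b} \<le> ennreal (b - a)" .
qed

text \<open>Comparison with Lebesgue measure: a covering set lies in the interval from its infimum
  to its supremum, whose length is at most its diameter, and Lebesgue measure is countably
  subadditive. The mesh \<open>1\<close> is an arbitrary choice.\<close>

lemma hausdorff_interval_ge:
  fixes a b :: real
  assumes "a \<le> b"
  shows "ennreal (b - a) \<le> hausdorff 1 {a..b}"
proof -
  have "ennreal (b - a) \<le> hausdorff_premeasure 1 1 {a..b}"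
  proof (rule hausdorff_premeasure_greatest)
    fix C :: "nat \<Rightarrow> real set"
    assume C: "{a..b} \<subseteq> (\<Union>i. C i)" "\<And>i. bounded (C i)"
    define D where "D i = (if C i = {} then {} else {Inf (C i)..Sup (C i)})" for i
    have CD: "C i \<subseteq> D i" for i
      using bounded_imp_bdd_above[OF C(2)[of i]] bounded_imp_bdd_below[OF C(2)[of i]]
      by (auto simp: D_def intro: cInf_lower cSup_upper)
    have D: "emeasure lborel (D i) \<le> hausdorff_weight 1 (C i)" for i
    proof (cases "C i = {}")
      case False
      have "Sup (C i) \<le> Inf (C i) + diameter (C i)"
      proof (rule cSup_least[OF False])
        fix x assume x: "x \<in> C i"
        have "x - diameter (C i) \<le> Inf (C i)"
        proof (rule cInf_greatest[OF False])
          fix y assume "y \<in> C i"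
          then show "x - diameter (C i) \<le> y"
            using diameter_bounded_bound[OF C(2)[of i] x, of y] by (auto simp: dist_real_def)
        qed
        then show "x \<le> Inf (C i) + diameter (C i)" by simp
      qed
      then show ?thesis using False
        by (cases "Inf (C i) \<le> Sup (C i)") (auto simp: D_def hausdorff_weight_1 intro: ennreal_leI)
    qed (simp add: D_def)
    have "ennreal (b - a) = emeasure lborel {a..b}" using assms by simp
    also have "\<dots> \<le> emeasure lborel (\<Union>i. D i)"
    proof (rule emeasure_mono)
      show "{a..b} \<subseteq> (\<Union>i. D i)" using C(1) CD by blast
    qed (auto simp: D_def)
    also have "\<dots> \<le> (\<Sum>i. emeasure lborel (D i))"
      by (rule emeasure_subadditive_countably) (auto simp: D_def)
    also have "\<dots> \<le> (\<Sum>i. hausdorff_weight 1 (C i))" by (intro suminf_le D) auto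
    finally show "ennreal (b - a) \<le> (\<Sum>i. hausdorff_weight 1 (C i))" .
  qed
  also have "\<dots> \<le> hausdorff 1 {a..b}" by (rule hausdorff_premeasure_le_hausdorff) simp
  finally show ?thesis .
qed

text \<open>The 1-Lipschitz function \<open>dist x\<close> takes all values in \<open>{0..r}\<close>
  on \<open>S \<inter> cball x r\<close>, and such functions do not increase length. This lower
  density bound controls the size of nets, makes the upper density in \<open>approx_tangent\<close>
  positive and bounds a continuum by its length.\<close>

lemma hausdorff_connected_ge:
  fixes S :: "'a::metric_space set"
  assumes "connected S" "x \<in> S" "y \<in> S" "0 \<le> r" "r \<le> dist x y"
  shows "ennreal r \<le> hausdorff 1 (S \<inter> cball x r)"
proof -
  have "connected (dist x ` S)"
    by (intro connected_continuous_image continuous_intros assms)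
  moreover have "0 \<in> dist x ` S" "dist x y \<in> dist x ` S" using assms by (auto intro!: image_eqI[of _ _ x])
  ultimately have "{0..dist x y} \<subseteq> dist x ` S" by (rule connected_contains_Icc)
  then have sub: "{0..r} \<subseteq> dist x ` (S \<inter> cball x r)" using assms(5) by force
  have "1-lipschitz_on (S \<inter> cball x r) (dist x)"
    by (rule lipschitz_onI) (auto simp: dist_real_def abs_le_iff, (smt (verit) dist_commute dist_triangle)+)
  note Lip = hausdorff_Lipschitz_image[OF this]
  have "ennreal r \<le> hausdorff 1 {0..r}" using hausdorff_interval_ge[of 0 r] assms by simp
  also have "\<dots> \<le> hausdorff 1 (dist x ` (S \<inter> cball x r))" using sub by (rule hausdorff_mono)
  also have "\<dots> \<le> hausdorff 1 (S \<inter> cball x r)" using Lip by simp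
  finally show ?thesis .
qed

text \<open>For sets of diameter at most 1 a higher power of half the diameter is smaller, so the
  weights compare up to the ratio \<open>c\<close> of ball volumes. With \<open>k = 1\<close> and
  \<open>m = n - 1\<close> this makes \<open>S\<close> a \<open>\<mu>\<close>-null set.\<close>

lemma hausdorff_finite_dimension_mono:
  assumes fin: "hausdorff k A < top" and km: "k \<le> m"
  shows "hausdorff m A < top"
proof -
  define c where "c = unit_ball_vol (real m) / unit_ball_vol (real k)"
  have uk: "0 < unit_ball_vol (real k)" and um: "0 < unit_ball_vol (real m)" by auto
  then have c: "0 \<le> c" by (simp add: c_def)
  have w: "hausdorff_weight m C \<le> ennreal c * hausdorff_weight k C"
    if "bounded C" "diameter C \<le> 1" for C :: "'a set"
  proof (cases "C = {}")
    case False
    have d: "0 \<le> diameter C / 2" "diameter C / 2 \<le> 1" using that diameter_ge_0[OF that(1)] by auto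
    have "unit_ball_vol (real m) * (diameter C / 2) ^ m \<le> unit_ball_vol (real m) * (diameter C / 2) ^ k"
      using d km um by (intro mult_left_mono power_decreasing) auto
    also have "\<dots> = c * (unit_ball_vol (real k) * (diameter C / 2) ^ k)"
      unfolding c_def by (metis (no_types) less_irrefl mult.assoc nonzero_eq_divide_eq uk)
    finally show ?thesis using False c d uk by (simp add: hausdorff_weight_def ennreal_leI flip: ennreal_mult)
  qed simp
  have "hausdorff m A \<le> ennreal c * (hausdorff k A + 1)"
  proof (rule hausdorff_le)
    fix \<delta> :: real assume d: "0 < \<delta>"
    define \<delta>' where "\<delta>' = min \<delta> 1"
    have d': "0 < \<delta>'" "\<delta>' \<le> \<delta>" "\<delta>' \<le> 1" using d by (auto simp: \<delta>'_def)
    have "hausdorff_premeasure \<delta>' k A \<le> hausdorff k A" using d'(1) by (rule hausdorff_premeasure_le_hausdorff)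
    also have "\<dots> < hausdorff k A + 1"
      using fin by (simp add: ennreal_add_left_cancel_less[of _ 0, simplified])
    finally obtain C where C: "A \<subseteq> (\<Union>i::nat. C i)" "\<And>i. bounded (C i)" "\<And>i. diameter (C i) \<le> \<delta>'"
        "(\<Sum>i. hausdorff_weight k (C i)) < hausdorff k A + 1"
      by (rule hausdorff_premeasure_lessE) blast
    have "hausdorff_premeasure \<delta> m A \<le> (\<Sum>i. hausdorff_weight m (C i))"
      using C d' by (intro hausdorff_premeasure_le) (auto intro: order_trans)
    also have "\<dots> \<le> (\<Sum>i. ennreal c * hausdorff_weight k (C i))"
      using C d' by (intro suminf_le w) (auto intro: order_trans)
    also have "\<dots> = ennreal c * (\<Sum>i. hausdorff_weight k (C i))" by simp
    also have "\<dots> \<le> ennreal c * (hausdorff k A + 1)" using C(4) by (intro mult_left_mono) auto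
    finally show "hausdorff_premeasure \<delta> m A \<le> ennreal c * (hausdorff k A + 1)" .
  qed
  also have "\<dots> < top" using fin by (simp add: ennreal_mult_less_top)
  finally show ?thesis .
qed

section \<open>Continua of finite length are Lipschitz curves\<close>

text \<open>A connected graph is explored by detours: a new vertex \<open>v\<close> adjacent to a
  visited \<open>u\<close> enters by replacing one occurrence of \<open>u\<close> by
  \<open>u, v, u\<close>, at the price of two entries. The length is thus linear in the number of
  vertices, which is what makes the limit curve Lipschitz.\<close>

lemma closed_walk_covering:
  assumes V: "finite V" "V \<noteq> {}"
    and sym: "\<And>u v. E u v \<Longrightarrow> E v u"
    and conn: "\<And>U. U \<subseteq> V \<Longrightarrow> U \<noteq> {} \<Longrightarrow> U \<noteq> V \<Longrightarrow> \<exists>u\<in>U. \<exists>v\<in>V - U. E u v"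
  shows "\<exists>ws. set ws = V \<and> successively E ws \<and> length ws = 2 * card V - 1"
proof -
  have ex: "\<exists>ws. set ws \<subseteq> V \<and> card (set ws) = Suc k \<and> successively E ws \<and> length ws = 2 * k + 1"
    if "Suc k \<le> card V" for k
    using that
  proof (induction k)
    case 0
    obtain v where "v \<in> V" using V by blast
    then show ?case by (intro exI[of _ "[v]"]) auto
  next
    case (Suc k)
    then obtain ws where ws: "set ws \<subseteq> V" "card (set ws) = Suc k" "successively E ws" "length ws = 2 * k + 1"
      by auto
    have "set ws \<noteq> V" "set ws \<noteq> {}" using ws Suc.prems by auto
    then obtain u v where uv: "u \<in> set ws" "v \<in> V" "v \<notin> set ws" "E u v" using conn[OF ws(1)] by blast
    obtain p q where pq: "ws = p @ u # q" using uv(1) by (meson split_list)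
    let ?w = "p @ u # v # u # q"
    have "successively E ?w"
      using ws(3) uv(4) sym[OF uv(4)] unfolding pq by (auto simp: successively_append_iff successively_Cons)
    moreover have "set ?w = insert v (set ws)" by (auto simp: pq)
    then have "set ?w \<subseteq> V" "card (set ?w) = Suc (Suc k)" using ws uv by auto
    moreover have "length ?w = 2 * Suc k + 1" using ws(4) by (simp add: pq)
    ultimately show ?case by blast
  qed
  have "card V \<noteq> 0" using V by simp
  then obtain k where k: "card V = Suc k" using not0_implies_Suc by blast
  from ex[of k] obtain ws where ws: "set ws \<subseteq> V" "card (set ws) = Suc k" "successively E ws" "length ws = 2 * k + 1"
    using k by auto
  have "set ws = V" using ws V k by (intro card_subset_eq) auto
  then show ?thesis using ws k by auto
qed

lemma successively_nthD:
  "successively P xs \<Longrightarrow> Suc i < length xs \<Longrightarrow> P (xs ! i) (xs ! Suc i)"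
proof (induction xs arbitrary: i)
  case (Cons x xs)
  then show ?case by (cases i; cases xs) auto
qed simp

lemma successively_dist_nth:
  fixes ws :: "'a::metric_space list"
  assumes s: "successively (\<lambda>u v. dist u v < c) ws" and "i \<le> j" "j < length ws"
  shows "dist (ws ! i) (ws ! j) \<le> c * (real j - real i)"
  using assms(2,3)
proof (induction j rule: dec_induct)
  case (step j)
  have "dist (ws ! i) (ws ! Suc j) \<le> dist (ws ! i) (ws ! j) + dist (ws ! j) (ws ! Suc j)"
    by (rule dist_triangle)
  also have "\<dots> \<le> c * (real j - real i) + c"
    using step successively_nthD[OF s step.prems] by (intro add_mono) auto
  finally show ?case by (simp add: algebra_simps)
qed simp

lemma hausdorff_sum_disjoint:
  assumes "finite F" "disjoint_family_on A F" "\<And>i. i \<in> F \<Longrightarrow> A i \<in> sets borel"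
  shows "(\<Sum>i\<in>F. hausdorff k (A i)) = hausdorff k (\<Union>i\<in>F. A i)"
proof -
  have m: "A i \<in> sets (hausdorff_measure k)" if "i \<in> F" for i
    using assms(3)[OF that] by (rule borel_subset_hausdorff_measure)
  have "(\<Sum>i\<in>F. hausdorff k (A i)) = (\<Sum>i\<in>F. emeasure (hausdorff_measure k) (A i))"
    by (intro sum.cong refl emeasure_hausdorff_measure[symmetric] m)
  also have "\<dots> = emeasure (hausdorff_measure k) (\<Union>i\<in>F. A i)"
    using m assms by (intro sum_emeasure) auto
  also have "\<dots> = hausdorff k (\<Union>i\<in>F. A i)"
    using m assms by (intro emeasure_hausdorff_measure sets.finite_UN) auto
  finally show ?thesis .
qed

text \<open>A maximal \<open>e\<close>-separated subset \<open>V\<close> of \<open>S\<close> is an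
  \<open>e\<close>-net. The disjoint balls of radius \<open>e / 3\<close> about its points each
  carry length at least \<open>e / 3\<close>, so \<open>card V * e\<close> is at most three times
  the length of \<open>S\<close>, and the walk has fewer than \<open>2 * card V\<close> entries:
  hence the factor 6. Two parts of \<open>V\<close> without a link shorter than \<open>2 * e\<close>
  would disconnect \<open>S\<close>.\<close>

lemma connected_net_walk:
  fixes S :: "'a::metric_space set"
  assumes S: "closed S" "connected S" and pq: "p \<in> S" "q \<in> S" and e: "0 < e" "e \<le> dist p q"
    and fin: "hausdorff 1 S < top"
  shows "\<exists>ws. ws \<noteq> [] \<and> set ws \<subseteq> S \<and> successively (\<lambda>u v. dist u v < 2 * e) ws \<and>
    (\<forall>x\<in>S. \<exists>w\<in>set ws. dist x w < e) \<and> real (length ws) * e \<le> 6 * enn2real (hausdorff 1 S)"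
proof -
  define h where "h = enn2real (hausdorff 1 S)"
  have h: "hausdorff 1 S = ennreal h" "0 \<le> h" using fin by (auto simp: h_def less_top)
  define P where "P V \<longleftrightarrow> finite V \<and> V \<subseteq> S \<and> (\<forall>u\<in>V. \<forall>v\<in>V. u \<noteq> v \<longrightarrow> e \<le> dist u v)" for V
  have bound: "real (card V) * e \<le> 3 * h" if "P V" for V
  proof -
    have V: "finite V" "V \<subseteq> S" "\<And>u v. u \<in> V \<Longrightarrow> v \<in> V \<Longrightarrow> u \<noteq> v \<Longrightarrow> e \<le> dist u v"
      using that by (auto simp: P_def)
    have "(\<Sum>z\<in>V. ennreal (e / 3)) \<le> (\<Sum>z\<in>V. hausdorff 1 (S \<inter> cball z (e / 3)))"
    proof (rule sum_mono)
      fix z assume "z \<in> V"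
      then have z: "z \<in> S" using V by auto
      \<comment> \<open>The lower bound on length needs a point of \<open>S\<close> at distance at
        least \<open>e / 3\<close> from \<open>z\<close>; since \<open>p\<close> and
        \<open>q\<close> are at least \<open>e\<close> apart, one of them is such a point.\<close>
      have "e / 3 \<le> dist z p \<or> e / 3 \<le> dist z q"
        using dist_triangle3[of p q z] e by linarith
      then show "ennreal (e / 3) \<le> hausdorff 1 (S \<inter> cball z (e / 3))"
        using hausdorff_connected_ge[OF S(2) z] pq e by auto
    qed
    also have "\<dots> = hausdorff 1 (\<Union>z\<in>V. S \<inter> cball z (e / 3))"
    proof (rule hausdorff_sum_disjoint)
      show "disjoint_family_on (\<lambda>z. S \<inter> cball z (e / 3)) V"
        unfolding disjoint_family_on_def
      proof (intro ballI impI)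
        fix u v assume uv: "u \<in> V" "v \<in> V" "u \<noteq> v"
        show "S \<inter> cball u (e / 3) \<inter> (S \<inter> cball v (e / 3)) = {}"
        proof (rule ccontr)
          assume "\<not> ?thesis"
          then obtain x where "dist u x \<le> e / 3" "dist v x \<le> e / 3" by auto
          then show False using V(3)[OF uv] dist_triangle2[of u v x] e by linarith
        qed
      qed
    qed (use V S in auto)
    also have "\<dots> \<le> hausdorff 1 S" by (rule hausdorff_mono) auto
    finally have "(\<Sum>z\<in>V. ennreal (e / 3)) \<le> ennreal h" unfolding h(1) .
    moreover have "(\<Sum>z\<in>V. ennreal (e / 3)) = ennreal (real (card V) * (e / 3))"
      using e by (simp add: ennreal_of_nat_eq_real_of_nat flip: ennreal_mult)
    ultimately have "ennreal (real (card V) * (e / 3)) \<le> ennreal h" by simp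
    then have "real (card V) * (e / 3) \<le> h" unfolding ennreal_le_iff[OF h(2)] .
    then show ?thesis by simp
  qed
  \<comment> \<open>The bound on cardinalities lets a largest separated set exist.\<close>
  have "\<exists>V. P V \<and> (\<forall>W. P W \<longrightarrow> card W \<le> card V)"
  proof (rule ex_has_greatest_nat[of P "{}" card "nat \<lceil>3 * h / e\<rceil> + 1"])
    show "P {}" by (simp add: P_def)
    show "\<forall>W. P W \<longrightarrow> card W < nat \<lceil>3 * h / e\<rceil> + 1"
    proof (intro allI impI)
      fix W assume "P W"
      then have "real (card W) \<le> 3 * h / e" using bound e by (simp add: field_simps)
      then show "card W < nat \<lceil>3 * h / e\<rceil> + 1" by linarith
    qed
  qed
  then obtain V where V: "P V" and Vmax: "\<And>W. P W \<Longrightarrow> card W \<le> card V" by blast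
  have near: "\<exists>z\<in>V. dist x z < e" if x: "x \<in> S" for x
  proof (rule ccontr)
    assume far: "\<not> ?thesis"
    then have "x \<notin> V" using e by force
    moreover have "P (insert x V)" using V x far unfolding P_def by (auto simp: dist_commute not_less)
    ultimately show False using Vmax[of "insert x V"] V by (simp add: P_def)
  qed
  have "\<exists>ws. set ws = V \<and> successively (\<lambda>u v. dist u v < 2 * e) ws \<and> length ws = 2 * card V - 1"
  proof (rule closed_walk_covering)
    show "finite V" using V by (simp add: P_def)
    show "V \<noteq> {}" using near[OF pq(1)] by auto
    fix U assume U: "U \<subseteq> V" "U \<noteq> {}" "U \<noteq> V"
    let ?A = "\<Union>u\<in>U. ball u e" and ?B = "\<Union>v\<in>V - U. ball v e"
    have "S \<subseteq> ?A \<union> ?B"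
    proof
      fix x assume "x \<in> S"
      then obtain z where "z \<in> V" "dist x z < e" using near by blast
      then have "z \<in> V" "x \<in> ball z e" by (auto simp: dist_commute)
      then show "x \<in> ?A \<union> ?B" by blast
    qed
    moreover have ballS: "ball z e \<inter> S \<noteq> {}" if "z \<in> V" for z
    proof -
      have "z \<in> ball z e \<inter> S" using that V e by (auto simp: P_def)
      then show ?thesis by blast
    qed
    then have "?A \<inter> S \<noteq> {}" "?B \<inter> S \<noteq> {}" using U by blast+
    ultimately have "?A \<inter> ?B \<inter> S \<noteq> {}"
      using connectedD[OF S(2), of ?A ?B] by blast
    then obtain x where "x \<in> ?A" "x \<in> ?B" by blast
    then obtain u v where "u \<in> U" "v \<in> V - U" "dist u x < e" "dist v x < e" by auto
    then show "\<exists>u\<in>U. \<exists>v\<in>V - U. dist u v < 2 * e"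
      using dist_triangle2[of u v x] by (intro bexI[of _ u] bexI[of _ v]) auto
  qed (simp add: dist_commute)
  then obtain ws where ws: "set ws = V" "successively (\<lambda>u v. dist u v < 2 * e) ws" "length ws = 2 * card V - 1"
    by blast
  have "real (length ws) * e \<le> (2 * real (card V)) * e" using e ws(3) by (intro mult_right_mono) auto
  also have "\<dots> \<le> 6 * h" using bound[OF V] by (simp add: mult.commute)
  finally have "real (length ws) * e \<le> 6 * h" .
  moreover have "ws \<noteq> []" using near[OF pq(1)] ws(1) by auto
  moreover have "set ws \<subseteq> S" using ws(1) V by (simp add: P_def)
  moreover have "\<forall>x\<in>S. \<exists>w\<in>set ws. dist x w < e" using near ws(1) by simp
  ultimately show ?thesis using ws(2) by (intro exI[of _ ws] conjI) (simp_all add: h_def)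
qed

text \<open>Run at uniform speed over \<open>{0..1}\<close>, a walk makes \<open>M k\<close> steps
  shorter than \<open>2 * e k\<close>, where \<open>M k * e k\<close> is at most
  \<open>6 * h\<close>; so its step function \<open>g k\<close> is \<open>12 * h\<close>-Lipschitz
  up to the error \<open>2 * e k\<close>. A subsequence converges at all rationals, and the error
  vanishes in the limit. Step functions, unlike polygons, stay in \<open>S\<close>.\<close>

theorem continuum_Lipschitz_curve:
  fixes S :: "'a::euclidean_space set"
  assumes S: "compact S" "connected S" "S \<noteq> {}" and fin: "hausdorff 1 S < top"
  shows "\<exists>\<gamma> L. L-lipschitz_on {0..1::real} \<gamma> \<and> \<gamma> ` {0..1} = S"
proof (cases "\<exists>p\<in>S. \<exists>q\<in>S. p \<noteq> q")
  case False
  then obtain p where "S = {p}" using S(3) by blast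
  then show ?thesis
    by (intro exI[of _ "\<lambda>_. p"] exI[of _ 0]) (auto intro!: lipschitz_onI image_eqI[of p _ 0])
next
  case True
  then obtain p q where pq: "p \<in> S" "q \<in> S" "p \<noteq> q" by blast
  define h where "h = enn2real (hausdorff 1 S)"
  have h0: "0 \<le> h" by (simp add: h_def)
  define e where "e k = dist p q * inverse (real (Suc k))" for k
  have e: "0 < e k" "e k \<le> dist p q" for k
  proof -
    show "0 < e k" using pq by (simp add: e_def)
    have "inverse (real (Suc k)) \<le> 1" by (simp add: field_simps)
    then have "dist p q * inverse (real (Suc k)) \<le> dist p q * 1" by (rule mult_left_mono) simp
    then show "e k \<le> dist p q" by (simp add: e_def)
  qed
  have elim: "e \<longlonglongrightarrow> 0"
    unfolding e_def using tendsto_mult[OF tendsto_const LIMSEQ_inverse_real_of_nat, of "dist p q"] by simp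
  have "\<exists>ws. ws \<noteq> [] \<and> set ws \<subseteq> S \<and> successively (\<lambda>u v. dist u v < 2 * e k) ws \<and>
    (\<forall>x\<in>S. \<exists>w\<in>set ws. dist x w < e k) \<and> real (length ws) * e k \<le> 6 * h" for k
    unfolding h_def by (rule connected_net_walk[OF compact_imp_closed[OF S(1)] S(2) pq(1,2) e fin])
  then have "\<exists>W. \<forall>k. W k \<noteq> [] \<and> set (W k) \<subseteq> S \<and> successively (\<lambda>u v. dist u v < 2 * e k) (W k) \<and>
    (\<forall>x\<in>S. \<exists>w\<in>set (W k). dist x w < e k) \<and> real (length (W k)) * e k \<le> 6 * h"
    by (intro choice allI)
  then obtain W where W: "\<And>k. W k \<noteq> []" "\<And>k. set (W k) \<subseteq> S"
      "\<And>k. successively (\<lambda>u v. dist u v < 2 * e k) (W k)"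
      "\<And>k x. x \<in> S \<Longrightarrow> \<exists>w\<in>set (W k). dist x w < e k"
      "\<And>k. real (length (W k)) * e k \<le> 6 * h"
    by blast
  define M where "M k = length (W k)" for k
  have M: "0 < M k" for k using W(1) by (simp add: M_def)
  \<comment> \<open>For \<open>t\<close> in \<open>{0..1}\<close> the cap \<open>M k - 1\<close>
    takes effect at \<open>t = 1\<close> only.\<close>
  define idx where "idx k t = min (nat \<lfloor>t * real (M k)\<rfloor>) (M k - 1)" for k and t :: real
  have idx: "idx k t < M k" for k t using M[of k] by (auto simp: idx_def)
  define g where "g k t = W k ! idx k t" for k t
  have gS: "g k t \<in> S" for k t
    using W(2)[of k] idx[of k t] nth_mem[of "idx k t" "W k"] by (auto simp: g_def M_def)
  have idx_diff: "\<bar>real (idx k s) - real (idx k t)\<bar> \<le> \<bar>s - t\<bar> * real (M k) + 1" if "0 \<le> s" "0 \<le> t" for k s t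
  proof -
    let ?a = "s * real (M k)" and ?b = "t * real (M k)"
    have nn: "0 \<le> ?a" "0 \<le> ?b" using that by auto
    have "\<bar>real (min i c) - real (min j c)\<bar> \<le> \<bar>real i - real j\<bar>" for i j c :: nat
      by (auto simp: min_def)
    then have "\<bar>real (idx k s) - real (idx k t)\<bar> \<le> \<bar>real (nat \<lfloor>?a\<rfloor>) - real (nat \<lfloor>?b\<rfloor>)\<bar>"
      unfolding idx_def .
    also have "\<dots> = \<bar>of_int \<lfloor>?a\<rfloor> - of_int \<lfloor>?b\<rfloor>\<bar>" using nn by simp
    also have "\<dots> \<le> \<bar>?a - ?b\<bar> + 1" by linarith
    also have "\<bar>?a - ?b\<bar> = \<bar>s - t\<bar> * real (M k)" by (simp add: abs_mult flip: left_diff_distrib)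
    finally show ?thesis .
  qed
  have g_dist: "dist (g k s) (g k t) \<le> 12 * h * \<bar>s - t\<bar> + 2 * e k" if st: "0 \<le> s" "0 \<le> t" for k s t
  proof -
    have "dist (g k s) (g k t) \<le> 2 * e k * \<bar>real (idx k s) - real (idx k t)\<bar>"
    proof (cases "idx k s \<le> idx k t")
      case True
      then show ?thesis
        using successively_dist_nth[OF W(3) True] idx[of k t] by (simp add: g_def M_def abs_if)
    next
      case False
      then show ?thesis
        using successively_dist_nth[OF W(3), of "idx k t" "idx k s" k] idx[of k s]
        by (simp add: g_def M_def abs_if dist_commute)
    qed
    also have "\<dots> \<le> 2 * e k * (\<bar>s - t\<bar> * real (M k) + 1)"
      using idx_diff[OF st] e[of k] by (intro mult_left_mono) auto
    also have "\<dots> = 2 * \<bar>s - t\<bar> * (real (M k) * e k) + 2 * e k" by (simp add: algebra_simps)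
    also have "\<dots> \<le> 2 * \<bar>s - t\<bar> * (6 * h) + 2 * e k"
      using W(5)[of k] unfolding M_def by (intro add_right_mono mult_left_mono) auto
    finally show ?thesis by (simp add: algebra_simps)
  qed
  \<comment> \<open>Countable, so that a diagonal subsequence exists, and with closure
    \<open>{0..1}\<close>.\<close>
  define Q :: "real set" where "Q = {0<..<1} \<inter> \<rat>"
  have "countable Q" by (auto simp: Q_def countable_rat intro: countable_Int2)
  obtain B where B: "\<And>x. x \<in> S \<Longrightarrow> norm x \<le> B"
    using compact_imp_bounded[OF S(1)] unfolding bounded_iff by blast
  obtain r where r: "strict_mono (r :: nat \<Rightarrow> nat)" "\<And>t. t \<in> Q \<Longrightarrow> \<exists>l. (\<lambda>n. g (r n) t) \<longlonglongrightarrow> l"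
    by (rule function_convergent_subsequence[OF \<open>countable Q\<close>, of g B]) (use B[OF gS] in auto)
  then obtain l where l: "\<And>t. t \<in> Q \<Longrightarrow> (\<lambda>n. g (r n) t) \<longlonglongrightarrow> l t" by metis
  have er: "(\<lambda>n. e (r n)) \<longlonglongrightarrow> 0"
    using LIMSEQ_subseq_LIMSEQ[OF elim r(1)] by (simp add: comp_def)
  have "(12 * h)-lipschitz_on Q l"
  proof (rule lipschitz_onI)
    fix s t assume st: "s \<in> Q" "t \<in> Q"
    have "(\<lambda>n. dist (g (r n) s) (g (r n) t)) \<longlonglongrightarrow> dist (l s) (l t)"
      by (intro tendsto_dist l st)
    moreover have "(\<lambda>n. 12 * h * \<bar>s - t\<bar> + 2 * e (r n)) \<longlonglongrightarrow> 12 * h * \<bar>s - t\<bar> + 2 * 0"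
      by (intro tendsto_intros er)
    ultimately have "dist (l s) (l t) \<le> 12 * h * \<bar>s - t\<bar> + 2 * 0"
      by (rule LIMSEQ_le) (use g_dist st in \<open>auto simp: Q_def\<close>)
    then show "dist (l s) (l t) \<le> 12 * h * dist s t" by (simp add: dist_real_def)
  qed (use h0 in simp)
  then obtain \<gamma> where \<gamma>: "(12 * h)-lipschitz_on (closure Q) \<gamma>" "\<And>t. t \<in> Q \<Longrightarrow> \<gamma> t = l t"
    using lipschitz_extend_closure by blast
  have clQ: "closure Q = {0..1}"
    unfolding Q_def by (subst closure_open_Int_superset) (auto simp: Rats_closure_real)
  have cont: "continuous_on {0..1} \<gamma>" using \<gamma>(1) clQ by (metis lipschitz_on_continuous_on)
  have sub: "\<gamma> ` {0..1} \<subseteq> S"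
    unfolding clQ[symmetric]
  proof (rule image_closure_subset)
    show "continuous_on (closure Q) \<gamma>" using cont clQ by simp
    show "closed S" using S(1) by (rule compact_imp_closed)
    show "\<gamma> ` Q \<subseteq> S"
      using \<gamma>(2) closed_sequentially[OF compact_imp_closed[OF S(1)] gS l] by auto
  qed
  have "x \<in> \<gamma> ` {0..1}" if x: "x \<in> S" for x
  proof (rule ccontr)
    assume nx: "x \<notin> \<gamma> ` {0..1}"
    have cl: "closed (\<gamma> ` {0..1})" using compact_continuous_image[OF cont] by (auto intro: compact_imp_closed)
    define d where "d = infdist x (\<gamma> ` {0..1})"
    have d: "0 < d"
      using in_closed_iff_infdist_zero[OF cl, of x] nx infdist_nonneg[of x] by (auto simp: d_def less_le)
    \<comment> \<open>The final estimate adds up \<open>d / 12\<close> for the net,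
      \<open>d / 4 + d / 6\<close> along the walk and \<open>d / 4\<close> for the convergence at a
      rational: altogether less than \<open>d\<close>.\<close>
    define \<eta> where "\<eta> = d / (48 * h + 48)"
    have \<eta>: "0 < \<eta>" "12 * h * \<eta> < d / 4"
      using d h0 by (auto simp: \<eta>_def field_simps)
    have "{0..1} \<subseteq> (\<Union>q\<in>Q. ball q \<eta>)"
    proof
      fix t :: real assume "t \<in> {0..1}"
      then have "t \<in> closure Q" using clQ by simp
      then obtain q where "q \<in> Q" "dist q t < \<eta>" using \<eta>(1) unfolding closure_approachable by blast
      then show "t \<in> (\<Union>q\<in>Q. ball q \<eta>)" by auto
    qed
    \<comment> \<open>Convergence on \<open>Q\<close> is only pointwise. By compactness finitely
      many rationals are \<open>\<eta>\<close>-dense, and one \<open>n\<close> serves all of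
      them.\<close>
    then obtain T where T: "T \<subseteq> Q" "finite T" "{0..1} \<subseteq> (\<Union>q\<in>T. ball q \<eta>)"
      by (rule compactE_image[OF compact_Icc, rotated]) auto
    have "eventually (\<lambda>n. \<forall>q\<in>T. dist (g (r n) q) (l q) < d / 4) sequentially"
      using T(1,2) d by (intro eventually_ball_finite ballI tendstoD[OF l]) auto
    moreover have "eventually (\<lambda>n. dist (e (r n)) 0 < d / 12) sequentially"
      using d by (intro tendstoD[OF er]) auto
    ultimately have "eventually (\<lambda>n. (\<forall>q\<in>T. dist (g (r n) q) (l q) < d / 4) \<and> dist (e (r n)) 0 < d / 12) sequentially"
      by (rule eventually_conj)
    then obtain n where n: "\<And>q. q \<in> T \<Longrightarrow> dist (g (r n) q) (l q) < d / 4" "dist (e (r n)) 0 < d / 12"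
      unfolding eventually_sequentially by blast
    have en: "e (r n) < d / 12" using n(2) by (simp add: dist_real_def)
    obtain w where w: "w \<in> set (W (r n))" "dist x w < e (r n)" using W(4)[OF x] by blast
    then obtain i where i: "i < M (r n)" "W (r n) ! i = w" by (auto simp: in_set_conv_nth M_def)
    \<comment> \<open>A parameter at which the walk is at \<open>w\<close>.\<close>
    define t where "t = real i / real (M (r n))"
    have "idx (r n) t = i" using i(1) by (simp add: idx_def t_def)
    then have gt: "g (r n) t = w" using i by (simp add: g_def)
    have t: "t \<in> {0..1}" using i(1) by (simp add: t_def)
    then obtain q where q: "q \<in> T" "dist q t < \<eta>" using T(3) by auto
    then have qQ: "q \<in> Q" using T by auto
    have "dist w (g (r n) q) \<le> 12 * h * \<bar>t - q\<bar> + 2 * e (r n)"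
      using g_dist[of t q "r n"] t qQ gt by (auto simp: Q_def)
    also have "12 * h * \<bar>t - q\<bar> \<le> 12 * h * \<eta>"
      using q(2) h0 by (intro mult_left_mono) (auto simp: dist_real_def abs_minus_commute)
    finally have 1: "dist w (g (r n) q) < d / 4 + 2 * (d / 12)" using \<eta>(2) en by linarith
    have "dist x (\<gamma> q) \<le> dist x w + dist w (g (r n) q) + dist (g (r n) q) (l q)"
      using dist_triangle[of x "l q" w] dist_triangle[of w "l q" "g (r n) q"] \<gamma>(2)[OF qQ] by simp
    then have "dist x (\<gamma> q) < d" using 1 w(2) n(1)[OF q(1)] en d by linarith
    moreover have "d \<le> dist x (\<gamma> q)"
      unfolding d_def using qQ by (intro infdist_le) (auto simp: Q_def)
    ultimately show False by simp
  qed
  then have "\<gamma> ` {0..1} = S" using sub by blast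
  then show ?thesis using \<gamma>(1) clQ by auto
qed

section \<open>Flat pieces of Lipschitz curves\<close>

definition dyadic_increment :: "(real \<Rightarrow> 'a::real_inner) \<Rightarrow> nat \<Rightarrow> nat \<Rightarrow> 'a" where
  "dyadic_increment \<gamma> K i = \<gamma> (real (Suc i) / 2 ^ K) - \<gamma> (real i / 2 ^ K)"

text \<open>The Dirichlet energy, that is the integral of the squared speed, of the polygon through
  the points of dyadic level \<open>K\<close>.\<close>

definition dyadic_energy :: "(real \<Rightarrow> 'a::real_inner) \<Rightarrow> nat \<Rightarrow> real" where
  "dyadic_energy \<gamma> K = 2 ^ K * (\<Sum>i<2 ^ K. (norm (dyadic_increment \<gamma> K i))\<^sup>2)"

text \<open>The variance identity. It yields the energy gap of two levels and, since its left-hand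
  side is nonnegative, the Cauchy-Schwarz inequality that follows.\<close>

lemma sum_norm_diff_mean:
  fixes d :: "'i \<Rightarrow> 'a::real_inner"
  assumes "finite A" "A \<noteq> {}"
  defines "n \<equiv> real (card A)"
  shows "(\<Sum>i\<in>A. (norm (d i - (\<Sum>i\<in>A. d i) /\<^sub>R n))\<^sup>2) = (\<Sum>i\<in>A. (norm (d i))\<^sup>2) - (norm (\<Sum>i\<in>A. d i))\<^sup>2 / n"
proof -
  let ?D = "\<Sum>i\<in>A. d i"
  have n: "0 < n" using assms by (simp add: card_gt_0_iff)
  have "(norm (d i - ?D /\<^sub>R n))\<^sup>2 = (norm (d i))\<^sup>2 - 2 / n * (d i \<bullet> ?D) + (norm ?D)\<^sup>2 / n\<^sup>2" for i
    unfolding power2_norm_eq_inner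
    by (simp add: inner_diff_left inner_diff_right inner_commute power2_eq_square divide_inverse)
  then have "(\<Sum>i\<in>A. (norm (d i - ?D /\<^sub>R n))\<^sup>2) =
      (\<Sum>i\<in>A. (norm (d i))\<^sup>2) - 2 / n * (\<Sum>i\<in>A. d i \<bullet> ?D) + n * ((norm ?D)\<^sup>2 / n\<^sup>2)"
    by (simp add: sum.distrib sum_subtractf sum_distrib_left n_def)
  also have "(\<Sum>i\<in>A. d i \<bullet> ?D) = (norm ?D)\<^sup>2"
    by (simp add: inner_sum_left power2_norm_eq_inner)
  finally show ?thesis using n by (simp add: power2_eq_square field_simps)
qed

lemma norm_sum_squared_le:
  fixes d :: "'i \<Rightarrow> 'a::real_inner"
  assumes "finite A"
  shows "(norm (\<Sum>i\<in>A. d i))\<^sup>2 \<le> real (card A) * (\<Sum>i\<in>A. (norm (d i))\<^sup>2)"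
proof (cases "A = {}")
  case False
  then have n: "0 < real (card A)" using assms by (simp add: card_gt_0_iff)
  have "0 \<le> (\<Sum>i\<in>A. (norm (d i))\<^sup>2) - (norm (\<Sum>i\<in>A. d i))\<^sup>2 / real (card A)"
    unfolding sum_norm_diff_mean[OF assms False, symmetric] by (rule sum_nonneg) simp
  then show ?thesis using n by (simp add: field_simps)
qed simp

lemma sum_dyadic_increment:
  assumes "a \<le> b"
  shows "(\<Sum>i=a..<b. dyadic_increment \<gamma> K i) = \<gamma> (real b / 2 ^ K) - \<gamma> (real a / 2 ^ K)"
  using sum_Suc_diff'[OF assms, of "\<lambda>i. \<gamma> (real i / 2 ^ K)"] by (simp add: dyadic_increment_def)

text \<open>Pythagoras: an increment of level \<open>k\<close> is the sum of the \<open>N\<close>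
  increments of level \<open>K\<close> in its cell, so dividing it by \<open>N\<close> gives their
  mean, and the variance identity applies cell by cell. The gap is thus the squared L2 distance
  between the slopes of the two levels.\<close>

lemma dyadic_energy_diff:
  assumes kK: "k \<le> K"
  defines "N \<equiv> (2::nat) ^ (K - k)"
  shows "dyadic_energy \<gamma> K - dyadic_energy \<gamma> k =
    2 ^ K * (\<Sum>i<2 ^ K. (norm (dyadic_increment \<gamma> K i - dyadic_increment \<gamma> k (i div N) /\<^sub>R real N))\<^sup>2)"
proof -
  let ?d = "dyadic_increment \<gamma> K" and ?D = "dyadic_increment \<gamma> k"
  have N: "0 < N" by (simp add: N_def)
  have KN: "(2::nat) ^ K = 2 ^ k * N" using kK by (simp add: N_def flip: power_add)
  have KNr: "(2::real) ^ K = 2 ^ k * real N" using kK by (simp add: N_def flip: power_add)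
  have block: "(\<Sum>i=j*N..<j*N+N. (norm (?d i - ?D (i div N) /\<^sub>R real N))\<^sup>2) =
      (\<Sum>i=j*N..<j*N+N. (norm (?d i))\<^sup>2) - (norm (?D j))\<^sup>2 / real N" for j
  proof -
    have 1: "real (j * N + N) / 2 ^ K = real (Suc j) / 2 ^ k" "real (j * N) / 2 ^ K = real j / 2 ^ k"
      using N by (auto simp: KNr field_simps)
    have D: "(\<Sum>i=j*N..<j*N+N. ?d i) = ?D j"
      by (subst sum_dyadic_increment) (simp, simp only: 1 dyadic_increment_def)
    have "(\<Sum>i=j*N..<j*N+N. (norm (?d i - ?D (i div N) /\<^sub>R real N))\<^sup>2) =
        (\<Sum>i=j*N..<j*N+N. (norm (?d i - ?D j /\<^sub>R real N))\<^sup>2)"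
    proof (rule sum.cong)
      fix i assume "i \<in> {j*N..<j*N+N}"
      then have "i div N = j" by (intro div_nat_eqI) (auto simp: algebra_simps)
      then show "(norm (?d i - ?D (i div N) /\<^sub>R real N))\<^sup>2 = (norm (?d i - ?D j /\<^sub>R real N))\<^sup>2" by simp
    qed simp
    then show ?thesis
      using sum_norm_diff_mean[of "{j*N..<j*N+N}" ?d] N by (simp add: D)
  qed
  have "(\<Sum>i<2 ^ K. (norm (?d i - ?D (i div N) /\<^sub>R real N))\<^sup>2) =
      (\<Sum>j<2 ^ k. \<Sum>i=j*N..<j*N+N. (norm (?d i - ?D (i div N) /\<^sub>R real N))\<^sup>2)"
    unfolding KN by (rule sum.nat_group[symmetric])
  also have "\<dots> = (\<Sum>j<2 ^ k. (\<Sum>i=j*N..<j*N+N. (norm (?d i))\<^sup>2)) - (\<Sum>j<2 ^ k. (norm (?D j))\<^sup>2) / real N"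
    by (simp only: block sum_subtractf sum_divide_distrib)
  also have "(\<Sum>j<2 ^ k. (\<Sum>i=j*N..<j*N+N. (norm (?d i))\<^sup>2)) = (\<Sum>i<2 ^ K. (norm (?d i))\<^sup>2)"
    unfolding KN by (rule sum.nat_group)
  finally have "(\<Sum>i<2 ^ K. (norm (?d i - ?D (i div N) /\<^sub>R real N))\<^sup>2) =
      (\<Sum>i<2 ^ K. (norm (?d i))\<^sup>2) - (\<Sum>j<2 ^ k. (norm (?D j))\<^sup>2) / real N" .
  then show ?thesis using N by (simp add: dyadic_energy_def KNr right_diff_distrib)
qed

lemma dyadic_energy_incseq: "incseq (dyadic_energy \<gamma>)"
proof (rule monoI)
  fix k K :: nat assume "k \<le> K"
  have "0 \<le> dyadic_energy \<gamma> K - dyadic_energy \<gamma> k"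
    unfolding dyadic_energy_diff[OF \<open>k \<le> K\<close>] by (intro mult_nonneg_nonneg sum_nonneg) auto
  then show "dyadic_energy \<gamma> k \<le> dyadic_energy \<gamma> K" by simp
qed

lemma dyadic_energy_le:
  assumes L: "L-lipschitz_on {0..1} \<gamma>"
  shows "dyadic_energy \<gamma> K \<le> L\<^sup>2"
proof -
  have "(norm (dyadic_increment \<gamma> K i))\<^sup>2 \<le> (L / 2 ^ K)\<^sup>2" if "i < 2 ^ K" for i
  proof -
    have "real (Suc i) \<le> real (2 ^ K)" using that unfolding of_nat_le_iff by simp
    then have "real (Suc i) \<le> 2 ^ K" by simp
    then have "real (Suc i) \<le> 2 ^ K" "real i \<le> 2 ^ K" by linarith+
    then have "real (Suc i) / 2 ^ K \<in> {0..1}" "real i / 2 ^ K \<in> {0..1}" by auto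
    then have "norm (dyadic_increment \<gamma> K i) \<le> L * \<bar>real (Suc i) / 2 ^ K - real i / 2 ^ K\<bar>"
      unfolding dyadic_increment_def using lipschitz_onD[OF L] by (auto simp: dist_norm)
    also have "\<bar>real (Suc i) / 2 ^ K - real i / 2 ^ K\<bar> = 1 / 2 ^ K" by (simp flip: diff_divide_distrib)
    finally show ?thesis by (intro power_mono) auto
  qed
  then have "(\<Sum>i<2 ^ K. (norm (dyadic_increment \<gamma> K i))\<^sup>2) \<le> (\<Sum>i<(2::nat) ^ K. (L / 2 ^ K)\<^sup>2)"
    by (intro sum_mono) auto
  then have "dyadic_energy \<gamma> K \<le> 2 ^ K * (2 ^ K * (L / 2 ^ K)\<^sup>2)"
    unfolding dyadic_energy_def by (intro mult_left_mono) auto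
  then show ?thesis by (simp add: power2_eq_square)
qed

section \<open>Chords compared with the slope of their dyadic cell\<close>

definition dyadic_at :: "nat \<Rightarrow> real \<Rightarrow> bool" where
  "dyadic_at K x \<longleftrightarrow> (\<exists>\<alpha>::nat. x = real \<alpha> / 2 ^ K)"

lemma dyadic_at_mono: "dyadic_at K x \<Longrightarrow> K \<le> K' \<Longrightarrow> dyadic_at K' x"
proof -
  assume "dyadic_at K x" and K: "K \<le> K'"
  then obtain \<alpha> :: nat where "x = real \<alpha> / 2 ^ K" by (auto simp: dyadic_at_def)
  moreover have "(2::real) ^ K' = 2 ^ K * 2 ^ (K' - K)" using K by (simp flip: power_add)
  ultimately have "x = real (\<alpha> * 2 ^ (K' - K)) / 2 ^ K'" by simp
  then show ?thesis unfolding dyadic_at_def by blast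
qed

definition dyadic_slope :: "(real \<Rightarrow> 'a::real_inner) \<Rightarrow> nat \<Rightarrow> nat \<Rightarrow> 'a" where
  "dyadic_slope \<gamma> k j = 2 ^ k *\<^sub>R dyadic_increment \<gamma> k j"

definition dyadic_cell :: "nat \<Rightarrow> nat \<Rightarrow> real set" where
  "dyadic_cell k j = {real j / 2 ^ k .. real (Suc j) / 2 ^ k}"

text \<open>The end points are dyadic of an arbitrary level: on such an interval the deviation is a
  sum of residuals of increments of one fine level, and those are what the energy gap
  controls.\<close>

definition bad_interval :: "(real \<Rightarrow> 'a::real_inner) \<Rightarrow> nat \<Rightarrow> real \<Rightarrow> real \<times> real \<Rightarrow> bool" where
  "bad_interval \<gamma> k \<theta> p \<longleftrightarrow>
     (\<exists>K. dyadic_at K (fst p) \<and> dyadic_at K (snd p)) \<and> fst p < snd p \<and>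
     (\<exists>j<2 ^ k. fst p \<in> dyadic_cell k j \<and> snd p \<in> dyadic_cell k j \<and>
        \<theta> * (snd p - fst p) < norm (\<gamma> (snd p) - \<gamma> (fst p) - (snd p - fst p) *\<^sub>R dyadic_slope \<gamma> k j))"

text \<open>On a common level \<open>K\<close> the deviation over a bad interval is the sum of the
  residuals \<open>r\<close> over it. By Cauchy-Schwarz, \<open>\<theta>\<^sup>2\<close> times the
  length of the interval is at most the energy of the residuals in it, and for disjoint intervals
  these energies add up to at most the whole gap.\<close>

lemma bad_intervals_sum_le:
  assumes E: "\<And>K. k \<le> K \<Longrightarrow> dyadic_energy \<gamma> K - dyadic_energy \<gamma> k \<le> e" and \<theta>: "0 < \<theta>"
    and F: "finite F" "\<And>p. p \<in> F \<Longrightarrow> bad_interval \<gamma> k \<theta> p"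
    and disj: "\<And>p q. p \<in> F \<Longrightarrow> q \<in> F \<Longrightarrow> p \<noteq> q \<Longrightarrow> {fst p<..<snd p} \<inter> {fst q<..<snd q} = {}"
  shows "\<theta>\<^sup>2 * (\<Sum>p\<in>F. snd p - fst p) \<le> e"
proof -
  \<comment> \<open>Finitely many intervals have all their end points on one sufficiently fine
    level.\<close>
  have "\<forall>\<^sub>F K in sequentially. \<forall>p\<in>F. dyadic_at K (fst p) \<and> dyadic_at K (snd p)"
  proof (intro eventually_ball_finite F ballI)
    fix p assume "p \<in> F"
    then obtain K where "dyadic_at K (fst p)" "dyadic_at K (snd p)"
      using F(2) unfolding bad_interval_def by blast
    then show "\<forall>\<^sub>F K in sequentially. dyadic_at K (fst p) \<and> dyadic_at K (snd p)"
      using dyadic_at_mono unfolding eventually_sequentially by blast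
  qed
  then obtain K0 where K0: "\<And>K p. K0 \<le> K \<Longrightarrow> p \<in> F \<Longrightarrow> dyadic_at K (fst p) \<and> dyadic_at K (snd p)"
    unfolding eventually_sequentially by blast
  define K where "K = max K0 k"
  have kK: "k \<le> K" by (simp add: K_def)
  have "\<exists>\<alpha> \<beta>. \<forall>p\<in>F. fst p = real (\<alpha> p) / 2 ^ K \<and> snd p = real (\<beta> p) / 2 ^ K"
  proof -
    have "\<forall>p\<in>F. \<exists>a b. fst p = real a / 2 ^ K \<and> snd p = real b / 2 ^ K"
      using K0[of K] unfolding dyadic_at_def by (auto simp: K_def)
    then show ?thesis by metis
  qed
  then obtain \<alpha> \<beta> where ab: "\<And>p. p \<in> F \<Longrightarrow> fst p = real (\<alpha> p) / 2 ^ K" "\<And>p. p \<in> F \<Longrightarrow> snd p = real (\<beta> p) / 2 ^ K"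
    by metis
  define N where "N = (2::nat) ^ (K - k)"
  have N: "0 < N" by (simp add: N_def)
  have KNr: "(2::real) ^ K = 2 ^ k * real N" using kK by (simp add: N_def flip: power_add)
  have KN: "(2::nat) ^ K = 2 ^ k * N" using kK by (simp add: N_def flip: power_add)
  define r where "r i = dyadic_increment \<gamma> K i - dyadic_increment \<gamma> k (i div N) /\<^sub>R real N" for i
  have one: "\<theta>\<^sup>2 * (snd p - fst p) \<le> 2 ^ K * (\<Sum>i\<in>{\<alpha> p..<\<beta> p}. (norm (r i))\<^sup>2) \<and> \<beta> p \<le> 2 ^ K" if p: "p \<in> F" for p
  proof -
    obtain j where j: "j < 2 ^ k" "fst p \<in> dyadic_cell k j" "snd p \<in> dyadic_cell k j"
      "\<theta> * (snd p - fst p) < norm (\<gamma> (snd p) - \<gamma> (fst p) - (snd p - fst p) *\<^sub>R dyadic_slope \<gamma> k j)"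
      and lt: "fst p < snd p"
      using F(2)[OF p] unfolding bad_interval_def by blast
    have ab_lt: "\<alpha> p < \<beta> p" using lt ab[OF p] by (simp add: divide_less_cancel)
    have "real (j * N) \<le> real (\<alpha> p)" using j(2) ab[OF p] N by (auto simp: dyadic_cell_def KNr field_simps)
    then have a: "j * N \<le> \<alpha> p" unfolding of_nat_le_iff .
    have "real (\<beta> p) \<le> real (Suc j * N)" using j(3) ab[OF p] N by (auto simp: dyadic_cell_def KNr field_simps)
    then have b: "\<beta> p \<le> Suc j * N" unfolding of_nat_le_iff .
    have len: "snd p - fst p = real (\<beta> p - \<alpha> p) / 2 ^ K"
      using ab[OF p] ab_lt by (simp add: of_nat_diff diff_divide_distrib)
    have "(\<Sum>i=\<alpha> p..<\<beta> p. r i) = (\<Sum>i=\<alpha> p..<\<beta> p. dyadic_increment \<gamma> K i - dyadic_increment \<gamma> k j /\<^sub>R real N)"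
    proof (rule sum.cong)
      fix i assume "i \<in> {\<alpha> p..<\<beta> p}"
      then have "i div N = j" using a b by (intro div_nat_eqI) (auto simp: algebra_simps)
      then show "r i = dyadic_increment \<gamma> K i - dyadic_increment \<gamma> k j /\<^sub>R real N" by (simp add: r_def)
    qed simp
    also have "\<dots> = \<gamma> (snd p) - \<gamma> (fst p) - real (\<beta> p - \<alpha> p) *\<^sub>R (dyadic_increment \<gamma> k j /\<^sub>R real N)"
      using ab_lt ab[OF p] by (simp add: sum_subtractf sum_dyadic_increment sum_constant_scaleR)
    also have "real (\<beta> p - \<alpha> p) *\<^sub>R (dyadic_increment \<gamma> k j /\<^sub>R real N) = (snd p - fst p) *\<^sub>R dyadic_slope \<gamma> k j"
      using N by (simp add: len dyadic_slope_def KNr divide_inverse)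
    finally have "(\<theta> * (snd p - fst p))\<^sup>2 \<le> (norm (\<Sum>i=\<alpha> p..<\<beta> p. r i))\<^sup>2"
      using j(4) \<theta> lt by (intro power_mono) auto
    also have "\<dots> \<le> real (card {\<alpha> p..<\<beta> p}) * (\<Sum>i=\<alpha> p..<\<beta> p. (norm (r i))\<^sup>2)"
      by (rule norm_sum_squared_le) simp
    also have "real (card {\<alpha> p..<\<beta> p}) = (snd p - fst p) * 2 ^ K" by (simp add: len)
    finally have "(snd p - fst p) * (\<theta>\<^sup>2 * (snd p - fst p)) \<le> (snd p - fst p) * (2 ^ K * (\<Sum>i\<in>{\<alpha> p..<\<beta> p}. (norm (r i))\<^sup>2))"
      by (simp add: power2_eq_square algebra_simps)
    then have "\<theta>\<^sup>2 * (snd p - fst p) \<le> 2 ^ K * (\<Sum>i\<in>{\<alpha> p..<\<beta> p}. (norm (r i))\<^sup>2)"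
      using lt by simp
    moreover have "Suc j * N \<le> 2 ^ k * N" using j(1) by (intro mult_right_mono) auto
    ultimately show ?thesis using b KN by simp
  qed
  have disjI: "{\<alpha> p..<\<beta> p} \<inter> {\<alpha> q..<\<beta> q} = {}" if pq: "p \<in> F" "q \<in> F" "p \<noteq> q" for p q
  proof (rule ccontr)
    assume "\<not> ?thesis"
    then obtain i where "i \<in> {\<alpha> p..<\<beta> p} \<inter> {\<alpha> q..<\<beta> q}" by blast
    then have i: "\<alpha> p \<le> i" "i < \<beta> p" "\<alpha> q \<le> i" "i < \<beta> q" by auto
    \<comment> \<open>Only the open intervals are disjoint, so the midpoint of grid cell
      \<open>i\<close> serves as the common point.\<close>
    have "(real i + 1/2) / 2 ^ K \<in> {fst s<..<snd s}" if "s \<in> F" "\<alpha> s \<le> i" "i < \<beta> s" for s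
    proof -
      have "real (\<alpha> s) < real i + 1/2" "real i + 1/2 < real (\<beta> s)" using that by linarith+
      then show ?thesis using ab[OF that(1)] by (simp add: divide_strict_right_mono)
    qed
    then show False using disj[OF pq] i pq by blast
  qed
  have "\<theta>\<^sup>2 * (\<Sum>p\<in>F. snd p - fst p) = (\<Sum>p\<in>F. \<theta>\<^sup>2 * (snd p - fst p))" by (rule sum_distrib_left)
  also have "\<dots> \<le> (\<Sum>p\<in>F. 2 ^ K * (\<Sum>i\<in>{\<alpha> p..<\<beta> p}. (norm (r i))\<^sup>2))"
    by (intro sum_mono) (use one in blast)
  also have "\<dots> = 2 ^ K * (\<Sum>i\<in>(\<Union>p\<in>F. {\<alpha> p..<\<beta> p}). (norm (r i))\<^sup>2)"
    using F disjI by (subst sum.UNION_disjoint) (auto simp: sum_distrib_left)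
  also have "\<dots> \<le> 2 ^ K * (\<Sum>i<2 ^ K. (norm (r i))\<^sup>2)"
  proof (intro mult_left_mono sum_mono2)
    show "(\<Union>p\<in>F. {\<alpha> p..<\<beta> p}) \<subseteq> {..<2 ^ K}" using one by fastforce
  qed auto
  also have "\<dots> = dyadic_energy \<gamma> K - dyadic_energy \<gamma> k"
    unfolding dyadic_energy_diff[OF kK] r_def N_def by simp
  also have "\<dots> \<le> e" using E[OF kK] .
  finally show ?thesis .
qed

text \<open>Open intervals are removed, so that what remains of a closed cell is compact.\<close>

definition bad_set :: "(real \<Rightarrow> 'a::real_inner) \<Rightarrow> nat \<Rightarrow> real \<Rightarrow> real set" where
  "bad_set \<gamma> k \<theta> = (\<Union>p\<in>Collect (bad_interval \<gamma> k \<theta>). {fst p<..<snd p})"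

lemma open_bad_set: "open (bad_set \<gamma> k \<theta>)"
  unfolding bad_set_def by auto

lemma dyadic_cell_subset: "j < 2 ^ k \<Longrightarrow> dyadic_cell k j \<subseteq> {0..1}"
proof -
  assume "j < 2 ^ k"
  then have "real (Suc j) \<le> real (2 ^ k)" unfolding of_nat_le_iff by simp
  then have "real (Suc j) / 2 ^ k \<le> 1" by (simp add: field_simps)
  then show ?thesis unfolding dyadic_cell_def by (auto intro: order_trans[of 0 "real j / 2 ^ k"])
qed

text \<open>A maximal inequality of weak type. Vitali's lemma selects disjoint bad intervals whose
  fivefold enlargements cover the bad set, and disjoint bad intervals have total length at most
  \<open>e / \<theta>\<^sup>2\<close>.\<close>

lemma hausdorff_bad_set_le:
  assumes E: "\<And>K. k \<le> K \<Longrightarrow> dyadic_energy \<gamma> K - dyadic_energy \<gamma> k \<le> e" and \<theta>: "0 < \<theta>"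
  shows "hausdorff 1 (bad_set \<gamma> k \<theta>) \<le> ennreal (5 * e / \<theta>\<^sup>2)"
proof -
  define a where "a p = (fst p + snd p) / 2" for p :: "real \<times> real"
  define r where "r p = (snd p - fst p) / 2" for p :: "real \<times> real"
  let ?K = "Collect (bad_interval \<gamma> k \<theta>)"
  have ball: "ball (a p) (r p) = {fst p<..<snd p}" for p
    unfolding ball_eq_greaterThanLessThan a_def r_def by (simp add: field_simps)
  have r: "0 < r p \<and> r p \<le> 1" if "p \<in> ?K" for p
  proof -
    from that obtain j where "j < 2 ^ k" "fst p \<in> dyadic_cell k j" "snd p \<in> dyadic_cell k j" "fst p < snd p"
      unfolding bad_interval_def by blast
    then have "fst p \<in> {0..1}" "snd p \<in> {0..1}" "fst p < snd p" using dyadic_cell_subset by blast+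
    then show ?thesis by (auto simp: r_def)
  qed
  have "bad_set \<gamma> k \<theta> \<subseteq> (\<Union>p\<in>?K. ball (a p) (r p))" by (simp add: ball bad_set_def)
  from Vitali_covering_lemma_balls[OF this, of 1] r
  obtain C where C: "countable C" "C \<subseteq> ?K"
     "pairwise (\<lambda>i j. disjnt (ball (a i) (r i)) (ball (a j) (r j))) C"
     "bad_set \<gamma> k \<theta> \<subseteq> (\<Union>i\<in>C. ball (a i) (5 * r i))" by auto
  have "hausdorff 1 (bad_set \<gamma> k \<theta>) \<le> hausdorff 1 (\<Union>i\<in>C. ball (a i) (5 * r i))"
    using C(4) by (rule hausdorff_mono)
  also have "\<dots> \<le> ennreal (5 * e / \<theta>\<^sup>2)"
  proof (rule countable_subadditive_UN_le[OF hausdorff_UN_le hausdorff_empty C(1)])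
    fix p assume "p \<in> C"
    then have "0 < r p" using C(2) r[of p] by blast
    have "hausdorff 1 (ball (a p) (5 * r p)) \<le> hausdorff 1 {a p - 5 * r p..a p + 5 * r p}"
      by (rule hausdorff_mono) (auto simp: ball_eq_greaterThanLessThan)
    also have "\<dots> \<le> ennreal (5 * (snd p - fst p))"
    proof -
      have "a p + 5 * r p - (a p - 5 * r p) = 5 * (snd p - fst p)" by (simp add: r_def)
      then show ?thesis
        using hausdorff_interval_le[of "a p - 5 * r p" "a p + 5 * r p"] \<open>0 < r p\<close> by simp
    qed
    finally show "hausdorff 1 (ball (a p) (5 * r p)) \<le> ennreal (5 * (snd p - fst p))" .
  next
    fix F assume F: "finite F" "F \<subseteq> C"
    have bad: "bad_interval \<gamma> k \<theta> p" if "p \<in> F" for p using that F C(2) by auto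
    have "\<theta>\<^sup>2 * (\<Sum>p\<in>F. snd p - fst p) \<le> e"
    proof (rule bad_intervals_sum_le[OF E \<theta> F(1) bad])
      fix p q assume "p \<in> F" "q \<in> F" "p \<noteq> q"
      then show "{fst p<..<snd p} \<inter> {fst q<..<snd q} = {}"
        using pairwiseD[OF C(3), of p q] F(2) by (auto simp: ball disjnt_def)
    qed
    then have "5 * (\<Sum>p\<in>F. snd p - fst p) \<le> 5 * e / \<theta>\<^sup>2" using \<theta> by (simp add: field_simps)
    moreover have "(\<Sum>p\<in>F. ennreal (5 * (snd p - fst p))) = ennreal (5 * (\<Sum>p\<in>F. snd p - fst p))"
      using bad by (subst sum_ennreal) (auto simp: bad_interval_def sum_distrib_left less_imp_le)
    ultimately show "(\<Sum>p\<in>F. ennreal (5 * (snd p - fst p))) \<le> ennreal (5 * e / \<theta>\<^sup>2)"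
      by (simp add: ennreal_leI)
  qed
  finally show ?thesis .
qed

lemma dyadic_at_max: "dyadic_at K x \<Longrightarrow> dyadic_at K y \<Longrightarrow> dyadic_at K (max x y)"
  by (simp add: max_def)

lemma dyadic_at_min: "dyadic_at K x \<Longrightarrow> dyadic_at K y \<Longrightarrow> dyadic_at K (min x y)"
  by (simp add: min_def)

lemma dyadic_below:
  assumes "0 < s"
  obtains a where "\<And>n. dyadic_at n (a n)" "\<And>n. a n < s" "a \<longlonglongrightarrow> s"
proof
  \<comment> \<open>The largest integer strictly below \<open>s * 2 ^ n\<close>, even when that
    number is an integer; it is nonnegative because \<open>0 < s\<close>.\<close>
  define m where "m n = \<lceil>s * 2 ^ n\<rceil> - 1" for n
  have m: "of_int (m n) < s * 2 ^ n" "s * 2 ^ n - 1 \<le> of_int (m n)" for n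
    unfolding m_def by linarith+
  have m0: "0 \<le> m n" for n using assms by (simp add: m_def)
  define a where "a n = real (nat (m n)) / 2 ^ n" for n
  have a: "a n = of_int (m n) / 2 ^ n" for n using m0 by (simp add: a_def)
  show "dyadic_at n (a n)" for n by (auto simp: dyadic_at_def a_def)
  show lt: "a n < s" for n using m(1)[of n] by (simp add: a field_simps)
  have ge: "s - (1/2) ^ n \<le> a n" for n
    using divide_right_mono[OF m(2)[of n], of "2 ^ n"] by (simp add: a diff_divide_distrib power_one_over)
  have "(\<lambda>n. s - (1/2) ^ n) \<longlonglongrightarrow> s - 0" by (intro tendsto_diff tendsto_const LIMSEQ_power_zero) auto
  then show "a \<longlonglongrightarrow> s"
    by (intro tendsto_sandwich[of "\<lambda>n. s - (1/2) ^ n" a _ "\<lambda>_. s"]) (use ge lt in \<open>auto simp: less_imp_le\<close>)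
qed

lemma dyadic_above:
  assumes "0 \<le> t"
  obtains b where "\<And>n. dyadic_at n (b n)" "\<And>n. t < b n" "b \<longlonglongrightarrow> t"
proof
  define m where "m n = nat \<lfloor>t * 2 ^ n\<rfloor> + 1" for n
  have m: "t * 2 ^ n < real (m n)" "real (m n) \<le> t * 2 ^ n + 1" for n
    unfolding m_def using assms by (simp_all add: of_nat_nat) (use floor_correct[of "t * 2 ^ n"] in linarith)
  define b where "b n = real (m n) / 2 ^ n" for n
  show "dyadic_at n (b n)" for n by (auto simp: dyadic_at_def b_def)
  show gt: "t < b n" for n using m(1)[of n] by (simp add: b_def field_simps)
  have le: "b n \<le> t + (1/2) ^ n" for n
    using divide_right_mono[OF m(2)[of n], of "2 ^ n"] by (simp add: b_def add_divide_distrib power_one_over)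
  have "(\<lambda>n. t + (1/2) ^ n) \<longlonglongrightarrow> t + 0" by (intro tendsto_add tendsto_const LIMSEQ_power_zero) auto
  then show "b \<longlonglongrightarrow> t"
    by (intro tendsto_sandwich[of "\<lambda>_. t" b _ "\<lambda>n. t + (1/2) ^ n"]) (use le gt in \<open>auto simp: less_imp_le\<close>)
qed

text \<open>A dyadic interval in the cell that is slightly larger than \<open>{s..t}\<close> has
  \<open>s\<close> or \<open>t\<close> in its interior, so it cannot be bad; letting it shrink to
  \<open>{s..t}\<close> gives the estimate by continuity. At an end of the cell there is no room for
  enlarging; if both \<open>s\<close> and \<open>t\<close> are ends, the chord has exactly the slope
  of the cell.\<close>

lemma good_chord:
  fixes \<gamma> :: "real \<Rightarrow> 'a::euclidean_space"
  assumes cont: "continuous_on {0..1} \<gamma>" and \<theta>: "0 < \<theta>" and j: "j < 2 ^ k"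
    and s: "s \<in> dyadic_cell k j - bad_set \<gamma> k \<theta>" and t: "t \<in> dyadic_cell k j - bad_set \<gamma> k \<theta>" and st: "s < t"
  shows "norm (\<gamma> t - \<gamma> s - (t - s) *\<^sub>R dyadic_slope \<gamma> k j) \<le> \<theta> * (t - s)"
proof -
  define l where "l = real j / 2 ^ k"
  define u where "u = real (Suc j) / 2 ^ k"
  have cell: "dyadic_cell k j = {l..u}" by (simp add: dyadic_cell_def l_def u_def)
  have lu: "0 \<le> l" "u \<le> 1" "l \<le> s" "t \<le> u" "l \<le> t" "s \<le> u"
    using dyadic_cell_subset[OF j] s t unfolding cell by (auto simp: l_def)
  have dl: "dyadic_at k l" "dyadic_at k u" unfolding dyadic_at_def l_def u_def by blast+
  show ?thesis
  proof (cases "s = l \<and> t = u")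
    case True
    then have "(t - s) *\<^sub>R dyadic_slope \<gamma> k j = \<gamma> t - \<gamma> s"
      by (simp add: l_def u_def dyadic_slope_def dyadic_increment_def flip: diff_divide_distrib)
    then show ?thesis using st \<theta> by simp
  next
    case False
    have "\<exists>a. (\<forall>n\<ge>k. dyadic_at n (a n)) \<and> (\<forall>n. l \<le> a n \<and> a n \<le> s \<and> (l < s \<longrightarrow> a n < s)) \<and> a \<longlonglongrightarrow> s"
    proof (cases "l < s")
      case True
      then have "0 < s" using lu by linarith
      then obtain a where a: "\<And>n. dyadic_at n (a n)" "\<And>n. a n < s" "a \<longlonglongrightarrow> s"
        by (rule dyadic_below) blast
      have "(\<lambda>n. max l (a n)) \<longlonglongrightarrow> max l s" by (intro tendsto_max tendsto_const a)
      moreover have "max l s = s" using True by simp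
      ultimately show ?thesis
        using a True dl dyadic_at_mono dyadic_at_max
        by (intro exI[of _ "\<lambda>n. max l (a n)"]) (auto simp: less_imp_le)
    next
      case False
      then show ?thesis using lu dl dyadic_at_mono by (intro exI[of _ "\<lambda>_. l"]) auto
    qed
    then obtain a where a: "\<And>n. n \<ge> k \<Longrightarrow> dyadic_at n (a n)" "\<And>n. l \<le> a n" "\<And>n. a n \<le> s"
        "\<And>n. l < s \<Longrightarrow> a n < s" "a \<longlonglongrightarrow> s"
      by blast
    have "\<exists>b. (\<forall>n\<ge>k. dyadic_at n (b n)) \<and> (\<forall>n. b n \<le> u \<and> t \<le> b n \<and> (t < u \<longrightarrow> t < b n)) \<and> b \<longlonglongrightarrow> t"
    proof (cases "t < u")
      case True
      have "0 \<le> t" using lu by linarith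
      then obtain b where b: "\<And>n. dyadic_at n (b n)" "\<And>n. t < b n" "b \<longlonglongrightarrow> t"
        by (rule dyadic_above) blast
      have "(\<lambda>n. min u (b n)) \<longlonglongrightarrow> min u t" by (intro tendsto_min tendsto_const b)
      moreover have "min u t = t" using True by simp
      ultimately show ?thesis
        using b True dl dyadic_at_mono dyadic_at_min
        by (intro exI[of _ "\<lambda>n. min u (b n)"]) (auto simp: less_imp_le)
    next
      case False
      then show ?thesis using lu dl dyadic_at_mono by (intro exI[of _ "\<lambda>_. u"]) auto
    qed
    then obtain b where b: "\<And>n. n \<ge> k \<Longrightarrow> dyadic_at n (b n)" "\<And>n. b n \<le> u" "\<And>n. t \<le> b n"
        "\<And>n. t < u \<Longrightarrow> t < b n" "b \<longlonglongrightarrow> t"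
      by blast
    have good: "norm (\<gamma> (b n) - \<gamma> (a n) - (b n - a n) *\<^sub>R dyadic_slope \<gamma> k j) \<le> \<theta> * (b n - a n)" if n: "n \<ge> k" for n
    proof (rule ccontr)
      assume "\<not> ?thesis"
      moreover have "a n < b n" using a(3)[of n] b(3)[of n] st by linarith
      moreover have "a n \<in> dyadic_cell k j" "b n \<in> dyadic_cell k j"
        unfolding cell using a(2)[of n] b(2)[of n] \<open>a n < b n\<close> by auto
      ultimately have "bad_interval \<gamma> k \<theta> (a n, b n)"
        unfolding bad_interval_def using a(1)[OF n] b(1)[OF n] j by auto
      then have "{a n<..<b n} \<subseteq> bad_set \<gamma> k \<theta>" unfolding bad_set_def by force
      moreover have "s \<in> {a n<..<b n} \<or> t \<in> {a n<..<b n}"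
        using False lu a(3,4)[of n] b(3,4)[of n] st by auto
      ultimately show False using s t by blast
    qed
    have ab01: "a n \<in> {0..1}" "b n \<in> {0..1}" for n
      using lu a(2,3)[of n] b(2,3)[of n] st by auto
    have "(\<lambda>n. \<gamma> (a n)) \<longlonglongrightarrow> \<gamma> s" "(\<lambda>n. \<gamma> (b n)) \<longlonglongrightarrow> \<gamma> t"
      using ab01 lu st by (auto intro!: continuous_on_tendsto_compose[OF cont] a b)
    then have "(\<lambda>n. norm (\<gamma> (b n) - \<gamma> (a n) - (b n - a n) *\<^sub>R dyadic_slope \<gamma> k j)) \<longlonglongrightarrow>
        norm (\<gamma> t - \<gamma> s - (t - s) *\<^sub>R dyadic_slope \<gamma> k j)"
      by (intro tendsto_intros a b)
    moreover have "(\<lambda>n. \<theta> * (b n - a n)) \<longlonglongrightarrow> \<theta> * (t - s)" by (intro tendsto_intros a b)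
    ultimately show ?thesis
      by (rule LIMSEQ_le) (use good in blast)
  qed
qed

text \<open>The bound on the diameter makes the derivative of a vector field nearly constant on the
  piece. For \<open>\<delta> < 1\<close> the bound on chords says that the piece is a Lipschitz
  graph over a subset of the line of \<open>\<tau>\<close>.\<close>

definition flat_piece :: "real \<Rightarrow> 'a::euclidean_space \<Rightarrow> 'a set \<Rightarrow> bool" where
  "flat_piece \<delta> \<tau> A \<longleftrightarrow> norm \<tau> = 1 \<and>
     (\<forall>x\<in>A. \<forall>y\<in>A. dist x y \<le> \<delta> \<and> norm ((y - x) - ((y - x) \<bullet> \<tau>) *\<^sub>R \<tau>) \<le> \<delta> * norm (y - x))"

lemma norm_diff_projection_le:
  fixes w \<tau> :: "'a::real_inner"
  assumes "norm \<tau> = 1"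
  shows "norm (w - (w \<bullet> \<tau>) *\<^sub>R \<tau>) \<le> norm (w - c *\<^sub>R \<tau>)"
proof -
  have \<tau>: "\<tau> \<bullet> \<tau> = 1" using assms by (simp add: norm_eq_1)
  have "(norm (w - c *\<^sub>R \<tau>))\<^sup>2 = (norm (w - (w \<bullet> \<tau>) *\<^sub>R \<tau>))\<^sup>2 + (w \<bullet> \<tau> - c)\<^sup>2"
    unfolding power2_norm_eq_inner
    by (simp add: inner_diff_left inner_diff_right \<tau> inner_commute power2_eq_square algebra_simps)
  then have "(norm (w - (w \<bullet> \<tau>) *\<^sub>R \<tau>))\<^sup>2 \<le> (norm (w - c *\<^sub>R \<tau>))\<^sup>2" by simp
  then show ?thesis by (rule power2_le_imp_le) simp
qed

text \<open>Three kinds of parameters on one fine dyadic level: bad ones have an image of small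
  length by the maximal inequality; in cells of slope below \<open>\<rho>\<close> the curve is slow
  and covers little length; in the remaining cells the chord error is small relative to the chord
  itself, so the image is flat.\<close>

lemma Lipschitz_curve_flat_pieces:
  fixes \<gamma> :: "real \<Rightarrow> 'a::euclidean_space"
  assumes L: "L-lipschitz_on {0..1} \<gamma>" and \<delta>: "0 < \<delta>" "\<delta> < 1" and \<kappa>: "0 < \<kappa>"
  shows "\<exists>F. finite F \<and> (\<forall>(A, \<tau>)\<in>F. compact A \<and> A \<subseteq> \<gamma> ` {0..1} \<and> flat_piece \<delta> \<tau> A) \<and>
    hausdorff 1 (\<gamma> ` {0..1} - (\<Union>(A, \<tau>)\<in>F. A)) \<le> ennreal \<kappa>"
proof -
  have L0: "0 \<le> L" using L by (rule lipschitz_on_nonneg)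
  have cont: "continuous_on {0..1} \<gamma>" using L by (rule lipschitz_on_continuous_on)
  \<comment> \<open>Here \<open>\<rho>\<close> equals \<open>\<kappa> / 3\<close>, whence
    \<open>\<rho> + \<theta> \<le> \<kappa> / 2\<close> for the slow cells;
    \<open>\<delta> * \<rho> = 2 * \<theta>\<close> gives
    \<open>\<theta> \<le> \<delta> * (\<rho> - \<theta>)\<close> for the flat ones; and
    \<open>e\<close> is such that the image of the bad set has length at most
    \<open>\<kappa> / 2\<close>.\<close>
  define \<theta> where "\<theta> = \<kappa> * \<delta> / 6"
  define \<rho> where "\<rho> = 2 * \<theta> / \<delta>"
  define e where "e = \<kappa> * \<theta>\<^sup>2 / (10 * (L + 1))"
  have \<theta>: "0 < \<theta>" using \<delta> \<kappa> by (simp add: \<theta>_def)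
  have e: "0 < e" using \<kappa> \<theta> L0 by (simp add: e_def)
  have \<rho>: "0 < \<rho>" "\<rho> + \<theta> \<le> \<kappa> / 2" "\<delta> * \<rho> = 2 * \<theta>"
  proof -
    show "0 < \<rho>" using \<theta> \<delta> by (simp add: \<rho>_def)
    show "\<delta> * \<rho> = 2 * \<theta>" using \<delta> by (simp add: \<rho>_def)
    have "\<delta> * \<kappa> \<le> 1 * \<kappa>" using \<delta> \<kappa> by (intro mult_right_mono) auto
    then show "\<rho> + \<theta> \<le> \<kappa> / 2" using \<delta> by (simp add: \<rho>_def \<theta>_def)
  qed
  have Le: "L * (5 * e / \<theta>\<^sup>2) \<le> \<kappa> / 2"
  proof -
    have "5 * e / \<theta>\<^sup>2 = \<kappa> / 2 / (L + 1)" using \<theta> L0 unfolding e_def by (simp add: divide_simps)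
    then have "L * (5 * e / \<theta>\<^sup>2) = (L / (L + 1)) * (\<kappa> / 2)" by simp
    also have "\<dots> \<le> 1 * (\<kappa> / 2)" using L0 \<kappa> by (intro mult_right_mono) auto
    finally show ?thesis by simp
  qed
  have "convergent (dyadic_energy \<gamma>)"
    using incseq_convergent[OF dyadic_energy_incseq] dyadic_energy_le[OF L] by (metis convergentI)
  then have "Cauchy (dyadic_energy \<gamma>)" by (rule convergent_Cauchy)
  then obtain k0 where k0: "\<And>m n. k0 \<le> m \<Longrightarrow> k0 \<le> n \<Longrightarrow> dist (dyadic_energy \<gamma> m) (dyadic_energy \<gamma> n) < e"
    using e unfolding Cauchy_def by blast
  obtain k1 where k1: "L / \<delta> < 2 ^ k1" using real_arch_pow[of 2] by auto
  \<comment> \<open>Level \<open>k0\<close> brings the energy gap below \<open>e\<close>, level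
    \<open>k1\<close> brings the diameter of the image of a cell below
    \<open>\<delta>\<close>.\<close>
  define k where "k = max k0 k1"
  have E: "dyadic_energy \<gamma> K - dyadic_energy \<gamma> k \<le> e" if "k \<le> K" for K
    using k0[of K k] that by (auto simp: k_def dist_real_def)
  have "L / \<delta> \<le> 2 ^ k"
    using k1 power_increasing[of k1 k "2::real"] unfolding k_def by linarith
  then have Lk: "L * (1 / 2 ^ k) \<le> \<delta>" using \<delta> by (simp add: field_simps)
  define B where "B = bad_set \<gamma> k \<theta>"
  define J where "J j = dyadic_cell k j - B" for j
  have J01: "J j \<subseteq> {0..1}" if "j < 2 ^ k" for j using dyadic_cell_subset[OF that] by (auto simp: J_def)
  have Jdist: "\<bar>t - s\<bar> \<le> 1 / 2 ^ k" if "s \<in> J j" "t \<in> J j" for s t j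
  proof -
    have "real (Suc j) / 2 ^ k - real j / 2 ^ k = 1 / 2 ^ k" by (simp flip: diff_divide_distrib)
    then show ?thesis using that unfolding J_def dyadic_cell_def by auto
  qed
  define v where "v j = dyadic_slope \<gamma> k j" for j
  have chord: "norm (\<gamma> t - \<gamma> s - (t - s) *\<^sub>R v j) \<le> \<theta> * \<bar>t - s\<bar>"
    if j: "j < 2 ^ k" and st: "s \<in> J j" "t \<in> J j" for s t j
  proof -
    consider "s < t" | "s = t" | "t < s" by linarith
    then show ?thesis
    proof cases
      case 1
      then show ?thesis using good_chord[OF cont \<theta> j _ _ 1] st by (simp add: J_def B_def v_def)
    next
      case 3
      have "norm (\<gamma> t - \<gamma> s - (t - s) *\<^sub>R v j) = norm (\<gamma> s - \<gamma> t - (s - t) *\<^sub>R v j)"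
        by (subst norm_minus_cancel[symmetric]) (simp add: algebra_simps)
      then show ?thesis using good_chord[OF cont \<theta> j _ _ 3] st 3 by (simp add: J_def B_def v_def)
    qed simp
  qed
  have cpt: "compact (\<gamma> ` J j)" if "j < 2 ^ k" for j
  proof (rule compact_continuous_image)
    show "continuous_on (J j) \<gamma>" using cont J01[OF that] by (rule continuous_on_subset)
    show "compact (J j)" unfolding J_def B_def dyadic_cell_def
      by (rule compact_diff) (auto simp: open_bad_set)
  qed
  have flat: "flat_piece \<delta> (v j /\<^sub>R norm (v j)) (\<gamma> ` J j)" if j: "j < 2 ^ k" and vj: "\<rho> \<le> norm (v j)" for j
  proof -
    let ?\<tau> = "v j /\<^sub>R norm (v j)"
    have v0: "0 < norm (v j)" using vj \<rho>(1) by linarith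
    then have \<tau>: "norm ?\<tau> = 1" by simp
    have "dist (\<gamma> s) (\<gamma> t) \<le> \<delta> \<and>
        norm ((\<gamma> t - \<gamma> s) - ((\<gamma> t - \<gamma> s) \<bullet> ?\<tau>) *\<^sub>R ?\<tau>) \<le> \<delta> * norm (\<gamma> t - \<gamma> s)"
      if st: "s \<in> J j" "t \<in> J j" for s t
    proof
      have "dist (\<gamma> s) (\<gamma> t) \<le> L * dist s t" using lipschitz_onD[OF L] J01[OF j] st by blast
      also have "\<dots> \<le> L * (1 / 2 ^ k)"
        using Jdist[OF st] L0 by (intro mult_left_mono) (auto simp: dist_real_def abs_minus_commute)
      finally show "dist (\<gamma> s) (\<gamma> t) \<le> \<delta>" using Lk by linarith
      let ?w = "\<gamma> t - \<gamma> s"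
      have ch: "norm (?w - (t - s) *\<^sub>R v j) \<le> \<theta> * \<bar>t - s\<bar>" using chord[OF j st] .
      have eq: "(t - s) *\<^sub>R v j = ((t - s) * norm (v j)) *\<^sub>R ?\<tau>" using v0 by simp
      have "norm (?w - (?w \<bullet> ?\<tau>) *\<^sub>R ?\<tau>) \<le> norm (?w - (t - s) *\<^sub>R v j)"
        unfolding eq by (rule norm_diff_projection_le[OF \<tau>])
      also have "\<dots> \<le> \<theta> * \<bar>t - s\<bar>" by (rule ch)
      \<comment> \<open>By the slope bound and the chord error, the chord has length at least
        \<open>(\<rho> - \<theta>) * |t - s|\<close>.\<close>
      also have "\<theta> * \<bar>t - s\<bar> \<le> \<delta> * norm ?w"
      proof -
        have "\<bar>t - s\<bar> * norm (v j) - \<theta> * \<bar>t - s\<bar> \<le> norm ?w"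
          using ch norm_triangle_ineq2[of "(t - s) *\<^sub>R v j" ?w] by (simp add: norm_minus_commute)
        moreover have "\<bar>t - s\<bar> * \<rho> \<le> \<bar>t - s\<bar> * norm (v j)" using vj by (intro mult_left_mono) auto
        ultimately have "\<delta> * (\<bar>t - s\<bar> * \<rho> - \<theta> * \<bar>t - s\<bar>) \<le> \<delta> * norm ?w"
          using \<delta> by (intro mult_left_mono) auto
        moreover have "\<delta> * (\<bar>t - s\<bar> * \<rho> - \<theta> * \<bar>t - s\<bar>) = \<bar>t - s\<bar> * (\<delta> * \<rho>) - \<delta> * (\<theta> * \<bar>t - s\<bar>)"
          by (simp add: algebra_simps)
        moreover have "\<delta> * (\<theta> * \<bar>t - s\<bar>) \<le> 1 * (\<theta> * \<bar>t - s\<bar>)" using \<delta> \<theta> by (intro mult_right_mono) auto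
        moreover have "\<bar>t - s\<bar> * (\<delta> * \<rho>) = 2 * (\<theta> * \<bar>t - s\<bar>)" by (simp add: \<rho>(3))
        ultimately show ?thesis by linarith
      qed
      finally show "norm (?w - (?w \<bullet> ?\<tau>) *\<^sub>R ?\<tau>) \<le> \<delta> * norm ?w" .
    qed
    then show ?thesis unfolding flat_piece_def using \<tau> by blast
  qed
  define G where "G = {j. j < 2 ^ k \<and> \<rho> \<le> norm (v j)}"
  define F where "F = (\<lambda>j. (\<gamma> ` J j, v j /\<^sub>R norm (v j))) ` G"
  have "finite F" unfolding F_def G_def by (intro finite_imageI) (auto intro: finite_subset[of _ "{..<2^k}"])
  moreover have "compact A \<and> A \<subseteq> \<gamma> ` {0..1} \<and> flat_piece \<delta> \<tau> A" if "(A, \<tau>) \<in> F" for A \<tau>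
    using that cpt flat J01 unfolding F_def G_def by blast
  moreover have "hausdorff 1 (\<gamma> ` {0..1} - (\<Union>(A, \<tau>)\<in>F. A)) \<le> ennreal \<kappa>"
  proof -
    define R where "R = {..<2 ^ k} - G"
    have cover: "\<exists>j<2 ^ k. t \<in> dyadic_cell k j" if t: "t \<in> {0..1}" for t
    \<comment> \<open>The end point \<open>1\<close> belongs to the last cell; the floor would give
      the index \<open>2 ^ k\<close>.\<close>
    proof (cases "t = 1")
      case True
      then show ?thesis
        by (intro exI[of _ "2 ^ k - 1"]) (simp add: dyadic_cell_def of_nat_diff)
    next
      case False
      define j where "j = nat \<lfloor>t * 2 ^ k\<rfloor>"
      have "real j \<le> t * 2 ^ k" "t * 2 ^ k < real j + 1"
        unfolding j_def using t by auto
      moreover have "t * 2 ^ k < 1 * 2 ^ k" using t False by (intro mult_strict_right_mono) auto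
      ultimately have "real j < 2 ^ k" "real j \<le> t * 2 ^ k" "t * 2 ^ k \<le> real (Suc j)" by linarith+
      then have "real j < real (2 ^ k)" "t \<in> dyadic_cell k j"
        by (simp_all only: of_nat_power of_nat_numeral) (simp add: dyadic_cell_def pos_divide_le_eq pos_le_divide_eq del: of_nat_Suc)
      then show ?thesis unfolding of_nat_less_iff by blast
    qed
    have "\<gamma> ` {0..1} - (\<Union>(A, \<tau>)\<in>F. A) \<subseteq> \<gamma> ` (B \<inter> {0..1}) \<union> (\<Union>j\<in>R. \<gamma> ` J j)"
    proof
      fix x assume x: "x \<in> \<gamma> ` {0..1} - (\<Union>(A, \<tau>)\<in>F. A)"
      then obtain t where t: "t \<in> {0..1}" "x = \<gamma> t" by blast
      obtain j where j: "j < 2 ^ k" "t \<in> dyadic_cell k j" using cover[OF t(1)] by blast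
      show "x \<in> \<gamma> ` (B \<inter> {0..1}) \<union> (\<Union>j\<in>R. \<gamma> ` J j)"
      proof (cases "t \<in> B")
        case False
        then have xj: "x \<in> \<gamma> ` J j" using t j by (auto simp: J_def)
        then have "j \<notin> G" using x unfolding F_def by blast
        then show ?thesis using xj j by (auto simp: R_def)
      qed (use t in auto)
    qed
    then have "hausdorff 1 (\<gamma> ` {0..1} - (\<Union>(A, \<tau>)\<in>F. A)) \<le>
        hausdorff 1 (\<gamma> ` (B \<inter> {0..1})) + hausdorff 1 (\<Union>j\<in>R. \<gamma> ` J j)"
      by (meson hausdorff_mono hausdorff_Un_le order_trans)
    also have "hausdorff 1 (\<gamma> ` (B \<inter> {0..1})) \<le> ennreal (\<kappa> / 2)"
    proof -
      have "L-lipschitz_on (B \<inter> {0..1}) \<gamma>" using L by (rule lipschitz_on_subset) auto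
      then have "hausdorff 1 (\<gamma> ` (B \<inter> {0..1})) \<le> ennreal L * hausdorff 1 (B \<inter> {0..1})"
        by (rule hausdorff_Lipschitz_image)
      also have "\<dots> \<le> ennreal L * hausdorff 1 B" by (intro mult_left_mono hausdorff_mono) auto
      also have "\<dots> \<le> ennreal L * ennreal (5 * e / \<theta>\<^sup>2)"
        unfolding B_def by (intro mult_left_mono hausdorff_bad_set_le E \<theta>) auto
      also have "\<dots> \<le> ennreal (\<kappa> / 2)" using Le L0 e by (simp flip: ennreal_mult add: ennreal_leI)
      finally show ?thesis .
    qed
    also have "hausdorff 1 (\<Union>j\<in>R. \<gamma> ` J j) \<le> ennreal (\<kappa> / 2)"
    proof (rule countable_subadditive_UN_le[OF hausdorff_UN_le hausdorff_empty])
      show "countable R" by (simp add: R_def)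
      fix j assume j: "j \<in> R"
      then have jk: "j < 2 ^ k" and vj: "norm (v j) \<le> \<rho>" by (auto simp: R_def G_def)
      have "(\<rho> + \<theta>)-lipschitz_on (J j) \<gamma>"
      proof (rule lipschitz_onI)
        fix s t assume st: "s \<in> J j" "t \<in> J j"
        have "norm (\<gamma> s - \<gamma> t) \<le> norm (\<gamma> s - \<gamma> t - (s - t) *\<^sub>R v j) + norm ((s - t) *\<^sub>R v j)"
          by (metis norm_triangle_sub add.commute)
        also have "\<dots> \<le> \<theta> * \<bar>s - t\<bar> + \<bar>s - t\<bar> * \<rho>"
          using chord[OF jk st(2,1)] vj by (intro add_mono) (auto intro: mult_left_mono)
        finally show "dist (\<gamma> s) (\<gamma> t) \<le> (\<rho> + \<theta>) * dist s t" by (simp add: dist_norm algebra_simps)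
      qed (use \<rho> \<theta> in auto)
      then have "hausdorff 1 (\<gamma> ` J j) \<le> ennreal (\<rho> + \<theta>) * hausdorff 1 (J j)"
        by (rule hausdorff_Lipschitz_image)
      also have "\<dots> \<le> ennreal (\<rho> + \<theta>) * hausdorff 1 (dyadic_cell k j)"
        by (intro mult_left_mono hausdorff_mono) (auto simp: J_def)
      also have "\<dots> \<le> ennreal (\<rho> + \<theta>) * ennreal (1 / 2 ^ k)"
      proof (rule mult_left_mono)
        have "real (Suc j) / 2 ^ k - real j / 2 ^ k = 1 / 2 ^ k" by (simp flip: diff_divide_distrib)
        then show "hausdorff 1 (dyadic_cell k j) \<le> ennreal (1 / 2 ^ k)"
          unfolding dyadic_cell_def using hausdorff_interval_le[of "real j / 2 ^ k" "real (Suc j) / 2 ^ k"]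
          by (simp add: divide_right_mono)
      qed simp
      also have "\<dots> = ennreal ((\<rho> + \<theta>) / 2 ^ k)" using \<rho> \<theta> by (simp flip: ennreal_mult ennreal_plus)
      finally show "hausdorff 1 (\<gamma> ` J j) \<le> ennreal ((\<rho> + \<theta>) / 2 ^ k)" .
    next
      fix H assume H: "finite H" "H \<subseteq> R"
      have "card H \<le> card {..<(2::nat) ^ k}" using H by (intro card_mono) (auto simp: R_def)
      then have "real (card H) \<le> 2 ^ k" by (metis card_lessThan of_nat_le_iff of_nat_numeral of_nat_power)
      from this have "real (card H) * ((\<rho> + \<theta>) / 2 ^ k) \<le> 2 ^ k * ((\<rho> + \<theta>) / 2 ^ k)"
        using \<rho> \<theta> by (intro mult_right_mono) auto
      also have "2 ^ k * ((\<rho> + \<theta>) / 2 ^ k) = \<rho> + \<theta>" by simp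
      also have "\<dots> \<le> \<kappa> / 2" by (rule \<rho>(2))
      finally have "real (card H) * ((\<rho> + \<theta>) / 2 ^ k) \<le> \<kappa> / 2" .
      then show "(\<Sum>j\<in>H. ennreal ((\<rho> + \<theta>) / 2 ^ k)) \<le> ennreal (\<kappa> / 2)"
        using \<rho> \<theta> by (simp add: ennreal_of_nat_eq_real_of_nat ennreal_leI flip: ennreal_mult)
    qed
    finally show ?thesis using \<kappa> by (simp add: add_mono flip: ennreal_plus)
  qed
  ultimately show ?thesis by (intro exI[of _ F]) auto
qed

section \<open>Densities\<close>

text \<open>Let \<open>N t\<close> be the points of \<open>A\<close> with arbitrarily small balls of
  density ratio above \<open>t\<close>. Vitali's lemma bounds its length by \<open>5 / t\<close>
  times the length of \<open>T\<close> in a neighbourhood \<open>U n\<close> of \<open>A\<close>. As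
  \<open>A\<close> is closed and disjoint from \<open>T\<close>, the sets
  \<open>T \<inter> U n\<close> decrease to the empty set, and by finiteness their length tends to
  0.\<close>

lemma AE_density_null:
  fixes A T :: "'a::euclidean_space set"
  assumes A: "closed A" and T: "T \<in> sets (hausdorff_measure 1)" and disj: "A \<inter> T = {}"
    and fin: "hausdorff 1 T < top"
  shows "\<exists>N. hausdorff 1 N = 0 \<and> (\<forall>x\<in>A - N.
    ((\<lambda>r. hausdorff 1 (T \<inter> cball x r) / ennreal (2 * r)) \<longlongrightarrow> 0) (at_right 0))"
proof -
  let ?H = "hausdorff_measure 1 :: 'a measure"
  define N where "N t = {x \<in> A. \<forall>d>0. \<exists>r>0. r < d \<and> ennreal (t * (2 * r)) < hausdorff 1 (T \<inter> cball x r)}" for t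
  have meas: "T \<inter> cball x r \<in> sets ?H" for x r
    by (intro sets.Int T borel_subset_hausdorff_measure) auto
  have null: "hausdorff 1 (N t) = 0" if t: "0 < t" for t
  proof -
    define U where "U n = {x. infdist x A < inverse (real (Suc n))}" for n
    have U: "open (U n)" for n unfolding U_def by (intro open_Collect_less continuous_intros)
    have TU: "T \<inter> U n \<in> sets ?H" for n
      using U by (intro sets.Int T borel_subset_hausdorff_measure) auto
    have lim: "(\<lambda>n. hausdorff 1 (T \<inter> U n)) \<longlonglongrightarrow> 0" if "A \<noteq> {}"
    proof -
      have "(\<lambda>n. emeasure ?H (T \<inter> U n)) \<longlonglongrightarrow> emeasure ?H (\<Inter>n. T \<inter> U n)"
      proof (rule Lim_emeasure_decseq)
        show "decseq (\<lambda>n. T \<inter> U n)"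
        proof (rule decseq_SucI)
          fix n
          have "inverse (real (Suc (Suc n))) \<le> inverse (real (Suc n))" by simp
          then have "infdist x A < inverse (real (Suc n))" if "infdist x A < inverse (real (Suc (Suc n)))" for x
            using that by linarith
          then show "T \<inter> U (Suc n) \<subseteq> T \<inter> U n" unfolding U_def by blast
        qed
        show "emeasure ?H (T \<inter> U n) \<noteq> \<infinity>" for n
        proof -
          have "hausdorff 1 (T \<inter> U n) < top" using hausdorff_mono[of "T \<inter> U n" T 1] fin by (auto intro: le_less_trans)
          then show ?thesis using emeasure_hausdorff_measure[OF TU, of n] by simp
        qed
      qed (use TU in auto)
      moreover have "(\<Inter>n. T \<inter> U n) = {}"
      proof (rule ccontr)
        assume "\<not> ?thesis"
        then obtain x where x: "x \<in> T" "\<And>n. infdist x A < inverse (real (Suc n))" by (auto simp: U_def)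
        have "infdist x A \<le> 0"
        proof (rule ccontr)
          assume "\<not> ?thesis"
          then obtain n where "inverse (real (Suc n)) < infdist x A" using reals_Archimedean[of "infdist x A"] by auto
          then show False using x(2)[of n] by simp
        qed
        then have "x \<in> A" using in_closed_iff_infdist_zero[OF A that, of x] infdist_nonneg[of x A] by simp
        then show False using x disj by blast
      qed
      ultimately show ?thesis unfolding emeasure_hausdorff_measure[OF TU] by simp
    qed
    have le: "hausdorff 1 (N t) \<le> ennreal (5 / t) * hausdorff 1 (T \<inter> U n)" for n
    proof (rule hausdorff_le)
      fix \<delta> :: real assume \<delta>: "0 < \<delta>"
      \<comment> \<open>Radii below \<open>1/(n+1)\<close> keep the balls inside \<open>U n\<close>;
        radii below \<open>\<delta> / 10\<close> make the fivefold balls, of diameter at most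
        \<open>10 * r x\<close>, admissible for the premeasure.\<close>
      define d where "d = min (inverse (real (Suc n))) (\<delta> / 10)"
      have d: "0 < d" using \<delta> by (simp add: d_def)
      have "\<exists>r>0. r < d \<and> ennreal (t * (2 * r)) < hausdorff 1 (T \<inter> cball x r)" if "x \<in> N t" for x
        using that d unfolding N_def by blast
      then obtain r where r: "\<And>x. x \<in> N t \<Longrightarrow> 0 < r x" "\<And>x. x \<in> N t \<Longrightarrow> r x < d"
          "\<And>x. x \<in> N t \<Longrightarrow> ennreal (t * (2 * r x)) < hausdorff 1 (T \<inter> cball x (r x))"
        by metis
      have sub: "cball x (r x) \<subseteq> U n" if x: "x \<in> N t" for x
      proof
        fix y assume "y \<in> cball x (r x)"
        moreover have "infdist y A \<le> dist y x" using x by (intro infdist_le) (simp add: N_def)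
        moreover have "r x < inverse (real (Suc n))" using r(2)[OF x] by (simp add: d_def)
        ultimately show "y \<in> U n" by (simp add: U_def dist_commute del: of_nat_Suc)
      qed
      have cov: "N t \<subseteq> (\<Union>x\<in>N t. cball x (r x))"
      proof
        fix x assume "x \<in> N t"
        then have "x \<in> cball x (r x)" using r(1) by (simp add: less_imp_le)
        then show "x \<in> (\<Union>x\<in>N t. cball x (r x))" using \<open>x \<in> N t\<close> by blast
      qed
      obtain C where C: "countable C" "C \<subseteq> N t"
         "pairwise (\<lambda>i j. disjnt (cball i (r i)) (cball j (r j))) C"
         "N t \<subseteq> (\<Union>i\<in>C. cball i (5 * r i))"
        by (rule Vitali_covering_lemma_cballs[OF cov, of d]) (use r in \<open>auto simp: less_imp_le\<close>)
      have "hausdorff_premeasure \<delta> 1 (N t) \<le> hausdorff_premeasure \<delta> 1 (\<Union>i\<in>C. cball i (5 * r i))"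
        using C(4) by (rule hausdorff_premeasure_mono)
      also have "\<dots> \<le> ennreal (5 / t) * hausdorff 1 (T \<inter> U n)"
      proof (rule countable_subadditive_UN_le[OF hausdorff_premeasure_UN_le _ C(1)])
        show "hausdorff_premeasure \<delta> 1 {} = 0" using \<delta> by simp
        fix x assume "x \<in> C"
        then have x: "x \<in> N t" using C(2) by auto
        have dm: "diameter (cball x (5 * r x)) \<le> 10 * r x"
        proof (rule diameter_le_dist)
          fix y z assume "y \<in> cball x (5 * r x)" "z \<in> cball x (5 * r x)"
          then show "dist y z \<le> 10 * r x" using dist_triangle3[of y z x] by simp
        qed (use r(1)[OF x] in simp)
        have "10 * r x \<le> \<delta>" using r(2)[OF x] by (simp add: d_def)
        then have "hausdorff_premeasure \<delta> 1 (cball x (5 * r x)) \<le> hausdorff_weight 1 (cball x (5 * r x))"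
          using dm \<delta> by (intro hausdorff_premeasure_le_weight) auto
        also have "\<dots> \<le> ennreal (10 * r x)" using dm by (simp add: hausdorff_weight_1 ennreal_leI)
        also have "\<dots> = ennreal (5 / t) * ennreal (t * (2 * r x))"
          using t r(1)[OF x] by (simp flip: ennreal_mult)
        also have "\<dots> \<le> ennreal (5 / t) * hausdorff 1 (T \<inter> cball x (r x))"
          using r(3)[OF x] by (intro mult_left_mono) auto
        finally show "hausdorff_premeasure \<delta> 1 (cball x (5 * r x)) \<le>
            ennreal (5 / t) * hausdorff 1 (T \<inter> cball x (r x))" .
      next
        fix F assume F: "finite F" "F \<subseteq> C"
        have "(\<Sum>x\<in>F. hausdorff 1 (T \<inter> cball x (r x))) = (\<Sum>x\<in>F. emeasure ?H (T \<inter> cball x (r x)))"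
          by (intro sum.cong refl emeasure_hausdorff_measure[symmetric] meas)
        also have "\<dots> = emeasure ?H (\<Union>x\<in>F. T \<inter> cball x (r x))"
        proof (rule sum_emeasure)
          show "disjoint_family_on (\<lambda>x. T \<inter> cball x (r x)) F"
            unfolding disjoint_family_on_def
          proof (intro ballI impI)
            fix x y assume "x \<in> F" "y \<in> F" "x \<noteq> y"
            then have "disjnt (cball x (r x)) (cball y (r y))" using pairwiseD[OF C(3), of x y] F by auto
            then show "T \<inter> cball x (r x) \<inter> (T \<inter> cball y (r y)) = {}" by (auto simp: disjnt_def)
          qed
        qed (use meas F in auto)
        also have "\<dots> \<le> emeasure ?H (T \<inter> U n)"
          using TU F C sub by (intro emeasure_mono) blast+
        also have "\<dots> = hausdorff 1 (T \<inter> U n)" by (rule emeasure_hausdorff_measure[OF TU])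
        finally show "(\<Sum>x\<in>F. ennreal (5 / t) * hausdorff 1 (T \<inter> cball x (r x))) \<le>
            ennreal (5 / t) * hausdorff 1 (T \<inter> U n)"
          by (simp add: mult_left_mono flip: sum_distrib_left)
      qed
      finally show "hausdorff_premeasure \<delta> 1 (N t) \<le> ennreal (5 / t) * hausdorff 1 (T \<inter> U n)" .
    qed
    show ?thesis
    proof (cases "A = {}")
      case True then show ?thesis by (simp add: N_def)
    next
      case False
      have "(\<lambda>n. ennreal (5 / t) * hausdorff 1 (T \<inter> U n)) \<longlonglongrightarrow> ennreal (5 / t) * 0"
        by (intro tendsto_mult_ennreal tendsto_const lim False) auto
      from LIMSEQ_le_const[OF this, of "hausdorff 1 (N t)"] le show ?thesis by auto
    qed
  qed
  define M where "M = (\<Union>m. N (inverse (real (Suc m))))"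
  have "hausdorff 1 M = 0" unfolding M_def by (intro hausdorff_null_UN null) simp
  moreover have "((\<lambda>r. hausdorff 1 (T \<inter> cball x r) / ennreal (2 * r)) \<longlongrightarrow> 0) (at_right 0)"
    if x: "x \<in> A - M" for x
  proof (rule order_tendstoI)
    fix a :: ennreal assume "0 < a"
    \<comment> \<open>The bound \<open>a\<close> may be infinite; a smaller positive number
      \<open>b\<close> is a real threshold that can be compared with the countable family.\<close>
    then obtain b where b: "0 < b" "b < a" using dense by blast
    then have "b < top" by (metis less_top_ennreal order.strict_trans less_le_trans top_greatest)
    then obtain \<beta> where \<beta>: "b = ennreal \<beta>" "0 < \<beta>" using b(1) by (cases b) auto
    obtain m where m: "inverse (real (Suc m)) < \<beta>" using reals_Archimedean[OF \<beta>(2)] by blast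
    have "x \<notin> N (inverse (real (Suc m)))" using x unfolding M_def by blast
    have "\<exists>d>0. \<forall>r>0. r < d \<longrightarrow> hausdorff 1 (T \<inter> cball x r) \<le> ennreal (inverse (real (Suc m)) * (2 * r))"
    proof -
      have "\<not> (\<forall>d>0. \<exists>r>0. r < d \<and> ennreal (inverse (real (Suc m)) * (2 * r)) < hausdorff 1 (T \<inter> cball x r))"
        using \<open>x \<notin> N (inverse (real (Suc m)))\<close> x unfolding N_def by blast
      then show ?thesis by (meson not_le)
    qed
    then obtain d where d: "0 < d" "\<And>r. 0 < r \<Longrightarrow> r < d \<Longrightarrow>
        hausdorff 1 (T \<inter> cball x r) \<le> ennreal (inverse (real (Suc m)) * (2 * r))"
      by blast
    have "eventually (\<lambda>r. 0 < r \<and> r < d) (at_right (0::real))"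
      using eventually_at_right_real[OF d(1)] by (rule eventually_mono) auto
    then show "eventually (\<lambda>r. hausdorff 1 (T \<inter> cball x r) / ennreal (2 * r) < a) (at_right 0)"
    proof eventually_elim
      case (elim r)
      then have "hausdorff 1 (T \<inter> cball x r) / ennreal (2 * r) \<le> ennreal (inverse (real (Suc m)) * (2 * r)) / ennreal (2 * r)"
        using d(2) by (intro divide_right_mono_ennreal) auto
      also have "\<dots> = ennreal (inverse (real (Suc m)))" using elim by (subst divide_ennreal) auto
      also have "\<dots> < a" using m b \<beta> by (metis ennreal_lessI order.strict_trans)
      finally show ?case .
    qed
  qed (simp)
  ultimately show ?thesis by blast
qed

section \<open>The ridge set\<close>

definition nearest_points :: "'a::metric_space set \<Rightarrow> 'a \<Rightarrow> 'a set" where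
  "nearest_points S x = {p \<in> S. dist x p = infdist x S}"

lemma nearest_points_le: "p \<in> nearest_points S x \<Longrightarrow> q \<in> S \<Longrightarrow> dist x p \<le> dist x q"
  by (simp add: nearest_points_def infdist_le)

text \<open>The projection is monotone, being a selection of the subdifferential of the convex function
  \<open>x \<mapsto> (|x|\<^sup>2 - dist(x, S)\<^sup>2) / 2\<close>.\<close>

lemma nearest_points_monotone:
  fixes x y :: "'a::euclidean_space"
  assumes "p \<in> nearest_points S x" "q \<in> nearest_points S y"
  shows "0 \<le> (x - y) \<bullet> (p - q)"
proof -
  have "(dist x p)\<^sup>2 \<le> (dist x q)\<^sup>2" "(dist y q)\<^sup>2 \<le> (dist y p)\<^sup>2"
    using nearest_points_le[OF assms(1), of q] nearest_points_le[OF assms(2), of p] assms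
    by (auto intro!: power_mono simp: nearest_points_def infdist_nonneg)
  then show ?thesis
    unfolding dist_norm power2_norm_eq_inner
    by (simp add: inner_diff_left inner_diff_right inner_commute)
qed

text \<open>The coordinates other than \<open>i\<close> determine the points of \<open>R\<close> in
  a Lipschitz way. A grid of mesh \<open>1 / m\<close> in these \<open>d\<close> coordinates splits
  \<open>R\<close> into at most \<open>(2 * N * m + 1) ^ d\<close> sets of diameter at most
  \<open>c / m\<close>; the powers of \<open>m\<close> cancel, and the total weight stays below
  \<open>b\<close>.\<close>

lemma hausdorff_finite_graph:
  fixes R :: "(real ^ 'n) set"
  assumes R: "\<And>x. x \<in> R \<Longrightarrow> norm x \<le> real N"
    and c: "0 \<le> c" and graph: "\<And>x y t. x \<in> R \<Longrightarrow> y \<in> R \<Longrightarrow> (\<And>j. j \<noteq> i \<Longrightarrow> \<bar>x $ j - y $ j\<bar> \<le> t) \<Longrightarrow> 0 \<le> t \<Longrightarrow> dist x y \<le> c * t"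
  shows "hausdorff (CARD('n) - 1) R < top"
proof -
  define d where "d = CARD('n) - 1"
  define u where "u = unit_ball_vol (real d)"
  have u: "0 \<le> u" by (simp add: u_def less_imp_le)
  define b where "b = u * ((real (2 * N + 1)) * c / 2) ^ d"
  have "hausdorff d R \<le> ennreal b"
  proof (rule hausdorff_le)
    fix \<delta> :: real assume \<delta>: "0 < \<delta>"
    obtain m0 :: nat where m0: "c / \<delta> < real m0" using reals_Archimedean2 by blast
    define m where "m = Suc m0"
    have m: "c / real m \<le> \<delta>" "0 < real m" using m0 \<delta> by (auto simp: m_def field_simps)
    define I where "I = {- int (N * m)..int (N * m)}"
    define G where "G = (\<Pi>\<^sub>E j\<in>UNIV - {i}. I)"
    define C where "C g = {x \<in> R. \<forall>j. j \<noteq> i \<longrightarrow> \<lfloor>real m * x $ j\<rfloor> = g j}" for g :: "'n \<Rightarrow> int"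
    have G: "finite G" unfolding G_def I_def by (intro finite_PiE) auto
    have cardG: "card G = (2 * N * m + 1) ^ d"
    proof -
    have "card I = 2 * N * m + 1" unfolding I_def card_atLeastAtMost_int by linarith
    then show ?thesis unfolding G_def d_def by (subst card_PiE) auto
  qed
    have Cd: "dist x y \<le> c / real m" if "x \<in> C g" "y \<in> C g" for x y g
    proof -
      have "dist x y \<le> c * (1 / real m)"
      proof (rule graph)
        fix j assume "j \<noteq> i"
        then have "\<lfloor>real m * x $ j\<rfloor> = \<lfloor>real m * y $ j\<rfloor>" using that by (simp add: C_def)
        then have "\<bar>real m * x $ j - real m * y $ j\<bar> \<le> 1" by linarith
        then have "real m * \<bar>x $ j - y $ j\<bar> \<le> 1" using m(2) by (simp add: abs_mult flip: right_diff_distrib)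
        then show "\<bar>x $ j - y $ j\<bar> \<le> 1 / real m" using m(2) by (simp add: field_simps)
      qed (use that m in \<open>auto simp: C_def\<close>)
      then show ?thesis by simp
    qed
    have bC: "bounded (C g)" for g unfolding bounded_two_points using Cd by blast
    have dC: "diameter (C g) \<le> c / real m" for g
      by (rule diameter_le_dist) (use Cd c m in auto)
    have "R \<subseteq> (\<Union>g\<in>G. C g)"
    proof
      fix x assume x: "x \<in> R"
      define g where "g = (\<lambda>j\<in>UNIV - {i}. \<lfloor>real m * x $ j\<rfloor>)"
      have "\<lfloor>real m * x $ j\<rfloor> \<in> I" for j
      proof -
        have "\<bar>x $ j\<bar> \<le> real N" using component_le_norm_cart[of x j] R[OF x] by linarith
        then have "\<bar>real m * x $ j\<bar> \<le> real m * real N" using m by (simp add: abs_mult mult_left_mono)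
        then have "- real_of_int (int (N * m)) \<le> real m * x $ j" "real m * x $ j \<le> real_of_int (int (N * m))"
          by (auto simp: mult.commute abs_le_iff)
        then show ?thesis unfolding I_def by (simp add: le_floor_iff floor_le_iff)
      qed
      then have "g \<in> G" unfolding g_def G_def by auto
      moreover have "x \<in> C g" using x by (simp add: C_def g_def)
      ultimately show "x \<in> (\<Union>g\<in>G. C g)" by blast
    qed
    then have "hausdorff_premeasure \<delta> d R \<le> hausdorff_premeasure \<delta> d (\<Union>g\<in>G. C g)"
      by (rule hausdorff_premeasure_mono)
    also have "\<dots> \<le> ennreal b"
    proof (rule countable_subadditive_UN_le[OF hausdorff_premeasure_UN_le])
      show "hausdorff_premeasure \<delta> d {} = 0" using \<delta> by simp
      show "countable G" using G by (rule countable_finite)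
      fix g assume "g \<in> G"
      have "hausdorff_premeasure \<delta> d (C g) \<le> hausdorff_weight d (C g)"
        using bC dC[of g] m \<delta> by (intro hausdorff_premeasure_le_weight) auto
      also have "\<dots> \<le> ennreal (u * (c / real m / 2) ^ d)"
        unfolding hausdorff_weight_def u_def[symmetric]
        using u dC[of g] diameter_ge_0[OF bC[of g]]
        by (auto intro!: ennreal_leI mult_left_mono power_mono)
      finally show "hausdorff_premeasure \<delta> d (C g) \<le> ennreal (u * (c / real m / 2) ^ d)" .
    next
      fix F assume F: "finite F" "F \<subseteq> G"
      have w0: "0 \<le> u * (c / real m / 2) ^ d" using u c by simp
      have "real (card F) \<le> real (card G)" using F G by (simp add: card_mono)
      also have "\<dots> = (real (2 * N * m + 1)) ^ d" by (simp add: cardG)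
      also have "\<dots> \<le> (real (2 * N + 1) * real m) ^ d"
      proof (rule power_mono)
        have "2 * N * m + 1 \<le> (2 * N + 1) * m" by (simp add: m_def)
        then show "real (2 * N * m + 1) \<le> real (2 * N + 1) * real m" by (metis of_nat_le_iff of_nat_mult)
      qed simp
      finally have "real (card F) * (u * (c / real m / 2) ^ d) \<le> (real (2 * N + 1) * real m) ^ d * (u * (c / real m / 2) ^ d)"
        using w0 by (rule mult_right_mono)
      also have "\<dots> = u * ((real (2 * N + 1) * real m) * (c / real m / 2)) ^ d"
        by (simp only: power_mult_distrib mult_ac)
      also have "(real (2 * N + 1) * real m) * (c / real m / 2) = real (2 * N + 1) * c / 2" using m by simp
      finally have "real (card F) * (u * (c / real m / 2) ^ d) \<le> b" by (simp add: b_def)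
      then have "ennreal (real (card F) * (u * (c / real m / 2) ^ d)) \<le> ennreal b" by (rule ennreal_leI)
      moreover have "(\<Sum>g\<in>F. ennreal (u * (c / real m / 2) ^ d)) = ennreal (real (card F) * (u * (c / real m / 2) ^ d))"
        unfolding sum_constant using w0 by (simp only: ennreal_of_nat_eq_real_of_nat ennreal_mult of_nat_0_le_iff)
      ultimately show "(\<Sum>g\<in>F. ennreal (u * (c / real m / 2) ^ d)) \<le> ennreal b" by simp
    qed
    finally show "hausdorff_premeasure \<delta> d R \<le> ennreal b" .
  qed
  also have "ennreal b < top" by simp
  finally show ?thesis by (simp add: d_def)
qed

text \<open>Fixing a coordinate in which two nearest points differ, and a gap from \<open>a\<close>
  to \<open>b\<close> between their values, makes the condition closed and quantitative. Rational
  gaps and integer radii leave countably many pieces.\<close>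

definition ridge_piece :: "(real ^ 'n) set \<Rightarrow> nat \<Rightarrow> 'n \<Rightarrow> real \<Rightarrow> real \<Rightarrow> (real ^ 'n) set" where
  "ridge_piece S N i a b = {x. norm x \<le> real N \<and>
     (\<exists>p\<in>nearest_points S x. \<exists>q\<in>nearest_points S x. p $ i \<le> a \<and> b \<le> q $ i)}"

text \<open>The piece is the projection of a compact set of triples. Compactness makes it Borel, as
  the hypothesis on \<open>\<mu>\<close> demands.\<close>

lemma compact_ridge_piece:
  assumes "compact S"
  shows "compact (ridge_piece S N i a b)"
proof -
  let ?K = "cball 0 (real N) \<times> S \<times> S"
  let ?Z = "{z. dist (fst z) (fst (snd z)) = infdist (fst z) S \<and> dist (fst z) (snd (snd z)) = infdist (fst z) S \<and>
      fst (snd z) $ i \<le> a \<and> b \<le> snd (snd z) $ i}"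
  have "closed ?Z"
    by (intro closed_Collect_conj closed_Collect_eq closed_Collect_le continuous_intros)
  then have "compact (?K \<inter> ?Z)" using assms by (intro compact_Int_closed compact_Times) auto
  then have "compact (fst ` (?K \<inter> ?Z))" by (intro compact_continuous_image continuous_intros)
  also have "fst ` (?K \<inter> ?Z) = ridge_piece S N i a b"
    unfolding ridge_piece_def nearest_points_def by (force simp: image_iff)
  finally show ?thesis .
qed

text \<open>For \<open>y $ i \<le> x $ i\<close> take a nearest point of \<open>x\<close> with
  coordinate at most \<open>a\<close> and one of \<open>y\<close> with coordinate at least
  \<open>b\<close>. Coordinate \<open>i\<close> then contributes at most
  \<open>- (b - a) * (x $ i - y $ i)\<close> to the inner product, which is nonnegative by
  monotonicity; so the other coordinates must compensate and therefore control coordinate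
  \<open>i\<close>.\<close>

lemma hausdorff_ridge_piece:
  fixes S :: "(real ^ 'n) set"
  assumes S: "compact S" and ab: "a < b"
  shows "hausdorff (CARD('n) - 1) (ridge_piece S N i a b) < top"
proof -
  obtain D where D: "\<And>p q. p \<in> S \<Longrightarrow> q \<in> S \<Longrightarrow> dist p q \<le> D"
    using compact_imp_bounded[OF S] unfolding bounded_two_points by blast
  \<comment> \<open>If \<open>S\<close> is empty, \<open>D\<close> may be negative.\<close>
  define D' where "D' = max D 0"
  define n where "n = real CARD('n)"
  define c where "c = n * D' / (b - a) + n"
  have D'0: "0 \<le> D'" "0 \<le> n" by (auto simp: D'_def n_def)
  show ?thesis
  proof (rule hausdorff_finite_graph)
    show "norm x \<le> real N" if "x \<in> ridge_piece S N i a b" for x using that by (simp add: ridge_piece_def)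
    show "0 \<le> c" using D'0 ab by (simp add: c_def)
    fix x y :: "real ^ 'n" and t :: real
    assume xy: "x \<in> ridge_piece S N i a b" "y \<in> ridge_piece S N i a b"
      and t: "\<And>j. j \<noteq> i \<Longrightarrow> \<bar>x $ j - y $ j\<bar> \<le> t" "0 \<le> t"
    have one: "(b - a) * (x $ i - y $ i) \<le> n * (t * D')"
      if xy: "x \<in> ridge_piece S N i a b" "y \<in> ridge_piece S N i a b" and gt: "y $ i \<le> x $ i"
        and t: "\<And>j. j \<noteq> i \<Longrightarrow> \<bar>x $ j - y $ j\<bar> \<le> t" for x y
    proof -
      obtain p where p: "p \<in> nearest_points S x" "p $ i \<le> a" using xy(1) by (auto simp: ridge_piece_def)
      obtain q where q: "q \<in> nearest_points S y" "b \<le> q $ i" using xy(2) by (auto simp: ridge_piece_def)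
      have pq: "\<bar>p $ j - q $ j\<bar> \<le> D'" for j
        using component_le_norm_cart[of "p - q" j] D[of p q] p q
        by (auto simp: nearest_points_def dist_norm D'_def)
      have "0 \<le> (\<Sum>j\<in>UNIV. (x $ j - y $ j) * (p $ j - q $ j))"
        using nearest_points_monotone[OF p(1) q(1)] by (simp add: inner_vec_def)
      also have "\<dots> = (x $ i - y $ i) * (p $ i - q $ i) + (\<Sum>j\<in>UNIV - {i}. (x $ j - y $ j) * (p $ j - q $ j))"
        by (rule sum.remove) auto
      also have "(\<Sum>j\<in>UNIV - {i}. (x $ j - y $ j) * (p $ j - q $ j)) \<le> (\<Sum>j\<in>UNIV - {i}. t * D')"
      proof (rule sum_mono)
        fix j assume "j \<in> UNIV - {i}"
        then have "\<bar>(x $ j - y $ j) * (p $ j - q $ j)\<bar> \<le> t * D'"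
          unfolding abs_mult using t[of j] pq[of j] by (intro mult_mono) auto
        then show "(x $ j - y $ j) * (p $ j - q $ j) \<le> t * D'" by linarith
      qed
      also have "(\<Sum>j\<in>UNIV - {i}. t * D') \<le> n * (t * D')"
        using \<open>0 \<le> t\<close> D'0 by (simp add: n_def mult_right_mono)
      also have "(x $ i - y $ i) * (p $ i - q $ i) \<le> (x $ i - y $ i) * (a - b)"
        using gt p q by (intro mult_left_mono) auto
      finally show ?thesis by (simp add: algebra_simps)
    qed
    have "(b - a) * \<bar>x $ i - y $ i\<bar> \<le> n * (t * D')"
    proof (cases "y $ i \<le> x $ i")
      case True
      then show ?thesis using one[OF xy True] t by simp
    next
      case False
      then show ?thesis using one[of y x] xy t by (simp add: abs_minus_commute)
    qed
    then have xi: "\<bar>x $ i - y $ i\<bar> \<le> n * D' / (b - a) * t" using ab by (simp add: field_simps)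
    have "dist x y \<le> (\<Sum>j\<in>UNIV. \<bar>(x - y) $ j\<bar>)" unfolding dist_norm by (rule norm_le_l1_cart)
    also have "\<dots> = \<bar>x $ i - y $ i\<bar> + (\<Sum>j\<in>UNIV - {i}. \<bar>x $ j - y $ j\<bar>)"
      by (subst sum.remove[of _ i]) auto
    also have "(\<Sum>j\<in>UNIV - {i}. \<bar>x $ j - y $ j\<bar>) \<le> (\<Sum>j\<in>UNIV - {i}. t)" using t by (intro sum_mono) auto
    also have "\<dots> \<le> n * t" using t(2) by (simp add: n_def mult_right_mono)
    finally show "dist x y \<le> c * t" using xi by (simp add: c_def algebra_simps)
  qed
qed

lemma ridge_set_subset:
  fixes S :: "(real ^ 'n) set"
  assumes "p \<in> nearest_points S x" "q \<in> nearest_points S x" "p \<noteq> q"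
  shows "\<exists>N i a b. a \<in> \<rat> \<and> b \<in> \<rat> \<and> a < b \<and> x \<in> ridge_piece S N i a b"
proof -
  obtain N :: nat where N: "norm x \<le> real N" using real_arch_simple by blast
  obtain i where i: "p $ i \<noteq> q $ i" using assms(3) by (metis vec_eq_iff)
  have *: "\<exists>a b. a \<in> \<rat> \<and> b \<in> \<rat> \<and> a < b \<and> x \<in> ridge_piece S N i a b"
    if pq: "p \<in> nearest_points S x" "q \<in> nearest_points S x" "p $ i < q $ i" for p q
  proof -
    obtain a where a: "a \<in> \<rat>" "p $ i < a" "a < q $ i" using Rats_dense_in_real[OF pq(3)] by blast
    obtain b where b: "b \<in> \<rat>" "a < b" "b < q $ i" using Rats_dense_in_real[OF a(3)] by blast
    have "x \<in> ridge_piece S N i a b"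
      unfolding ridge_piece_def mem_Collect_eq
      using pq(1,2) a b N by (intro conjI bexI[of _ p] bexI[of _ q]) auto
    then show ?thesis using a b by blast
  qed
  from i have "p $ i < q $ i \<or> q $ i < p $ i" by linarith
  then show ?thesis using *[OF assms(1,2)] *[OF assms(2,1)] by blast
qed

lemma AE_unique_nearest_point:
  fixes \<mu> :: "(real ^ 'n) measure" and S :: "(real ^ 'n) set"
  assumes S: "compact S" and sets: "sets \<mu> = sets borel"
    and null: "\<And>E. E \<in> sets borel \<Longrightarrow> hausdorff (CARD('n) - 1) E < top \<Longrightarrow> emeasure \<mu> E = 0"
  shows "AE x in \<mu>. \<forall>p\<in>nearest_points S x. \<forall>q\<in>nearest_points S x. p = q"
proof -
  let ?I = "UNIV \<times> UNIV \<times> {ab \<in> \<rat> \<times> \<rat>. fst ab < snd ab} :: (nat \<times> 'n \<times> real \<times> real) set"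
  let ?P = "\<lambda>(N, i, a, b). ridge_piece S N i a b"
  have c: "countable ?I"
    by (intro countable_SIGMA countable_subset[of "{ab \<in> \<rat> \<times> \<rat>. fst ab < snd ab}" "\<rat> \<times> \<rat>"] countable_rat) auto
  have "(\<Union>z\<in>?I. ?P z) \<in> null_sets \<mu>"
  proof (rule null_sets_UN'[OF c])
    fix z assume "z \<in> ?I"
    then obtain N i a b where z: "z = (N, i, a, b)" "a < b" by (cases z) auto
    have "ridge_piece S N i a b \<in> sets borel"
      using compact_ridge_piece[OF S] by (intro borel_compact)
    then show "?P z \<in> null_sets \<mu>"
      using z null hausdorff_ridge_piece[OF S] sets by (auto simp: null_sets_def)
  qed
  then show ?thesis
  proof (rule AE_I')
    show "{x \<in> space \<mu>. \<not> (\<forall>p\<in>nearest_points S x. \<forall>q\<in>nearest_points S x. p = q)} \<subseteq> (\<Union>z\<in>?I. ?P z)"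
    proof
      fix x assume "x \<in> {x \<in> space \<mu>. \<not> (\<forall>p\<in>nearest_points S x. \<forall>q\<in>nearest_points S x. p = q)}"
      then obtain p q where "p \<in> nearest_points S x" "q \<in> nearest_points S x" "p \<noteq> q" by blast
      from ridge_set_subset[OF this] obtain N i a b where
        "a \<in> \<rat>" "b \<in> \<rat>" "a < b" "x \<in> ridge_piece S N i a b" by blast
      then show "x \<in> (\<Union>z\<in>?I. ?P z)" by (intro UN_I[of "(N, i, a, b)"]) auto
    qed
  qed
qed

section \<open>Variations of the distance function\<close>

lemma inner_sgn_self: "sgn u \<bullet> u = norm (u::'a::real_inner)"
  by (cases "u = 0") (auto simp: sgn_div_norm power2_norm_eq_inner[symmetric] power2_eq_square)

lemma inner_sgn_le: "sgn u \<bullet> v \<le> norm (v::'a::real_inner)"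
proof -
  have "sgn u \<bullet> v \<le> norm (sgn u) * norm v" by (rule norm_cauchy_schwarz)
  also have "\<dots> \<le> 1 * norm v" by (intro mult_right_mono) (auto simp: norm_sgn)
  finally show ?thesis by simp
qed

text \<open>The subgradient inequality for the norm at \<open>u\<close>; the lemma after it is the
  same inequality at \<open>u + d\<close>. As \<open>sgn 0 = 0\<close>, both hold at the origin
  too.\<close>

lemma norm_add_ge_sgn: "sgn u \<bullet> d \<le> norm (u + d) - norm (u::'a::real_inner)"
  using inner_sgn_le[of u "u + d"] by (simp add: inner_add_right inner_sgn_self)

lemma norm_add_le_sgn: "norm (u + d) - norm (u::'a::real_inner) \<le> sgn (u + d) \<bullet> d"
  using norm_add_ge_sgn[of "u + d" "- d"] by simp

text \<open>Danskin's argument: testing the perturbed minimum with \<open>p\<close> bounds it from above; convexity of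
  the norm at the perturbed minimizers, which tend to \<open>p\<close> by compactness and uniqueness, bounds it
  from below.\<close>

lemma has_derivative_min_norm:
  fixes d :: "'t::real_normed_vector \<Rightarrow> 'a::euclidean_space \<Rightarrow> 'a"
  assumes K: "compact K" "p \<in> K" "p \<noteq> x" and uniq: "\<And>s. s \<in> K \<Longrightarrow> s \<noteq> p \<Longrightarrow> dist x p < dist x s"
    and r: "0 < r" and B: "0 \<le> B" and C: "0 \<le> C"
    and m: "\<And>\<theta> s. norm \<theta> \<le> r \<Longrightarrow> s \<in> K \<Longrightarrow> m \<theta> \<le> norm (s - x + d \<theta> s)"
    and att: "\<And>\<theta>. norm \<theta> \<le> r \<Longrightarrow> \<exists>s\<in>K. m \<theta> = norm (s - x + d \<theta> s)"
    and dB: "\<And>\<theta> s. norm \<theta> \<le> r \<Longrightarrow> s \<in> K \<Longrightarrow> norm (d \<theta> s) \<le> B * norm \<theta>"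
    and dL: "\<And>\<theta> s. norm \<theta> \<le> r \<Longrightarrow> s \<in> K \<Longrightarrow> norm (d \<theta> s - d \<theta> p) \<le> B * norm (s - p) * norm \<theta>"
    and \<Lambda>: "bounded_linear \<Lambda>" "\<And>\<theta>. norm \<theta> \<le> r \<Longrightarrow> norm (d \<theta> p - \<Lambda> \<theta>) \<le> C * (norm \<theta>)\<^sup>2"
  shows "(m has_derivative (\<lambda>\<theta>. sgn (p - x) \<bullet> \<Lambda> \<theta>)) (at 0)"
proof -
  let ?a = "sgn (p - x)"
  have a1: "\<bar>?a \<bullet> v\<bar> \<le> norm v" for v
    using inner_sgn_le[of "p - x" v] inner_sgn_le[of "p - x" "- v"] by simp
  have d0: "d 0 s = 0" if "s \<in> K" for s using dB[of 0 s] that r by simp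
  have m0: "m 0 = norm (p - x)"
  proof (rule antisym)
    show "m 0 \<le> norm (p - x)" using m[of 0 p] K(2) r by (simp add: d0)
    obtain s where s: "s \<in> K" "m 0 = norm (s - x + d 0 s)" using att[of 0] r by auto
    then have "m 0 = dist x s" by (simp add: d0 dist_norm norm_minus_commute)
    then show "norm (p - x) \<le> m 0"
      using uniq[OF s(1)] by (cases "s = p") (auto simp: dist_norm norm_minus_commute)
  qed
  \<comment> \<open>Quantified uniqueness: by compactness, points of \<open>K\<close> away from
    \<open>p\<close> are farther from \<open>x\<close> by a fixed amount, so almost nearest points
    are close to \<open>p\<close>.\<close>
  have near: "\<exists>\<zeta>>0. \<forall>s\<in>K. dist x s < dist x p + \<zeta> \<longrightarrow> norm (s - p) < \<eta>" if "0 < \<eta>" for \<eta>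
  proof (cases "K - ball p \<eta> = {}")
    case True
    then show ?thesis by (intro exI[of _ 1]) (auto simp: dist_norm norm_minus_commute)
  next
    case False
    have "compact (K - ball p \<eta>)" using K(1) by (intro compact_diff) auto
    moreover have "continuous_on (K - ball p \<eta>) (dist x)" by (intro continuous_intros)
    ultimately have "\<exists>s0\<in>K - ball p \<eta>. \<forall>s\<in>K - ball p \<eta>. dist x s0 \<le> dist x s"
      using continuous_attains_inf[OF _ False] by simp
    then obtain s0 where s0: "s0 \<in> K - ball p \<eta>" "\<And>s. s \<in> K - ball p \<eta> \<Longrightarrow> dist x s0 \<le> dist x s"
      by (elim bexE) simp
    have "s0 \<noteq> p" using s0(1) that by auto
    then have "dist x p < dist x s0" using s0(1) uniq by auto
    moreover have "norm (s - p) < \<eta>" if "s \<in> K" "dist x s < dist x p + (dist x s0 - dist x p)" for s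
    proof (rule ccontr)
      assume "\<not> ?thesis"
      then have "s \<in> K - ball p \<eta>" using that by (auto simp: dist_norm norm_minus_commute)
      then show False using s0(2)[of s] that by simp
    qed
    ultimately show ?thesis by (intro exI[of _ "dist x s0 - dist x p"]) auto
  qed
  have "isCont sgn (p - x)" using K(3) by (intro continuous_sgn continuous_ident) auto
  show ?thesis
    unfolding has_derivative_at_alt
  proof (intro conjI allI impI)
    show "bounded_linear (\<lambda>\<theta>. ?a \<bullet> \<Lambda> \<theta>)"
      using bounded_linear_compose[OF bounded_linear_inner_right \<Lambda>(1)] by (simp add: comp_def)
    fix e :: real assume e: "0 < e"
    define e1 where "e1 = e / (3 * (B + 1))"
    have e1: "0 < e1" "e1 * B \<le> e / 3"
    proof -
      show "0 < e1" using e B by (simp add: e1_def)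
      have "e1 * B \<le> e1 * (B + 1)" using \<open>0 < e1\<close> by (intro mult_left_mono) auto
      also have "\<dots> = e / 3" using B by (simp add: e1_def field_simps)
      finally show "e1 * B \<le> e / 3" .
    qed
    obtain \<eta>1 where \<eta>1: "0 < \<eta>1" "\<And>v. dist v (p - x) < \<eta>1 \<Longrightarrow> dist (sgn v) ?a < e1"
      using \<open>isCont sgn (p - x)\<close> e1(1) unfolding continuous_at_eps_delta by (auto simp: dist_norm)
    have sgn_close: "\<bar>(sgn v - ?a) \<bullet> w\<bar> \<le> e1 * norm w" if "dist v (p - x) < \<eta>1" for v w
    proof -
      have "\<bar>(sgn v - ?a) \<bullet> w\<bar> \<le> norm (sgn v - ?a) * norm w" by (rule Cauchy_Schwarz_ineq2)
      also have "\<dots> \<le> e1 * norm w" using \<eta>1(2)[OF that] by (intro mult_right_mono) (auto simp: dist_norm)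
      finally show ?thesis .
    qed
    \<comment> \<open>Distance \<open>\<eta>1\<close> from \<open>p\<close> controls
      \<open>sgn (s - x)\<close>; distance \<open>e1\<close> controls the difference of
      \<open>d \<theta>\<close> at \<open>s\<close> and at \<open>p\<close>.\<close>
    define \<eta> where "\<eta> = min \<eta>1 e1"
    have \<eta>: "0 < \<eta>" using \<eta>1 e1 by (simp add: \<eta>_def)
    obtain \<zeta> where \<zeta>: "0 < \<zeta>" "\<And>s. s \<in> K \<Longrightarrow> dist x s < dist x p + \<zeta> \<Longrightarrow> norm (s - p) < \<eta>"
      using near[OF \<eta>] by blast
    \<comment> \<open>The four entries secure, in order: the range of the hypotheses; that the
      perturbed minimizer is almost nearest; that the perturbed vector at \<open>p\<close> is close
      to \<open>p - x\<close>; the error of the linearization \<open>\<Lambda>\<close>.\<close>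
    define \<delta> where "\<delta> = Min {r, \<zeta> / (2 * (B + 1)), \<eta>1 / (B + 1), e / (3 * (C + 1))}"
    have \<delta>: "0 < \<delta>" using r \<zeta> \<eta>1 e B C by (simp add: \<delta>_def)
    show "\<exists>\<delta>>0. \<forall>\<theta>. norm (\<theta> - 0) < \<delta> \<longrightarrow> norm (m \<theta> - m 0 - ?a \<bullet> \<Lambda> (\<theta> - 0)) \<le> e * norm (\<theta> - 0)"
    proof (intro exI[of _ \<delta>] conjI \<delta> allI impI)
      fix \<theta> :: 't assume "norm (\<theta> - 0) < \<delta>"
      then have \<theta>: "norm \<theta> < r" "norm \<theta> < \<zeta> / (2 * (B + 1))" "norm \<theta> < \<eta>1 / (B + 1)" "norm \<theta> < e / (3 * (C + 1))"
        by (auto simp: \<delta>_def)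
      have n0: "0 \<le> norm \<theta>" by simp
      have th: "norm \<theta> * (2 * (B + 1)) < \<zeta>" "norm \<theta> * (B + 1) < \<eta>1" "norm \<theta> * (3 * (C + 1)) < e"
        using \<theta> B C by (auto simp: pos_less_divide_eq)
      have B1: "B * norm \<theta> < \<eta>1" "2 * (B * norm \<theta>) < \<zeta>" "C * norm \<theta> \<le> e / 3"
        using th by (simp_all add: algebra_simps) (use n0 in linarith)+
      have C2: "C * (norm \<theta>)\<^sup>2 \<le> e / 3 * norm \<theta>"
        using mult_right_mono[OF B1(3) n0] by (simp add: power2_eq_square mult.assoc)
      have ap: "\<bar>?a \<bullet> d \<theta> p - ?a \<bullet> \<Lambda> \<theta>\<bar> \<le> e / 3 * norm \<theta>"
      proof -
        have "\<bar>?a \<bullet> d \<theta> p - ?a \<bullet> \<Lambda> \<theta>\<bar> \<le> norm (d \<theta> p - \<Lambda> \<theta>)"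
          using a1[of "d \<theta> p - \<Lambda> \<theta>"] by (simp add: inner_diff_right)
        also have "\<dots> \<le> C * (norm \<theta>)\<^sup>2" using \<Lambda>(2) \<theta>(1) by simp
        finally show ?thesis using C2 by linarith
      qed
      have e1B: "e1 * norm (d \<theta> s) \<le> e / 3 * norm \<theta>" if "s \<in> K" for s
      proof -
        have "e1 * norm (d \<theta> s) \<le> e1 * (B * norm \<theta>)"
          using dB[OF _ that, of \<theta>] \<theta>(1) e1 by (intro mult_left_mono) auto
        also have "\<dots> \<le> e / 3 * norm \<theta>" using mult_right_mono[OF e1(2) n0] by (simp add: mult.assoc)
        finally show ?thesis .
      qed
      have upper: "m \<theta> - m 0 \<le> ?a \<bullet> \<Lambda> \<theta> + e * norm \<theta>"
      proof -
        have "m \<theta> - m 0 \<le> sgn (p - x + d \<theta> p) \<bullet> d \<theta> p"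
          using m[OF less_imp_le[OF \<theta>(1)] K(2)] norm_add_le_sgn[of "p - x" "d \<theta> p"] m0 by linarith
        also have "\<dots> = ?a \<bullet> d \<theta> p + (sgn (p - x + d \<theta> p) - ?a) \<bullet> d \<theta> p" by (simp add: inner_diff_left)
        finally have "m \<theta> - m 0 \<le> ?a \<bullet> d \<theta> p + (sgn (p - x + d \<theta> p) - ?a) \<bullet> d \<theta> p" .
        moreover have "dist (p - x + d \<theta> p) (p - x) < \<eta>1"
          using dB[OF less_imp_le[OF \<theta>(1)] K(2)] B1(1) by (simp add: dist_norm)
        ultimately show ?thesis
          using sgn_close[of "p - x + d \<theta> p" "d \<theta> p"] e1B[OF K(2)] ap mult_nonneg_nonneg[of e "norm \<theta>"] e by linarith
      qed
      obtain s where s: "s \<in> K" "m \<theta> = norm (s - x + d \<theta> s)" using att[of \<theta>] \<theta>(1) by auto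
      \<comment> \<open>The minimizer of the perturbed problem almost minimizes the distance from
        \<open>x\<close>: the perturbation enters twice, once at \<open>s\<close> and once at
        \<open>p\<close>.\<close>
      have "norm (s - x) \<le> norm (s - x + d \<theta> s) + norm (d \<theta> s)"
        using norm_triangle_ineq4[of "s - x + d \<theta> s" "d \<theta> s"] by simp
      also have "\<dots> \<le> norm (p - x + d \<theta> p) + B * norm \<theta>"
        using m[OF less_imp_le[OF \<theta>(1)] K(2)] s(2) dB[OF less_imp_le[OF \<theta>(1)] s(1)] by linarith
      also have "\<dots> \<le> norm (p - x) + 2 * (B * norm \<theta>)"
        using norm_triangle_ineq[of "p - x" "d \<theta> p"] dB[OF less_imp_le[OF \<theta>(1)] K(2)] by linarith
      also have "\<dots> < norm (p - x) + \<zeta>" using B1(2) by simp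
      finally have sp: "norm (s - p) < \<eta>" using \<zeta>(2)[OF s(1)] by (simp add: dist_norm norm_minus_commute)
      have lower: "?a \<bullet> \<Lambda> \<theta> - e * norm \<theta> \<le> m \<theta> - m 0"
      proof -
        have ps: "norm (p - x) \<le> norm (s - x)"
          using uniq[OF s(1)] by (cases "s = p") (auto simp: dist_norm norm_minus_commute)
        have "sgn (s - x) \<bullet> d \<theta> s \<le> m \<theta> - m 0"
          using norm_add_ge_sgn[of "s - x" "d \<theta> s"] s(2) ps m0 by linarith
        moreover have "sgn (s - x) \<bullet> d \<theta> s = ?a \<bullet> d \<theta> p + ?a \<bullet> (d \<theta> s - d \<theta> p) + (sgn (s - x) - ?a) \<bullet> d \<theta> s"
          by (simp add: inner_diff_left inner_diff_right)
        moreover have "\<bar>?a \<bullet> (d \<theta> s - d \<theta> p)\<bar> \<le> e / 3 * norm \<theta>"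
        proof -
          have "\<bar>?a \<bullet> (d \<theta> s - d \<theta> p)\<bar> \<le> norm (d \<theta> s - d \<theta> p)" by (rule a1)
          also have "\<dots> \<le> B * norm (s - p) * norm \<theta>" using dL \<theta>(1) s(1) by simp
          also have "\<dots> \<le> B * e1 * norm \<theta>"
            using sp B by (intro mult_right_mono mult_left_mono) (auto simp: \<eta>_def)
          also have "\<dots> \<le> e / 3 * norm \<theta>" using mult_right_mono[OF e1(2) n0] by (simp add: mult.commute)
          finally show ?thesis .
        qed
        moreover have "dist (s - x) (p - x) < \<eta>1" using sp by (simp add: dist_norm \<eta>_def)
        ultimately show ?thesis
          using sgn_close[of "s - x" "d \<theta> s"] e1B[OF s(1)] ap by linarith
      qed
      show "norm (m \<theta> - m 0 - ?a \<bullet> \<Lambda> (\<theta> - 0)) \<le> e * norm (\<theta> - 0)"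
        using upper lower by (simp add: abs_le_iff)
    qed
  qed
qed

text \<open>The group law is dropped, so that \<open>\<phi> \<epsilon> x = x + \<epsilon> X x\<close> is admissible as well: the statement
  about minimizers then does not need the existence of the flow of \<open>X\<close>.\<close>

definition first_variation :: "'a::euclidean_space set \<Rightarrow> ('a \<Rightarrow> 'a) \<Rightarrow> (real \<Rightarrow> 'a \<Rightarrow> 'a) \<Rightarrow> real \<Rightarrow> bool" where
  "first_variation S X \<phi> C \<longleftrightarrow> 0 \<le> C \<and> (\<forall>\<epsilon>. \<bar>\<epsilon>\<bar> \<le> 1 \<longrightarrow>
     (\<forall>x\<in>S. norm (\<phi> \<epsilon> x - (x + \<epsilon> *\<^sub>R X x)) \<le> C * \<epsilon>\<^sup>2) \<and>
     (\<forall>x\<in>S. \<forall>y\<in>S. norm ((\<phi> \<epsilon> y - (y + \<epsilon> *\<^sub>R X y)) - (\<phi> \<epsilon> x - (x + \<epsilon> *\<^sub>R X x))) \<le> C * \<epsilon>\<^sup>2 * norm (y - x)))"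

section \<open>The distance under variations of the set and of the point\<close>

lemma has_derivative_infdist_variation:
  fixes S :: "'a::euclidean_space set"
  assumes S: "compact S" "p \<in> S" "p \<noteq> x" and uniq: "\<And>s. s \<in> S \<Longrightarrow> s \<noteq> p \<Longrightarrow> dist x p < dist x s"
    and \<phi>: "first_variation S X \<phi> C" and M: "0 \<le> M" "\<And>x. norm (X x) \<le> M"
    and L: "\<And>x y. norm (X x - X y) \<le> M * norm (x - y)"
  shows "((\<lambda>\<epsilon>. infdist x (\<phi> \<epsilon> ` S)) has_real_derivative X p \<bullet> sgn (p - x)) (at 0)"
proof -
  have C: "0 \<le> C" using \<phi> by (simp add: first_variation_def)
  define R where "R \<epsilon> s = \<phi> \<epsilon> s - (s + \<epsilon> *\<^sub>R X s)" for \<epsilon> s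
  have R: "norm (R \<epsilon> s) \<le> C * \<epsilon>\<^sup>2" if "\<bar>\<epsilon>\<bar> \<le> 1" "s \<in> S" for \<epsilon> s
    using \<phi> that by (simp add: first_variation_def R_def)
  have R2: "norm (R \<epsilon> s - R \<epsilon> t) \<le> C * \<epsilon>\<^sup>2 * norm (s - t)" if "\<bar>\<epsilon>\<bar> \<le> 1" "s \<in> S" "t \<in> S" for \<epsilon> s t
    using \<phi> that by (simp add: first_variation_def R_def)
  \<comment> \<open>The minimum lemma asks for bounds on \<open>d\<close> that are linear in
    \<open>\<epsilon>\<close>, so the quadratic remainder is weakened.\<close>
  have eps2: "C * \<epsilon>\<^sup>2 \<le> C * \<bar>\<epsilon>\<bar>" if "\<bar>\<epsilon>\<bar> \<le> 1" for \<epsilon> :: real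
    using that C mult_left_mono[of "\<bar>\<epsilon>\<bar>" 1 "\<bar>\<epsilon>\<bar>"] by (intro mult_left_mono) (auto simp: power2_eq_square abs_if split: if_splits)
  define d where "d \<epsilon> s = \<phi> \<epsilon> s - s" for \<epsilon> s
  have d: "d \<epsilon> s = \<epsilon> *\<^sub>R X s + R \<epsilon> s" for \<epsilon> s by (simp add: d_def R_def)
  have dB: "norm (d \<epsilon> s) \<le> (M + C) * norm \<epsilon>" if "norm \<epsilon> \<le> 1" "s \<in> S" for \<epsilon> s
  proof -
    have e: "\<bar>\<epsilon>\<bar> \<le> 1" using that by simp
    have "norm (d \<epsilon> s) \<le> \<bar>\<epsilon>\<bar> * norm (X s) + norm (R \<epsilon> s)" unfolding d by (rule order_trans[OF norm_triangle_ineq]) simp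
    also have "\<dots> \<le> \<bar>\<epsilon>\<bar> * M + C * \<bar>\<epsilon>\<bar>"
      using R[OF e that(2)] eps2[OF e] by (intro add_mono mult_left_mono M) auto
    finally show ?thesis by (simp add: algebra_simps)
  qed
  have dL: "norm (d \<epsilon> s - d \<epsilon> t) \<le> (M + C) * norm (s - t) * norm \<epsilon>" if "norm \<epsilon> \<le> 1" "s \<in> S" "t \<in> S" for \<epsilon> s t
  proof -
    have e: "\<bar>\<epsilon>\<bar> \<le> 1" using that by simp
    have "d \<epsilon> s - d \<epsilon> t = \<epsilon> *\<^sub>R (X s - X t) + (R \<epsilon> s - R \<epsilon> t)" by (simp add: d algebra_simps)
    then have "norm (d \<epsilon> s - d \<epsilon> t) \<le> \<bar>\<epsilon>\<bar> * norm (X s - X t) + norm (R \<epsilon> s - R \<epsilon> t)"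
      using norm_triangle_ineq[of "\<epsilon> *\<^sub>R (X s - X t)" "R \<epsilon> s - R \<epsilon> t"] by simp
    also have "\<dots> \<le> \<bar>\<epsilon>\<bar> * (M * norm (s - t)) + C * \<bar>\<epsilon>\<bar> * norm (s - t)"
      using R2[OF e that(2,3)] mult_right_mono[OF eps2[OF e], of "norm (s - t)"]
      by (intro add_mono mult_left_mono L) auto
    finally show ?thesis by (simp add: algebra_simps)
  qed
  have cont: "continuous_on S (\<phi> \<epsilon>)" if "norm \<epsilon> \<le> 1" for \<epsilon>
  proof -
    have "((M + C) * norm \<epsilon>)-lipschitz_on S (d \<epsilon>)"
    proof (rule lipschitz_onI)
      fix s t assume "s \<in> S" "t \<in> S"
      then show "dist (d \<epsilon> s) (d \<epsilon> t) \<le> (M + C) * norm \<epsilon> * dist s t"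
        using dL[OF that, of s t] by (simp add: dist_norm mult_ac)
    qed (use M C in simp)
    then have "continuous_on S (\<lambda>s. s + d \<epsilon> s)"
      by (intro continuous_intros) (rule lipschitz_on_continuous_on)
    then show ?thesis by (simp add: d_def)
  qed
  have "((\<lambda>\<epsilon>. infdist x (\<phi> \<epsilon> ` S)) has_derivative (\<lambda>\<epsilon>. sgn (p - x) \<bullet> (\<epsilon> *\<^sub>R X p))) (at 0)"
  proof (rule has_derivative_min_norm[where d = d and B = "M + C" and C = C and r = 1])
    show "compact S" "p \<in> S" "p \<noteq> x" using S by auto
    show "\<And>s. s \<in> S \<Longrightarrow> s \<noteq> p \<Longrightarrow> dist x p < dist x s" by (rule uniq)
    show "0 \<le> M + C" using M C by simp
    show "infdist x (\<phi> \<theta> ` S) \<le> norm (s - x + d \<theta> s)" if "s \<in> S" for \<theta> s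
      using infdist_le[of "\<phi> \<theta> s" "\<phi> \<theta> ` S" x] that by (simp add: d_def dist_norm norm_minus_commute)
    show "\<exists>s\<in>S. infdist x (\<phi> \<theta> ` S) = norm (s - x + d \<theta> s)" if "norm \<theta> \<le> 1" for \<theta>
    proof -
      have "closed (\<phi> \<theta> ` S)" by (intro compact_imp_closed compact_continuous_image cont that S)
      then obtain y where "y \<in> \<phi> \<theta> ` S" "infdist x (\<phi> \<theta> ` S) = dist x y"
        using infdist_attains_inf[of "\<phi> \<theta> ` S" x] S(2) by blast
      then show ?thesis by (auto simp: d_def dist_norm norm_minus_commute)
    qed
    show "bounded_linear (\<lambda>\<epsilon>. \<epsilon> *\<^sub>R X p)" by (rule bounded_linear_scaleR_left)
    show "norm (d \<theta> p - \<theta> *\<^sub>R X p) \<le> C * (norm \<theta>)\<^sup>2" if "norm \<theta> \<le> 1" for \<theta>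
      using R[of \<theta> p] that S by (simp add: d)
  qed (use dB dL C S in auto)
  then show ?thesis
    unfolding has_field_derivative_def by (rule has_derivative_eq_rhs) (auto simp: inner_commute)
qed

text \<open>Moving \<open>x\<close> by \<open>\<theta>\<close> amounts to moving every point of
  \<open>S\<close> by \<open>- \<theta>\<close>, so the minimum lemma applies again, now with the
  whole space as parameter space.\<close>

lemma GDERIV_infdist:
  fixes S :: "'a::euclidean_space set"
  assumes S: "compact S" "p \<in> S" "p \<noteq> x" and uniq: "\<And>s. s \<in> S \<Longrightarrow> s \<noteq> p \<Longrightarrow> dist x p < dist x s"
  shows "GDERIV (\<lambda>y. infdist y S) x :> - sgn (p - x)"
proof -
  have "((\<lambda>\<theta>. infdist (x + \<theta>) S) has_derivative (\<lambda>\<theta>. sgn (p - x) \<bullet> (- \<theta>))) (at 0)"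
  proof (rule has_derivative_min_norm[where d = "\<lambda>\<theta> s. - \<theta>" and B = 1 and C = 0 and r = 1])
    show "infdist (x + \<theta>) S \<le> norm (s - x + - \<theta>)" if "s \<in> S" for \<theta> s
    proof -
      have "dist (x + \<theta>) s = norm (s - x + - \<theta>)" by (simp add: dist_norm norm_minus_commute[of "x + \<theta>"] diff_diff_add)
      then show ?thesis using infdist_le[of s S "x + \<theta>"] that by simp
    qed
    show "\<exists>s\<in>S. infdist (x + \<theta>) S = norm (s - x + - \<theta>)" for \<theta>
    proof -
      have "dist (x + \<theta>) s = norm (s - x + - \<theta>)" for s by (simp add: dist_norm norm_minus_commute[of "x + \<theta>"] diff_diff_add)
      moreover obtain s where "s \<in> S" "infdist (x + \<theta>) S = dist (x + \<theta>) s"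
        using infdist_attains_inf[OF compact_imp_closed[OF S(1)], of "x + \<theta>"] S(2) by blast
      ultimately show ?thesis by (intro bexI[of _ s]) simp_all
    qed
    show "bounded_linear (\<lambda>\<theta>::'a. - \<theta>)" by (rule bounded_linear_minus[OF bounded_linear_ident])
  qed (use S uniq in auto)
  then have "((\<lambda>\<theta>. infdist (x + \<theta>) S) has_derivative (\<lambda>\<theta>. \<theta> \<bullet> (- sgn (p - x)))) (at (x - x))"
    by (simp add: inner_commute)
  then have "((\<lambda>\<theta>. infdist (x + \<theta>) S) \<circ> (\<lambda>y. y - x) has_derivative (\<lambda>\<theta>. \<theta> \<bullet> (- sgn (p - x))) \<circ> (\<lambda>h. h)) (at x)"
    by (intro diff_chain_at) (auto intro!: derivative_eq_intros)
  then show ?thesis by (simp add: gderiv_def comp_def)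
qed

lemma GDERIV_unique:
  fixes f :: "'a::euclidean_space \<Rightarrow> real"
  assumes "GDERIV f x :> g" "GDERIV f x :> g'"
  shows "g = g'"
proof -
  have "(\<lambda>h. h \<bullet> g) = (\<lambda>h. h \<bullet> g')"
    using assms unfolding gderiv_def by (rule has_derivative_unique)
  then have "(g - g') \<bullet> g = (g - g') \<bullet> g'" by metis
  then have "(g - g') \<bullet> (g - g') = 0" by (simp add: inner_diff_right)
  then show ?thesis by simp
qed

lemma gradient_infdist:
  fixes S :: "'a::euclidean_space set"
  assumes "compact S" "p \<in> S" "p \<noteq> x" "\<And>s. s \<in> S \<Longrightarrow> s \<noteq> p \<Longrightarrow> dist x p < dist x s"
  shows "gradient (\<lambda>y. infdist y S) x = - sgn (p - x)"
  unfolding gradient_def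
proof (rule the_equality)
  show G: "GDERIV (\<lambda>y. infdist y S) x :> - sgn (p - x)" by (rule GDERIV_infdist[OF assms])
  show "g = - sgn (p - x)" if "GDERIV (\<lambda>y. infdist y S) x :> g" for g
    using that G by (rule GDERIV_unique)
qed

section \<open>Flows of test fields\<close>

text \<open>What the variation estimates use of a test field; a single constant keeps the error
  terms short.\<close>

definition C11_field :: "real \<Rightarrow> ('a::euclidean_space \<Rightarrow> 'a) \<Rightarrow> bool" where
  "C11_field M X \<longleftrightarrow> 0 \<le> M \<and> (\<forall>x. norm (X x) \<le> M) \<and> (\<forall>x. X differentiable (at x)) \<and>
     (\<forall>x v. norm (frechet_derivative X (at x) v) \<le> M * norm v) \<and>
     (\<forall>x y v. norm (frechet_derivative X (at x) v - frechet_derivative X (at y) v) \<le> M * norm (x - y) * norm v)"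

lemma C11_fieldD:
  assumes "C11_field M X"
  shows "0 \<le> M" "norm (X x) \<le> M" "(X has_derivative frechet_derivative X (at x)) (at x)"
    "norm (frechet_derivative X (at x) v) \<le> M * norm v"
    "norm (frechet_derivative X (at x) v - frechet_derivative X (at y) v) \<le> M * norm (x - y) * norm v"
    "linear (frechet_derivative X (at x))"
  using assms frechet_derivative_works[of X "at x"] unfolding C11_field_def
  by (auto intro: linear_frechet_derivative)

lemma derivative_bound_imp_Lipschitz:
  fixes f :: "'a::euclidean_space \<Rightarrow> 'b::real_normed_vector"
  assumes "\<And>x. (f has_derivative D x) (at x)" "\<And>x v. norm (D x v) \<le> B * norm v" "0 \<le> B"
  shows "norm (f x - f y) \<le> B * norm (x - y)"
proof (rule differentiable_bound[of UNIV f D])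
  show "onorm (D x) \<le> B" for x using assms(3,2) by (rule onorm_bound)
qed (use assms in auto)

lemma C11_field_Lipschitz: "C11_field M X \<Longrightarrow> norm (X x - X y) \<le> M * norm (x - y)"
  by (rule derivative_bound_imp_Lipschitz) (auto dest: C11_fieldD)

lemma compact_support_imp_bounded:
  fixes f :: "'a::euclidean_space \<Rightarrow> 'b::real_normed_vector"
  assumes "continuous_on UNIV f" "compact K" "\<And>x. x \<notin> K \<Longrightarrow> f x = 0"
  shows "\<exists>B\<ge>0. \<forall>x. norm (f x) \<le> B"
proof -
  have "compact (f ` K)" using assms(1,2) by (intro compact_continuous_image) (auto intro: continuous_on_subset)
  then obtain B where B: "\<forall>x\<in>f ` K. norm x \<le> B" using compact_imp_bounded bounded_iff by blast
  have "norm (f x) \<le> max B 0" for x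
  proof (cases "x \<in> K")
    case True
    then have "norm (f x) \<le> B" using B by blast
    then show ?thesis by linarith
  qed (use assms(3)[of x] in simp)
  then show ?thesis by (intro exI[of _ "max B 0"]) auto
qed

lemma directional_derivative_compact_support:
  fixes f :: "'a::euclidean_space \<Rightarrow> 'b::real_normed_vector"
  assumes f: "smooth_map f" and K: "compact K" "\<And>x. x \<notin> K \<Longrightarrow> f x = 0"
  shows "smooth_map (\<lambda>x. frechet_derivative f (at x) v)" "x \<notin> K \<Longrightarrow> frechet_derivative f (at x) v = 0"
proof -
  have "times_cont_diff (Suc k) f" for k using f unfolding smooth_map_def by blast
  then show "smooth_map (\<lambda>x. frechet_derivative f (at x) v)" unfolding smooth_map_def by simp
  assume x: "x \<notin> K"
  have "(f has_derivative (\<lambda>_. 0)) (at x)"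
    by (rule has_derivative_transform_within_open[OF has_derivative_const[of 0], of "- K"])
       (use x K compact_imp_closed in auto)
  then have "frechet_derivative f (at x) = (\<lambda>_. 0)" by (rule frechet_derivative_at[symmetric])
  then show "frechet_derivative f (at x) v = 0" by simp
qed

lemma smooth_map_has_derivative:
  assumes "smooth_map f"
  shows "(f has_derivative frechet_derivative f (at x)) (at x)"
proof -
  have "times_cont_diff (Suc 0) f" using assms unfolding smooth_map_def by blast
  then show ?thesis using frechet_derivative_works[of f "at x"] by simp
qed

lemma linear_Basis_expansion:
  fixes f :: "'a::euclidean_space \<Rightarrow> 'b::real_vector"
  assumes "linear f"
  shows "f v = (\<Sum>b\<in>Basis. (v \<bullet> b) *\<^sub>R f b)"
proof -
  have "f v = f (\<Sum>b\<in>Basis. (v \<bullet> b) *\<^sub>R b)" by (simp add: euclidean_representation)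
  also have "\<dots> = (\<Sum>b\<in>Basis. (v \<bullet> b) *\<^sub>R f b)" using assms by (simp add: linear_sum linear_scale)
  finally show ?thesis .
qed

text \<open>\<open>smooth_map\<close> provides continuity of the derivative in each fixed direction;
  a bound uniform in the direction is assembled from the basis vectors.\<close>

lemma derivative_compact_support_bound:
  fixes f :: "'a::euclidean_space \<Rightarrow> 'b::real_normed_vector"
  assumes f: "smooth_map f" and K: "compact K" "\<And>x. x \<notin> K \<Longrightarrow> f x = 0"
  shows "\<exists>B\<ge>0. \<forall>x v. norm (frechet_derivative f (at x) v) \<le> B * norm v"
proof -
  let ?D = "\<lambda>x. frechet_derivative f (at x)"
  have "\<exists>B\<ge>0. \<forall>x. norm (?D x b) \<le> B" for b
  proof (rule compact_support_imp_bounded[OF _ K(1)])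
    have "times_cont_diff 0 (\<lambda>x. ?D x b)"
      using directional_derivative_compact_support(1)[OF f K] unfolding smooth_map_def by blast
    then show "continuous_on UNIV (\<lambda>x. ?D x b)" by simp
  qed (rule directional_derivative_compact_support(2)[OF f K])
  then obtain B where B: "\<And>b. 0 \<le> B b" "\<And>b x. norm (?D x b) \<le> B b" by metis
  have "norm (?D x v) \<le> (\<Sum>b\<in>Basis. B b) * norm v" for x v
  proof -
    have "?D x v = (\<Sum>b\<in>Basis. (v \<bullet> b) *\<^sub>R ?D x b)"
      by (rule linear_Basis_expansion[OF has_derivative_linear[OF smooth_map_has_derivative[OF f]]])
    then have "norm (?D x v) \<le> (\<Sum>b\<in>Basis. norm ((v \<bullet> b) *\<^sub>R ?D x b))" by (simp only: norm_sum)
    also have "\<dots> \<le> (\<Sum>b\<in>Basis. norm v * B b)"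
    proof (rule sum_mono)
      fix b :: 'a assume "b \<in> Basis"
      then have "\<bar>v \<bullet> b\<bar> \<le> norm v" by (rule Basis_le_norm)
      then show "norm ((v \<bullet> b) *\<^sub>R ?D x b) \<le> norm v * B b" using B by (simp add: mult_mono)
    qed
    finally show ?thesis by (simp add: sum_distrib_left mult.commute)
  qed
  moreover have "0 \<le> (\<Sum>b\<in>Basis. B b)" using B by (intro sum_nonneg) auto
  ultimately show ?thesis by blast
qed

text \<open>The Lipschitz bound on the derivative comes from applying the derivative bound once
  more, to the directional derivatives, which are again smooth and vanish outside
  \<open>K\<close>.\<close>

lemma test_field_C11:
  assumes "test_field X"
  shows "\<exists>M. C11_field M X"
proof -
  define K where "K = closure {x. X x \<noteq> 0}"
  have X: "smooth_map X" and K: "compact K" "\<And>x. x \<notin> K \<Longrightarrow> X x = 0"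
    using assms closure_subset[of "{x. X x \<noteq> 0}"] unfolding test_field_def K_def by auto
  let ?D = "\<lambda>x. frechet_derivative X (at x)"
  have "times_cont_diff 0 X" using X unfolding smooth_map_def by blast
  then have "continuous_on UNIV X" by simp
  from compact_support_imp_bounded[OF this K]
  obtain M1 where M1: "0 \<le> M1" "\<And>x. norm (X x) \<le> M1" by blast
  obtain M2 where M2: "0 \<le> M2" "\<And>x v. norm (?D x v) \<le> M2 * norm v"
    using derivative_compact_support_bound[OF X K] by blast
  have "\<exists>B\<ge>0. \<forall>x y. norm (?D x b - ?D y b) \<le> B * norm (x - y)" for b
  proof -
    note g = directional_derivative_compact_support[OF X K, where v = b]
    obtain B where B: "0 \<le> B" "\<And>x v. norm (frechet_derivative (\<lambda>x. ?D x b) (at x) v) \<le> B * norm v"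
      using derivative_compact_support_bound[OF g(1) K(1) g(2)] by blast
    show ?thesis
      using derivative_bound_imp_Lipschitz[OF smooth_map_has_derivative[OF g(1)] B(2,1)] B(1) by blast
  qed
  then obtain B where B: "\<And>b. 0 \<le> B b" "\<And>b x y. norm (?D x b - ?D y b) \<le> B b * norm (x - y)" by metis
  define M3 where "M3 = (\<Sum>b\<in>Basis. B b)"
  have M3: "0 \<le> M3" unfolding M3_def using B by (intro sum_nonneg) auto
  have D3: "norm (?D x v - ?D y v) \<le> M3 * norm (x - y) * norm v" for x y v
  proof -
    have rep: "?D x v = (\<Sum>b\<in>Basis. (v \<bullet> b) *\<^sub>R ?D x b)" for x
      by (rule linear_Basis_expansion[OF has_derivative_linear[OF smooth_map_has_derivative[OF X]]])
    have "?D x v - ?D y v = (\<Sum>b\<in>Basis. (v \<bullet> b) *\<^sub>R (?D x b - ?D y b))"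
      unfolding rep[of x] rep[of y] by (simp add: sum_subtractf scaleR_diff_right)
    then have "norm (?D x v - ?D y v) \<le> (\<Sum>b\<in>Basis. norm ((v \<bullet> b) *\<^sub>R (?D x b - ?D y b)))"
      by (simp only: norm_sum)
    also have "\<dots> \<le> (\<Sum>b\<in>Basis. norm v * (B b * norm (x - y)))"
    proof (rule sum_mono)
      fix b :: 'a assume "b \<in> Basis"
      then have "\<bar>v \<bullet> b\<bar> \<le> norm v" by (rule Basis_le_norm)
      then show "norm ((v \<bullet> b) *\<^sub>R (?D x b - ?D y b)) \<le> norm v * (B b * norm (x - y))"
        unfolding norm_scaleR using B by (intro mult_mono) auto
    qed
    also have "\<dots> = M3 * norm (x - y) * norm v"
      by (simp add: M3_def sum_distrib_left sum_distrib_right mult_ac)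
    finally show ?thesis .
  qed
  define M where "M = M1 + M2 + M3"
  have M: "M1 \<le> M" "M2 \<le> M" "M3 \<le> M" "0 \<le> M" using M1 M2 M3 by (auto simp: M_def)
  have "C11_field M X"
    unfolding C11_field_def
  proof (intro conjI allI)
    show "0 \<le> M" by (rule M)
    show "norm (X x) \<le> M" for x using M1(2)[of x] M by linarith
    show "X differentiable at x" for x
      using smooth_map_has_derivative[OF X] by (rule differentiableI)
    show "norm (?D x v) \<le> M * norm v" for x v
      using M2(2)[of x v] mult_right_mono[OF M(2), of "norm v"] by simp
    show "norm (?D x v - ?D y v) \<le> M * norm (x - y) * norm v" for x y v
      using D3[of x v y] mult_right_mono[OF mult_right_mono[OF M(3), of "norm (x - y)"], of "norm v"] by simp
  qed
  then show ?thesis by blast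
qed

section \<open>The one-parameter group as the flow of the field\<close>

lemma vector_derivative_bound:
  fixes f :: "real \<Rightarrow> 'a::real_normed_vector"
  assumes "\<And>s. (f has_vector_derivative f' s) (at s)" "\<And>s. \<bar>s\<bar> \<le> \<bar>t\<bar> \<Longrightarrow> norm (f' s) \<le> B" "0 \<le> B"
  shows "norm (f t - f 0) \<le> B * \<bar>t\<bar>"
proof -
  have "norm (f t - f 0) \<le> B * norm (t - 0)"
  proof (rule differentiable_bound[of "{-\<bar>t\<bar>..\<bar>t\<bar>}" f "\<lambda>s h. h *\<^sub>R f' s"])
    show "(f has_derivative (\<lambda>h. h *\<^sub>R f' s)) (at s within {-\<bar>t\<bar>..\<bar>t\<bar>})" for s
      using assms(1)[of s] unfolding has_vector_derivative_def by (rule has_derivative_at_withinI)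
    show "onorm (\<lambda>h. h *\<^sub>R f' s) \<le> B" if "s \<in> {-\<bar>t\<bar>..\<bar>t\<bar>}" for s
    proof (rule onorm_bound[OF assms(3)])
      fix h :: real
      have "norm (f' s) \<le> B" using that by (intro assms(2)) auto
      then have "norm h * norm (f' s) \<le> norm h * B" by (intro mult_left_mono) auto
      then show "norm (h *\<^sub>R f' s) \<le> B * norm h" by (simp add: mult.commute)
    qed
  qed auto
  then show ?thesis by simp
qed

text \<open>The group law transports the expansion at time 0, taken at the point
  \<open>\<phi> t x\<close>, to time \<open>t\<close>; so orbits solve the differential equation of
  \<open>X\<close>.\<close>

lemma flow_has_vector_derivative:
  fixes \<phi> :: "real \<Rightarrow> 'a::euclidean_space \<Rightarrow> 'a"
  assumes grp: "\<And>s t. \<phi> (s + t) = \<phi> s \<circ> \<phi> t"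
    and exp: "\<And>x. (\<lambda>\<epsilon>. norm (\<phi> \<epsilon> x - (x + \<epsilon> *\<^sub>R X x))) \<in> o[at 0](\<lambda>\<epsilon>. \<epsilon>)"
  shows "((\<lambda>s. \<phi> s x) has_vector_derivative X (\<phi> t x)) (at t)"
  unfolding has_vector_derivative_def has_derivative_at
proof
  let ?z = "\<phi> t x"
  have "((\<lambda>h. norm (\<phi> h ?z - (?z + h *\<^sub>R X ?z)) / h) \<longlongrightarrow> 0) (at 0)"
    by (rule smalloD_tendsto[OF exp])
  then have "((\<lambda>h. \<bar>norm (\<phi> h ?z - (?z + h *\<^sub>R X ?z)) / h\<bar>) \<longlongrightarrow> 0) (at 0)"
    by (rule tendsto_rabs_zero)
  moreover have "\<bar>norm (\<phi> h ?z - (?z + h *\<^sub>R X ?z)) / h\<bar> = norm (\<phi> (t + h) x - \<phi> t x - h *\<^sub>R X ?z) / norm h" for h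
    using fun_cong[OF grp[of h t], of x] by (simp add: add.commute[of t] diff_diff_add)
  ultimately show "(\<lambda>h. norm (\<phi> (t + h) x - \<phi> t x - h *\<^sub>R X ?z) / norm h) \<midarrow>0\<rightarrow> 0"
    by (simp only:)
qed (rule bounded_linear_scaleR_left)

text \<open>The squared norm is used because the norm is not differentiable at 0. Multiplied by a
  decaying exponential it is nonincreasing, by a growing one nondecreasing, which covers both
  directions of time.\<close>

lemma flow_Gronwall:
  fixes u :: "real \<Rightarrow> 'a::real_inner"
  assumes u: "\<And>s. (u has_vector_derivative u' s) (at s)" and le: "\<And>s. norm (u' s) \<le> M * norm (u s)"
  shows "norm (u t) \<le> exp (M * \<bar>t\<bar>) * norm (u 0)"
proof -
  define v where "v s = (norm (u s))\<^sup>2" for s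
  have v: "(v has_real_derivative 2 * (u s \<bullet> u' s)) (at s)" for s
  proof -
    have "((\<lambda>s. u s \<bullet> u s) has_derivative (\<lambda>h. u s \<bullet> (h *\<^sub>R u' s) + (h *\<^sub>R u' s) \<bullet> u s)) (at s)"
      using u[of s] unfolding has_vector_derivative_def by (intro has_derivative_inner)
    then have "((\<lambda>s. u s \<bullet> u s) has_real_derivative 2 * (u s \<bullet> u' s)) (at s)"
      unfolding has_field_derivative_def by (rule has_derivative_eq_rhs) (auto simp: inner_commute)
    then show ?thesis by (simp add: v_def[abs_def] power2_norm_eq_inner)
  qed
  have vle: "\<bar>u s \<bullet> u' s\<bar> \<le> M * v s" for s
    using Cauchy_Schwarz_ineq2[of "u s" "u' s"] mult_left_mono[OF le[of s], of "norm (u s)"]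
    by (simp add: v_def power2_eq_square mult_ac)
  have "v t \<le> exp (2 * M * \<bar>t\<bar>) * v 0"
  proof (cases "0 \<le> t")
    case True
    have "exp (- (2 * M) * t) * v t \<le> exp (- (2 * M) * 0) * v 0"
    proof (rule DERIV_nonpos_imp_nonincreasing[OF True])
      fix s :: real
      have "((\<lambda>s. exp (- (2 * M) * s) * v s) has_real_derivative exp (- (2 * M) * s) * (2 * (u s \<bullet> u' s) - 2 * M * v s)) (at s)"
        by (auto intro!: derivative_eq_intros v simp: algebra_simps)
      moreover have "exp (- (2 * M) * s) * (2 * (u s \<bullet> u' s) - 2 * M * v s) \<le> 0"
        using vle[of s] by (intro mult_nonneg_nonpos) auto
      ultimately show "\<exists>y. ((\<lambda>s. exp (- (2 * M) * s) * v s) has_real_derivative y) (at s) \<and> y \<le> 0" by blast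
    qed
    then have "exp (2 * M * t) * (exp (- (2 * M) * t) * v t) \<le> exp (2 * M * t) * v 0" by (intro mult_left_mono) auto
    moreover have "exp (2 * M * t) * (exp (- (2 * M) * t) * v t) = v t"
      by (subst mult.assoc[symmetric], subst exp_add[symmetric]) simp
    ultimately have "v t \<le> exp (2 * M * t) * v 0" by (simp only:)
    then show ?thesis using True by simp
  next
    case False
    have "exp (2 * M * t) * v t \<le> exp (2 * M * 0) * v 0"
    proof (rule DERIV_nonneg_imp_nondecreasing[of t 0])
      show "t \<le> 0" using False by simp
      fix s :: real
      have "((\<lambda>s. exp (2 * M * s) * v s) has_real_derivative exp (2 * M * s) * (2 * (u s \<bullet> u' s) + 2 * M * v s)) (at s)"
        by (auto intro!: derivative_eq_intros v simp: algebra_simps)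
      moreover have "exp (2 * M * s) * (2 * (u s \<bullet> u' s) + 2 * M * v s) \<ge> 0"
        using vle[of s] by (intro mult_nonneg_nonneg) auto
      ultimately show "\<exists>y. ((\<lambda>s. exp (2 * M * s) * v s) has_real_derivative y) (at s) \<and> 0 \<le> y" by blast
    qed
    then have "exp (- (2 * M * t)) * (exp (2 * M * t) * v t) \<le> exp (- (2 * M * t)) * v 0" by (intro mult_left_mono) auto
    moreover have "exp (- (2 * M * t)) * (exp (2 * M * t) * v t) = v t"
      by (subst mult.assoc[symmetric], subst exp_add[symmetric]) simp
    ultimately have "v t \<le> exp (- (2 * M * t)) * v 0" by (simp only:)
    then show ?thesis using False by simp
  qed
  also have "\<dots> = (exp (M * \<bar>t\<bar>) * norm (u 0))\<^sup>2"
    by (simp add: v_def power_mult_distrib power2_eq_square flip: exp_add)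
  finally show ?thesis unfolding v_def by (rule power2_le_imp_le) simp
qed

text \<open>The given expansion is pointwise in \<open>x\<close>; uniformity comes from the
  differential equation. The remainder \<open>R\<close> vanishes at time 0, and its time derivative
  \<open>X (\<phi> t x) - X x\<close> is of order \<open>t\<close>. For differences of two points
  this uses that the acceleration of orbits is a Lipschitz function of position and that orbits
  separate at most by the factor \<open>E\<close>.\<close>

lemma flow_first_variation:
  fixes X :: "'a::euclidean_space \<Rightarrow> 'a"
  assumes X: "C11_field M X" and \<phi>0: "\<phi> 0 = id" and grp: "\<And>s t. \<phi> (s + t) = \<phi> s \<circ> \<phi> t"
    and exp: "\<And>x. (\<lambda>\<epsilon>. norm (\<phi> \<epsilon> x - (x + \<epsilon> *\<^sub>R X x))) \<in> o[at 0](\<lambda>\<epsilon>. \<epsilon>)"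
  shows "\<exists>C. first_variation S X \<phi> C"
proof -
  let ?D = "\<lambda>x. frechet_derivative X (at x)"
  note X' = C11_fieldD[OF X] and Lip = C11_field_Lipschitz[OF X]
  note flow = flow_has_vector_derivative[of \<phi> X, OF grp exp]
  have Xflow: "((\<lambda>s. X (\<phi> s x)) has_vector_derivative ?D (\<phi> t x) (X (\<phi> t x))) (at t)" for x t
  proof -
    have "((\<lambda>s. X (\<phi> s x)) has_derivative (\<lambda>h. ?D (\<phi> t x) (h *\<^sub>R X (\<phi> t x)))) (at t)"
      using flow[of x t] unfolding has_vector_derivative_def
      by (rule has_derivative_compose) (rule X'(3))
    then show ?thesis unfolding has_vector_derivative_def
      by (rule has_derivative_eq_rhs) (simp add: linear_scale[OF X'(6)])
  qed
  \<comment> \<open>The acceleration at \<open>x\<close> is \<open>?D x (X x)\<close>; varying the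
    field and varying the derivative cost \<open>M\<^sup>2\<close> each.\<close>
  have Y: "norm (?D x (X x) - ?D y (X y)) \<le> 2 * M\<^sup>2 * norm (x - y)" for x y
  proof -
    have "?D x (X x) - ?D y (X y) = ?D x (X x - X y) + (?D x (X y) - ?D y (X y))"
      by (simp add: linear_diff[OF X'(6)])
    then have "norm (?D x (X x) - ?D y (X y)) \<le> norm (?D x (X x - X y)) + norm (?D x (X y) - ?D y (X y))"
      by (simp only: norm_triangle_ineq)
    also have "\<dots> \<le> M * (M * norm (x - y)) + M * norm (x - y) * M"
    proof (rule add_mono)
      show "norm (?D x (X x - X y)) \<le> M * (M * norm (x - y))"
        by (rule order_trans[OF X'(4)]) (intro mult_left_mono Lip X'(1))
      show "norm (?D x (X y) - ?D y (X y)) \<le> M * norm (x - y) * M"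
        by (rule order_trans[OF X'(5)]) (intro mult_left_mono mult_nonneg_nonneg X' norm_ge_zero)
    qed
    finally show ?thesis by (simp add: power2_eq_square algebra_simps)
  qed
  define E where "E = exp M"
  have E: "norm (\<phi> t x - \<phi> t y) \<le> E * norm (x - y)" if "\<bar>t\<bar> \<le> 1" for t x y
  proof -
    have "norm (\<phi> t x - \<phi> t y) \<le> exp (M * \<bar>t\<bar>) * norm (\<phi> 0 x - \<phi> 0 y)"
      by (rule flow_Gronwall[where u = "\<lambda>t. \<phi> t x - \<phi> t y" and u' = "\<lambda>t. X (\<phi> t x) - X (\<phi> t y)"])
         (intro has_vector_derivative_diff flow Lip)+
    also have "\<dots> \<le> E * norm (\<phi> 0 x - \<phi> 0 y)"
      unfolding E_def using mult_left_mono[OF that X'(1)] by (intro mult_right_mono) auto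
    finally show ?thesis by (simp add: \<phi>0)
  qed
  define R where "R t x = \<phi> t x - (x + t *\<^sub>R X x)" for t x
  have R0: "R 0 x = 0" for x by (simp add: R_def \<phi>0)
  have R': "((\<lambda>t. R t x) has_vector_derivative X (\<phi> t x) - X x) (at t)" for t x
  proof -
    have "((\<lambda>t. x + t *\<^sub>R X x) has_vector_derivative X x) (at t)"
      by (auto intro!: derivative_eq_intros)
    then show ?thesis unfolding R_def by (intro has_vector_derivative_diff flow)
  qed
  have R1: "norm (R t x) \<le> M\<^sup>2 * t\<^sup>2" if t: "\<bar>t\<bar> \<le> 1" for t x
  proof -
    have "norm (R t x - R 0 x) \<le> (M * (M * \<bar>t\<bar>)) * \<bar>t\<bar>"
    proof (rule vector_derivative_bound[OF R'])
      fix s assume s: "\<bar>s\<bar> \<le> \<bar>t\<bar>"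
      have "norm (\<phi> s x - \<phi> 0 x) \<le> M * \<bar>s\<bar>"
        by (rule vector_derivative_bound[OF flow]) (rule X')+
      also have "\<dots> \<le> M * \<bar>t\<bar>" using s X'(1) by (rule mult_left_mono)
      finally have "norm (\<phi> s x - x) \<le> M * \<bar>t\<bar>" by (simp add: \<phi>0)
      then have "M * norm (\<phi> s x - x) \<le> M * (M * \<bar>t\<bar>)" using X'(1) by (rule mult_left_mono)
      then show "norm (X (\<phi> s x) - X x) \<le> M * (M * \<bar>t\<bar>)" using Lip[of "\<phi> s x" x] by linarith
    qed (use X'(1) in auto)
    then show ?thesis by (simp add: R0 power2_eq_square mult_ac flip: abs_mult)
  qed
  have R2: "norm (R t y - R t x) \<le> 2 * M\<^sup>2 * E * t\<^sup>2 * norm (y - x)" if t: "\<bar>t\<bar> \<le> 1" for t x y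
  proof -
    let ?c = "2 * M\<^sup>2 * (E * norm (y - x))"
    have c0: "0 \<le> ?c" by (simp add: E_def)
    \<comment> \<open>The mean value estimate is applied twice: here to the difference of
      remainders, inside to its time derivative, both of which vanish at 0.\<close>
    have "norm ((R t y - R t x) - (R 0 y - R 0 x)) \<le> (?c * \<bar>t\<bar>) * \<bar>t\<bar>"
    proof (rule vector_derivative_bound)
      show "((\<lambda>t. R t y - R t x) has_vector_derivative (X (\<phi> s y) - X y) - (X (\<phi> s x) - X x)) (at s)" for s
        by (intro has_vector_derivative_diff R')
      fix s assume s: "\<bar>s\<bar> \<le> \<bar>t\<bar>"
      have "norm ((X (\<phi> s y) - X (\<phi> s x)) - (X (\<phi> 0 y) - X (\<phi> 0 x))) \<le> ?c * \<bar>s\<bar>"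
      proof (rule vector_derivative_bound)
        show "((\<lambda>s. X (\<phi> s y) - X (\<phi> s x)) has_vector_derivative
            ?D (\<phi> r y) (X (\<phi> r y)) - ?D (\<phi> r x) (X (\<phi> r x))) (at r)" for r
          by (intro has_vector_derivative_diff Xflow)
        fix r assume "\<bar>r\<bar> \<le> \<bar>s\<bar>"
        then have r: "\<bar>r\<bar> \<le> 1" using s t by linarith
        show "norm (?D (\<phi> r y) (X (\<phi> r y)) - ?D (\<phi> r x) (X (\<phi> r x))) \<le> ?c"
          by (rule order_trans[OF Y]) (intro mult_left_mono E r, simp)
      qed (rule c0)
      also have "\<dots> \<le> ?c * \<bar>t\<bar>" using s c0 by (rule mult_left_mono)
      finally show "norm ((X (\<phi> s y) - X y) - (X (\<phi> s x) - X x)) \<le> ?c * \<bar>t\<bar>"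
        by (simp add: \<phi>0 algebra_simps)
    qed (use c0 in simp)
    then show ?thesis by (simp add: R0 power2_eq_square mult_ac flip: abs_mult)
  qed
  define C where "C = M\<^sup>2 + 2 * M\<^sup>2 * E"
  have C: "M\<^sup>2 \<le> C" "2 * M\<^sup>2 * E \<le> C" "0 \<le> C" by (auto simp: C_def E_def)
  have "first_variation S X \<phi> C"
    unfolding first_variation_def R_def[symmetric]
  proof (intro conjI allI impI ballI)
    show "0 \<le> C" by (rule C)
    fix t :: real and x y assume t: "\<bar>t\<bar> \<le> 1"
    show "norm (R t x) \<le> C * t\<^sup>2"
      using R1[OF t, of x] mult_right_mono[OF C(1), of "t\<^sup>2"] by simp
    have "2 * M\<^sup>2 * E * t\<^sup>2 * norm (y - x) \<le> C * t\<^sup>2 * norm (y - x)"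
      using C(2) by (intro mult_right_mono) auto
    then show "norm (R t y - R t x) \<le> C * t\<^sup>2 * norm (y - x)" using R2[OF t, of y x] by linarith
  qed
  then show ?thesis by blast
qed

section \<open>Approximate tangents\<close>

definition flat_cover :: "real \<Rightarrow> (nat \<Rightarrow> 'a::euclidean_space set) \<Rightarrow> (nat \<Rightarrow> 'a) \<Rightarrow> 'a set \<Rightarrow> bool" where
  "flat_cover \<delta> K \<tau> S \<longleftrightarrow>
     (\<forall>i. compact (K i) \<and> K i \<subseteq> S \<and> flat_piece \<delta> (\<tau> i) (K i)) \<and> hausdorff 1 (S - (\<Union>i. K i)) = 0"

lemma ennreal_le_inverse_Suc_imp_0:
  assumes "\<And>m. x \<le> ennreal (inverse (real (Suc m)))"
  shows "x = 0"
proof -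
  have "x \<le> 0"
  proof (rule ennreal_le_epsilon)
    fix e :: real assume "0 < e"
    then obtain m where "inverse (real (Suc m)) < e" using reals_Archimedean by blast
    then show "x \<le> 0 + ennreal e" using order_trans[OF assms[of m] ennreal_leI[of _ e]] by simp
  qed
  then show ?thesis by simp
qed

lemma continuum_flat_cover:
  fixes S :: "'a::euclidean_space set"
  assumes S: "compact S" "connected S" "S \<noteq> {}" "hausdorff 1 S < top" and \<delta>: "0 < \<delta>" "\<delta> < 1"
  shows "\<exists>K \<tau>. flat_cover \<delta> K \<tau> S"
proof -
  obtain \<gamma> L where L: "L-lipschitz_on {0..1::real} \<gamma>" and S': "\<gamma> ` {0..1} = S"
    using continuum_Lipschitz_curve[OF S] by blast
  have "\<exists>F. finite F \<and> (\<forall>(A, \<tau>)\<in>F. compact A \<and> A \<subseteq> S \<and> flat_piece \<delta> \<tau> A) \<and>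
    hausdorff 1 (S - (\<Union>(A, \<tau>)\<in>F. A)) \<le> ennreal (inverse (real (Suc m)))" for m
    using Lipschitz_curve_flat_pieces[OF L \<delta>, of "inverse (real (Suc m))"] unfolding S' by simp
  then have "\<exists>F. \<forall>m. finite (F m) \<and> (\<forall>(A, \<tau>)\<in>F m. compact A \<and> A \<subseteq> S \<and> flat_piece \<delta> \<tau> A) \<and>
    hausdorff 1 (S - (\<Union>(A, \<tau>)\<in>F m. A)) \<le> ennreal (inverse (real (Suc m)))"
    by (intro choice allI)
  then obtain F where F: "\<And>m. finite (F m)"
      "\<And>m p. p \<in> F m \<Longrightarrow> compact (fst p) \<and> fst p \<subseteq> S \<and> flat_piece \<delta> (snd p) (fst p)"
      "\<And>m. hausdorff 1 (S - (\<Union>(A, \<tau>)\<in>F m. A)) \<le> ennreal (inverse (real (Suc m)))"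
    by (auto simp: case_prod_beta)
  obtain b :: 'a where b: "b \<in> Basis" using nonempty_Basis by blast
  \<comment> \<open>\<open>from_nat_into\<close> enumerates a nonempty countable set; the empty
    piece with an arbitrary unit direction guarantees this.\<close>
  define G where "G = insert ({}, b) (\<Union>m. F m)"
  have "countable G" unfolding G_def using F(1) by (auto intro: countable_finite)
  then have rG: "range (from_nat_into G) = G" by (rule range_from_nat_into[rotated]) (simp add: G_def)
  have G: "compact (fst p) \<and> fst p \<subseteq> S \<and> flat_piece \<delta> (snd p) (fst p)" if "p \<in> G" for p
  proof -
    have "flat_piece \<delta> b {}" using b by (simp add: flat_piece_def)
    then show ?thesis using that F(2)[of p] unfolding G_def by force
  qed
  define K where "K i = fst (from_nat_into G i)" for i
  define \<tau> where "\<tau> i = snd (from_nat_into G i)" for i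
  have "compact (K i) \<and> K i \<subseteq> S \<and> flat_piece \<delta> (\<tau> i) (K i)" for i
    unfolding K_def \<tau>_def using G[of "from_nat_into G i"] rG by blast
  moreover have "hausdorff 1 (S - (\<Union>i. K i)) = 0"
  proof (rule ennreal_le_inverse_Suc_imp_0)
    fix m
    have "(\<Union>(A, \<tau>)\<in>F m. A) \<subseteq> (\<Union>i. K i)"
    proof
      fix x assume "x \<in> (\<Union>(A, \<tau>)\<in>F m. A)"
      then obtain p where p: "p \<in> F m" "x \<in> fst p" by auto
      then have "p \<in> G" unfolding G_def by blast
      then have "p \<in> range (from_nat_into G)" unfolding rG .
      then obtain i where "p = from_nat_into G i" by blast
      then show "x \<in> (\<Union>i. K i)" using p(2) by (auto simp: K_def)
    qed
    then have "hausdorff 1 (S - (\<Union>i. K i)) \<le> hausdorff 1 (S - (\<Union>(A, \<tau>)\<in>F m. A))"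
      by (intro hausdorff_mono) blast
    also have "\<dots> \<le> ennreal (inverse (real (Suc m)))" by (rule F(3))
    finally show "hausdorff 1 (S - (\<Union>i. K i)) \<le> ennreal (inverse (real (Suc m)))" .
  qed
  ultimately show ?thesis unfolding flat_cover_def by blast
qed

text \<open>Write \<open>u = c *\<^sub>R \<tau> + w\<close> with \<open>w\<close> orthogonal to
  \<open>\<tau>\<close> and \<open>norm w \<le> s\<close>: the two values differ by four terms, each
  at most \<open>M * s\<close>. The sign of \<open>c\<close> does not matter, as is necessary for
  tangents that are unique only up to sign.\<close>

lemma quadratic_form_close:
  fixes u \<tau> :: "'a::euclidean_space"
  assumes D: "linear D" "\<And>v. norm (D v) \<le> M * norm v" and u: "norm u = 1" and \<tau>: "norm \<tau> = 1"
    and s: "norm (u - (u \<bullet> \<tau>) *\<^sub>R \<tau>) \<le> s" "s \<le> 1"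
  shows "\<bar>D u \<bullet> u - D \<tau> \<bullet> \<tau>\<bar> \<le> 4 * M * s"
proof -
  define c where "c = u \<bullet> \<tau>"
  define w where "w = u - c *\<^sub>R \<tau>"
  have uw: "u = c *\<^sub>R \<tau> + w" by (simp add: w_def)
  have w: "norm w \<le> s" using s(1) by (simp add: w_def c_def)
  have M: "0 \<le> M" using order_trans[OF norm_ge_zero D(2)[of \<tau>]] \<tau> by simp
  have s0: "0 \<le> s" using order_trans[OF norm_ge_zero w] .
  have c1: "\<bar>c\<bar> \<le> 1" using Cauchy_Schwarz_ineq2[of u \<tau>] u \<tau> by (simp add: c_def)
  have \<tau>\<tau>: "\<tau> \<bullet> \<tau> = 1" "u \<bullet> u = 1" using u \<tau> by (simp_all add: norm_eq_1)
  have cw: "1 - c\<^sup>2 = (norm w)\<^sup>2"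
  proof -
    have "u \<bullet> \<tau> = c" "\<tau> \<bullet> u = c" by (simp_all add: c_def inner_commute)
    then show ?thesis
      unfolding w_def power2_norm_eq_inner
      by (simp add: inner_diff_left inner_diff_right \<tau>\<tau> power2_eq_square)
  qed
  have bd: "\<bar>D v \<bullet> z\<bar> \<le> M * norm v * norm z" for v z
    using Cauchy_Schwarz_ineq2[of "D v" z] mult_right_mono[OF D(2)[of v], of "norm z"] by simp
  have Du: "D u = c *\<^sub>R D \<tau> + D w" unfolding uw using D(1) by (simp add: linear_add linear_scale)
  have "D u \<bullet> u = c\<^sup>2 * (D \<tau> \<bullet> \<tau>) + c * (D \<tau> \<bullet> w) + c * (D w \<bullet> \<tau>) + D w \<bullet> w"
    using arg_cong[OF uw, of "\<lambda>z. (c *\<^sub>R D \<tau> + D w) \<bullet> z"] unfolding Du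
    by (simp add: inner_add_left inner_add_right power2_eq_square algebra_simps)
  then have "D u \<bullet> u - D \<tau> \<bullet> \<tau> = - ((norm w)\<^sup>2 * (D \<tau> \<bullet> \<tau>)) + c * (D \<tau> \<bullet> w) + c * (D w \<bullet> \<tau>) + D w \<bullet> w"
    unfolding cw[symmetric] by (simp add: algebra_simps)
  then have "\<bar>D u \<bullet> u - D \<tau> \<bullet> \<tau>\<bar> \<le> \<bar>(norm w)\<^sup>2 * (D \<tau> \<bullet> \<tau>)\<bar> + \<bar>c * (D \<tau> \<bullet> w)\<bar> + \<bar>c * (D w \<bullet> \<tau>)\<bar> + \<bar>D w \<bullet> w\<bar>"
    by linarith
  moreover have "\<bar>(norm w)\<^sup>2 * (D \<tau> \<bullet> \<tau>)\<bar> \<le> s * M"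
  proof -
    have "(norm w)\<^sup>2 \<le> s * 1" unfolding power2_eq_square using w s s0 by (intro mult_mono) auto
    then have "(norm w)\<^sup>2 * \<bar>D \<tau> \<bullet> \<tau>\<bar> \<le> s * M" using bd[of \<tau> \<tau>] \<tau> s0 by (intro mult_mono) auto
    then show ?thesis by (simp add: abs_mult)
  qed
  moreover have "\<bar>c * (D \<tau> \<bullet> w)\<bar> \<le> 1 * (M * s)"
    unfolding abs_mult using bd[of \<tau> w] \<tau> c1 mult_left_mono[OF w M] by (intro mult_mono) auto
  moreover have "\<bar>c * (D w \<bullet> \<tau>)\<bar> \<le> 1 * (M * s)"
    unfolding abs_mult using bd[of w \<tau>] \<tau> c1 mult_left_mono[OF w M] by (intro mult_mono) auto
  moreover have "\<bar>D w \<bullet> w\<bar> \<le> M * s"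
  proof -
    have "M * norm w * norm w \<le> M * s * 1" using w s s0 M by (intro mult_mono mult_left_mono) auto
    then show ?thesis using bd[of w w] by simp
  qed
  ultimately show ?thesis by (simp add: algebra_simps)
qed

lemma norm_normalized_projection:
  fixes v \<tau> :: "'a::euclidean_space"
  assumes "v \<noteq> 0" "norm (v - (v \<bullet> \<tau>) *\<^sub>R \<tau>) \<le> s * norm v"
  shows "norm (v /\<^sub>R norm v - ((v /\<^sub>R norm v) \<bullet> \<tau>) *\<^sub>R \<tau>) \<le> s"
proof -
  have "v /\<^sub>R norm v - ((v /\<^sub>R norm v) \<bullet> \<tau>) *\<^sub>R \<tau> = (v - (v \<bullet> \<tau>) *\<^sub>R \<tau>) /\<^sub>R norm v"
    by (simp add: algebra_simps)
  then have "norm (v /\<^sub>R norm v - ((v /\<^sub>R norm v) \<bullet> \<tau>) *\<^sub>R \<tau>) = norm (v - (v \<bullet> \<tau>) *\<^sub>R \<tau>) / norm v"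
    by (simp add: divide_inverse mult.commute)
  then show ?thesis using assms by (simp add: pos_divide_le_eq)
qed

lemma infdist_span_unit:
  fixes v \<tau> :: "'a::euclidean_space"
  assumes \<tau>: "norm \<tau> = 1"
  shows "infdist v (span {\<tau>}) = norm (v - (v \<bullet> \<tau>) *\<^sub>R \<tau>)"
proof (rule antisym)
  have "(v \<bullet> \<tau>) *\<^sub>R \<tau> \<in> span {\<tau>}" by (intro span_scale span_base) simp
  then show "infdist v (span {\<tau>}) \<le> norm (v - (v \<bullet> \<tau>) *\<^sub>R \<tau>)"
    using infdist_le[of _ "span {\<tau>}" v] by (simp add: dist_norm)
  have "span {\<tau>} \<noteq> {}" using span_zero by blast
  then obtain z where z: "z \<in> span {\<tau>}" "infdist v (span {\<tau>}) = dist v z"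
    using infdist_attains_inf[OF closed_span] by metis
  then obtain c where "z = c *\<^sub>R \<tau>" by (auto simp: span_singleton)
  then show "norm (v - (v \<bullet> \<tau>) *\<^sub>R \<tau>) \<le> infdist v (span {\<tau>})"
    using norm_diff_projection_le[OF \<tau>, of v c] z(2) by (simp add: dist_norm)
qed

lemma ennreal_tendsto_0_le:
  fixes f g :: "'a \<Rightarrow> ennreal"
  assumes "(g \<longlongrightarrow> 0) F" "\<And>x. f x \<le> g x"
  shows "(f \<longlongrightarrow> 0) F"
  using tendsto_sandwich[of "\<lambda>_. 0" f F g 0] assms by (simp add: always_eventually)

definition density_zero :: "'a::euclidean_space set \<Rightarrow> 'a \<Rightarrow> bool" where
  "density_zero T x \<longleftrightarrow> ((\<lambda>r. hausdorff 1 (T \<inter> cball x r) / ennreal (2 * r)) \<longlongrightarrow> 0) (at_right 0)"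

lemma AE_flat_cover_density:
  fixes S :: "'a::euclidean_space set"
  assumes S: "compact S" "hausdorff 1 S < top" and K: "flat_cover \<delta> K \<tau> S"
  shows "\<exists>N. hausdorff 1 N = 0 \<and> (\<forall>x\<in>S - N. (\<exists>i. x \<in> K i) \<and> (\<forall>i. x \<in> K i \<longrightarrow> density_zero (S - K i) x))"
proof -
  have "\<exists>N. hausdorff 1 N = 0 \<and> (\<forall>x\<in>K i - N. density_zero (S - K i) x)" for i
    unfolding density_zero_def
  proof (rule AE_density_null)
    have c: "compact (K i)" using K by (simp add: flat_cover_def)
    then show "closed (K i)" by (rule compact_imp_closed)
    show "S - K i \<in> sets (hausdorff_measure 1)"
      using S(1) c by (intro borel_subset_hausdorff_measure sets.Diff borel_compact)
    show "hausdorff 1 (S - K i) < top"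
      using S(2) hausdorff_mono[of "S - K i" S 1] by (rule le_less_trans[rotated]) auto
  qed auto
  then obtain N where N: "\<And>i. hausdorff 1 (N i) = 0" "\<And>i x. x \<in> K i - N i \<Longrightarrow> density_zero (S - K i) x"
    by metis
  define N' where "N' = (\<Union>i. N i) \<union> (S - (\<Union>i. K i))"
  have "hausdorff 1 (S - (\<Union>i. K i)) = 0" using K by (simp add: flat_cover_def)
  then have "hausdorff 1 N' \<le> 0"
    unfolding N'_def using hausdorff_Un_le[of 1 "\<Union>i. N i" "S - (\<Union>i. K i)"] hausdorff_null_UN[of 1 N, OF N(1)]
    by simp
  then have "hausdorff 1 N' = 0" by simp
  moreover have "(\<exists>i. x \<in> K i) \<and> (\<forall>i. x \<in> K i \<longrightarrow> density_zero (S - K i) x)" if "x \<in> S - N'" for x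
    using that N(2) unfolding N'_def by blast
  ultimately show ?thesis by blast
qed

text \<open>If no other point of \<open>K\<close> lay in the \<open>\<delta>\<close>-cone about
  \<open>\<tau>\<close>, then near \<open>x\<close> the set \<open>S\<close> would consist of
  \<open>S - K\<close> and of a part outside the cone, both of density zero, against the positive
  upper density. So some chord of \<open>K\<close> from \<open>x\<close> is
  \<open>\<delta>\<close>-close to \<open>\<tau>\<close> and, by flatness, to
  \<open>\<sigma>\<close>; comparing through it costs \<open>4 * M * \<delta>\<close> twice.\<close>

lemma approx_tangent_near_flat_piece:
  fixes x :: "'a::euclidean_space"
  assumes x: "x \<in> K" and K: "flat_piece \<delta> \<sigma> K" and dens: "density_zero (S - K) x"
    and \<delta>: "0 < \<delta>" "\<delta> < 1" and \<tau>: "approx_tangent S x \<tau>"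
    and D: "linear D" "\<And>v. norm (D v) \<le> M * norm v"
  shows "\<bar>D \<tau> \<bullet> \<tau> - D \<sigma> \<bullet> \<sigma>\<bar> \<le> 8 * M * \<delta>"
proof -
  have \<tau>1: "norm \<tau> = 1" and \<sigma>1: "norm \<sigma> = 1" using \<tau> K by (auto simp: approx_tangent_def flat_piece_def)
  let ?Z = "\<lambda>r. {y \<in> S \<inter> cball x r. \<delta> * norm (y - x) \<le> infdist (y - x) (span {\<tau>})}"
  have "\<exists>y\<in>K. y \<noteq> x \<and> infdist (y - x) (span {\<tau>}) \<le> \<delta> * norm (y - x)"
  proof (rule ccontr)
    assume "\<not> ?thesis"
    then have far: "\<delta> * norm (y - x) \<le> infdist (y - x) (span {\<tau>})" if "y \<in> K" for y
      using that by (cases "y = x") (auto simp: infdist_nonneg not_le less_imp_le)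
    have le: "hausdorff 1 (S \<inter> cball x r) / ennreal (2 * r) \<le>
        hausdorff 1 ((S - K) \<inter> cball x r) / ennreal (2 * r) + hausdorff 1 (?Z r) / ennreal (2 * r)" for r
    proof -
      have "S \<inter> cball x r \<subseteq> ((S - K) \<inter> cball x r) \<union> ?Z r" using far by blast
      then have "hausdorff 1 (S \<inter> cball x r) \<le> hausdorff 1 ((S - K) \<inter> cball x r) + hausdorff 1 (?Z r)"
        by (rule order_trans[OF hausdorff_mono hausdorff_Un_le])
      then show ?thesis
        by (simp add: add_divide_distrib_ennreal[symmetric] divide_right_mono_ennreal)
    qed
    have sum0: "((\<lambda>r. hausdorff 1 ((S - K) \<inter> cball x r) / ennreal (2 * r) + hausdorff 1 (?Z r) / ennreal (2 * r)) \<longlongrightarrow> 0 + 0) (at_right 0)"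
    proof (rule tendsto_add)
      show "((\<lambda>r. hausdorff 1 ((S - K) \<inter> cball x r) / ennreal (2 * r)) \<longlongrightarrow> 0) (at_right 0)"
        using dens by (simp add: density_zero_def)
      show "((\<lambda>r. hausdorff 1 (?Z r) / ennreal (2 * r)) \<longlongrightarrow> 0) (at_right 0)"
        using \<tau> \<delta> unfolding approx_tangent_def by blast
    qed
    have "((\<lambda>r. hausdorff 1 (S \<inter> cball x r) / ennreal (2 * r)) \<longlongrightarrow> 0) (at_right 0)"
      by (rule ennreal_tendsto_0_le[OF sum0[unfolded add_0] le])
    then have "Limsup (at_right 0) (\<lambda>r. hausdorff 1 (S \<inter> cball x r) / ennreal (2 * r)) = 0"
      by (intro lim_imp_Limsup) auto
    then show False using \<tau> by (simp add: approx_tangent_def)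
  qed
  then obtain y where y: "y \<in> K" "y \<noteq> x" "norm ((y - x) - ((y - x) \<bullet> \<tau>) *\<^sub>R \<tau>) \<le> \<delta> * norm (y - x)"
    unfolding infdist_span_unit[OF \<tau>1] by blast
  have \<sigma>: "norm ((y - x) - ((y - x) \<bullet> \<sigma>) *\<^sub>R \<sigma>) \<le> \<delta> * norm (y - x)"
    using K x y(1) unfolding flat_piece_def by blast
  define u where "u = (y - x) /\<^sub>R norm (y - x)"
  have "norm u = 1" using y(2) by (simp add: u_def)
  moreover have "norm (u - (u \<bullet> \<tau>) *\<^sub>R \<tau>) \<le> \<delta>" "norm (u - (u \<bullet> \<sigma>) *\<^sub>R \<sigma>) \<le> \<delta>"
    unfolding u_def using y \<sigma> by (auto intro!: norm_normalized_projection simp del: scaleR_scaleR inner_scaleR_left)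
  ultimately have "\<bar>D u \<bullet> u - D \<tau> \<bullet> \<tau>\<bar> \<le> 4 * M * \<delta>" "\<bar>D u \<bullet> u - D \<sigma> \<bullet> \<sigma>\<bar> \<le> 4 * M * \<delta>"
    using quadratic_form_close[OF D _ \<tau>1, of u \<delta>] quadratic_form_close[OF D _ \<sigma>1, of u \<delta>] \<delta> by simp_all
  then show ?thesis by linarith
qed

lemma hausdorff_singleton: "hausdorff 1 {p} = 0"
proof -
  have "hausdorff 1 {p} \<le> 0"
  proof (rule hausdorff_le)
    fix \<delta> :: real assume "0 < \<delta>"
    then show "hausdorff_premeasure \<delta> 1 {p} \<le> 0"
      using hausdorff_premeasure_le_weight[of "{p}" \<delta> 1] by (simp add: hausdorff_weight_1)
  qed
  then show ?thesis by simp
qed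

text \<open>Flat covers with \<open>\<delta>\<close> tending to 0 give a sequence of directions at
  almost every \<open>x\<close>. A limit point \<open>l\<close> of them is an approximate tangent,
  because fine pieces through \<open>x\<close> lie in any given cone about \<open>l\<close> while
  the rest of \<open>S\<close> has density zero at \<open>x\<close>. This existence is what gives
  the choice in \<open>tangent_vector\<close> a meaning.\<close>

lemma AE_approx_tangent:
  fixes S :: "'a::euclidean_space set"
  assumes S: "compact S" "connected S" "S \<noteq> {}" "hausdorff 1 S < top"
  shows "\<exists>N. hausdorff 1 N = 0 \<and> (\<forall>x\<in>S - N. approx_tangent S x (tangent_vector S x))"
proof (cases "\<exists>p q. p \<in> S \<and> q \<in> S \<and> p \<noteq> q")
  case False
  then obtain p where "S = {p}" using S(3) by blast
  then show ?thesis using hausdorff_singleton by (intro exI[of _ S]) auto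
next
  case True
  then obtain p q where pq: "p \<in> S" "q \<in> S" "p \<noteq> q" by blast
  define \<delta> where "\<delta> m = inverse (real (Suc (Suc m)))" for m
  have \<delta>: "0 < \<delta> m" "\<delta> m < 1" for m by (simp_all add: \<delta>_def field_simps)
  have \<delta>lim: "\<delta> \<longlonglongrightarrow> 0"
    using LIMSEQ_Suc[OF LIMSEQ_inverse_real_of_nat] by (simp add: \<delta>_def[abs_def])
  have "\<exists>K \<tau>. flat_cover (\<delta> m) K \<tau> S" for m by (rule continuum_flat_cover[OF S \<delta>])
  then obtain K \<tau> where K: "\<And>m. flat_cover (\<delta> m) (K m) (\<tau> m) S" by metis
  have "\<exists>N. hausdorff 1 N = 0 \<and> (\<forall>x\<in>S - N. (\<exists>i. x \<in> K m i) \<and> (\<forall>i. x \<in> K m i \<longrightarrow> density_zero (S - K m i) x))" for m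
    by (rule AE_flat_cover_density[OF S(1,4) K])
  then obtain N where N: "\<And>m. hausdorff 1 (N m) = 0"
      "\<And>m x. x \<in> S - N m \<Longrightarrow> (\<exists>i. x \<in> K m i) \<and> (\<forall>i. x \<in> K m i \<longrightarrow> density_zero (S - K m i) x)"
    by metis
  have "approx_tangent S x (tangent_vector S x)" if x: "x \<in> S - (\<Union>m. N m)" for x
  proof -
    have xS: "x \<in> S" using x by blast
    have "\<exists>i. x \<in> K m i" for m using N(2)[of x m] x by blast
    then obtain i where i: "\<And>m. x \<in> K m (i m)" by metis
    have dens: "density_zero (S - K m (i m)) x" for m using N(2)[of x m] x i by blast
    define \<sigma> where "\<sigma> m = \<tau> m (i m)" for m
    have flat: "flat_piece (\<delta> m) (\<sigma> m) (K m (i m))" for m using K by (simp add: flat_cover_def \<sigma>_def)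
    have \<sigma>1: "norm (\<sigma> m) = 1" for m using flat by (simp add: flat_piece_def)
    have "\<forall>m. \<sigma> m \<in> sphere 0 1" using \<sigma>1 by simp
    then obtain l r where l: "l \<in> sphere 0 1" and r: "strict_mono (r :: nat \<Rightarrow> nat)" and lim: "(\<sigma> \<circ> r) \<longlonglongrightarrow> l"
      using compact_sphere[of "0::'a" 1] unfolding compact_def by blast
    have l1: "norm l = 1" using l by simp
    have "approx_tangent S x l"
      unfolding approx_tangent_def
    proof (intro conjI allI impI l1)
      obtain y where y: "y \<in> S" "y \<noteq> x" using pq by metis
      \<comment> \<open>By connectedness \<open>S\<close> has length at least \<open>r\<close> in
        the ball of radius \<open>r\<close>.\<close>
      have "eventually (\<lambda>r. ennreal (1 / 2) \<le> hausdorff 1 (S \<inter> cball x r) / ennreal (2 * r)) (at_right 0)"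
      proof (rule eventually_mono[OF eventually_at_right_real[of 0 "dist x y"]])
        show "0 < dist x y" using y by simp
        fix r assume r: "r \<in> {0<..<dist x y}"
        have "ennreal (1 / 2) = ennreal r / ennreal (2 * r)" using r by (subst divide_ennreal) auto
        also have "\<dots> \<le> hausdorff 1 (S \<inter> cball x r) / ennreal (2 * r)"
          using hausdorff_connected_ge[OF S(2) xS y(1), of r] r by (intro divide_right_mono_ennreal) auto
        finally show "ennreal (1 / 2) \<le> hausdorff 1 (S \<inter> cball x r) / ennreal (2 * r)" .
      qed
      then have "ennreal (1 / 2) \<le> Limsup (at_right 0) (\<lambda>r. hausdorff 1 (S \<inter> cball x r) / ennreal (2 * r))"
        by (intro le_Limsup) auto
      then show "0 < Limsup (at_right 0) (\<lambda>r. hausdorff 1 (S \<inter> cball x r) / ennreal (2 * r))"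
        by (rule less_le_trans[rotated]) (unfold ennreal_less_zero_iff, simp)
      fix s :: real assume s: "0 < s \<and> s < 1"
      have "eventually (\<lambda>n. dist ((\<sigma> \<circ> r) n) l < s / 2) sequentially"
        using s by (intro tendstoD[OF lim]) auto
      moreover have "eventually (\<lambda>n. dist ((\<delta> \<circ> r) n) 0 < s / 2) sequentially"
        using s by (intro tendstoD[OF LIMSEQ_subseq_LIMSEQ[OF \<delta>lim r]]) auto
      ultimately have "eventually (\<lambda>n. dist ((\<sigma> \<circ> r) n) l < s / 2 \<and> dist ((\<delta> \<circ> r) n) 0 < s / 2) sequentially"
        by (rule eventually_conj)
      then obtain n where "dist ((\<sigma> \<circ> r) n) l < s / 2" "dist ((\<delta> \<circ> r) n) 0 < s / 2"
        by (auto simp: eventually_sequentially)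
      \<comment> \<open>One half of \<open>s\<close> is spent on the direction, the other on the
        flatness of the piece.\<close>
      then obtain m where m: "norm (\<sigma> m - l) < s / 2" "\<delta> m < s / 2"
        by (intro that[of "r n"]) (auto simp: dist_norm)
      let ?Z = "\<lambda>r. {y \<in> S \<inter> cball x r. s * norm (y - x) \<le> infdist (y - x) (span {l})}"
      have "?Z r \<subseteq> ((S - K m (i m)) \<inter> cball x r) \<union> {x}" for r
      proof
        fix y assume y: "y \<in> ?Z r"
        have "y = x" if yK: "y \<in> K m (i m)"
        proof (rule ccontr)
          assume "y \<noteq> x"
          then have v0: "0 < norm (y - x)" by simp
          let ?v = "y - x"
          have "infdist ?v (span {l}) \<le> norm (?v - (?v \<bullet> \<sigma> m) *\<^sub>R l)"
            unfolding infdist_span_unit[OF l1] by (rule norm_diff_projection_le[OF l1])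
          also have "\<dots> = norm ((?v - (?v \<bullet> \<sigma> m) *\<^sub>R \<sigma> m) + (?v \<bullet> \<sigma> m) *\<^sub>R (\<sigma> m - l))"
            by (simp add: algebra_simps)
          also have "\<dots> \<le> norm (?v - (?v \<bullet> \<sigma> m) *\<^sub>R \<sigma> m) + \<bar>?v \<bullet> \<sigma> m\<bar> * norm (\<sigma> m - l)"
            by (rule order_trans[OF norm_triangle_ineq]) simp
          also have "\<dots> \<le> \<delta> m * norm ?v + norm ?v * norm (\<sigma> m - l)"
          proof (rule add_mono)
            show "norm (?v - (?v \<bullet> \<sigma> m) *\<^sub>R \<sigma> m) \<le> \<delta> m * norm ?v"
              using flat[of m] i[of m] yK unfolding flat_piece_def by blast
            show "\<bar>?v \<bullet> \<sigma> m\<bar> * norm (\<sigma> m - l) \<le> norm ?v * norm (\<sigma> m - l)"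
              using Cauchy_Schwarz_ineq2[of ?v "\<sigma> m"] \<sigma>1 by (intro mult_right_mono) auto
          qed
          also have "\<dots> = (\<delta> m + norm (\<sigma> m - l)) * norm ?v" by (simp add: algebra_simps)
          also have "\<dots> < s * norm ?v" using m v0 by (intro mult_strict_right_mono) auto
          finally show False using y by simp
        qed
        then show "y \<in> ((S - K m (i m)) \<inter> cball x r) \<union> {x}" using y by blast
      qed
      then have "hausdorff 1 (?Z r) \<le> hausdorff 1 ((S - K m (i m)) \<inter> cball x r) + hausdorff 1 {x}" for r
        by (rule order_trans[OF hausdorff_mono hausdorff_Un_le])
      then have le: "hausdorff 1 (?Z r) / ennreal (2 * r) \<le> hausdorff 1 ((S - K m (i m)) \<inter> cball x r) / ennreal (2 * r)" for r
        unfolding hausdorff_singleton by (intro divide_right_mono_ennreal) simp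
      show "((\<lambda>r. hausdorff 1 (?Z r) / ennreal (2 * r)) \<longlongrightarrow> 0) (at_right 0)"
        by (rule ennreal_tendsto_0_le[OF dens[of m, unfolded density_zero_def] le])
    qed
    then show ?thesis unfolding tangent_vector_def by (rule someI)
  qed
  then show ?thesis using hausdorff_null_UN[of 1 N, OF N(1)] by blast
qed

text \<open>The factor 9 is 8 from comparing tangents plus 1 from moving the base point from
  \<open>x\<close> to \<open>a\<close>. The comparison value depends on \<open>a\<close> and
  \<open>i\<close> but not on \<open>x\<close>, so it serves as a constant on the whole
  piece.\<close>

lemma tangential_div_near_flat_cover:
  fixes S :: "'a::euclidean_space set"
  assumes S: "compact S" "connected S" "S \<noteq> {}" "hausdorff 1 S < top" and X: "C11_field M X"
    and K: "flat_cover \<delta> K \<tau> S" and \<delta>: "0 < \<delta>" "\<delta> < 1"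
  shows "\<exists>N. hausdorff 1 N = 0 \<and> (\<forall>x\<in>S - N. \<bar>tangential_div S X x\<bar> \<le> M \<and> (\<exists>i. x \<in> K i) \<and>
    (\<forall>i. \<forall>a\<in>K i. x \<in> K i \<longrightarrow> \<bar>tangential_div S X x - frechet_derivative X (at a) (\<tau> i) \<bullet> \<tau> i\<bar> \<le> 9 * M * \<delta>))"
proof -
  note X' = C11_fieldD[OF X]
  obtain N1 where N1: "hausdorff 1 N1 = 0" "\<And>x. x \<in> S - N1 \<Longrightarrow> approx_tangent S x (tangent_vector S x)"
    using AE_approx_tangent[OF S] by blast
  obtain N2 where N2: "hausdorff 1 N2 = 0"
      "\<And>x. x \<in> S - N2 \<Longrightarrow> (\<exists>i. x \<in> K i) \<and> (\<forall>i. x \<in> K i \<longrightarrow> density_zero (S - K i) x)"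
    using AE_flat_cover_density[OF S(1,4) K] by blast
  have "hausdorff 1 (N1 \<union> N2) \<le> 0" using hausdorff_Un_le[of 1 N1 N2] N1 N2 by simp
  then have N0: "hausdorff 1 (N1 \<union> N2) = 0" by simp
  have "\<bar>tangential_div S X x\<bar> \<le> M \<and> (\<exists>i. x \<in> K i) \<and>
    (\<forall>i. \<forall>a\<in>K i. x \<in> K i \<longrightarrow> \<bar>tangential_div S X x - frechet_derivative X (at a) (\<tau> i) \<bullet> \<tau> i\<bar> \<le> 9 * M * \<delta>)"
    if x: "x \<in> S - (N1 \<union> N2)" for x
  proof (intro conjI allI ballI impI)
    let ?t = "tangent_vector S x" and ?D = "\<lambda>x. frechet_derivative X (at x)"
    have t: "approx_tangent S x ?t" using N1(2) x by blast
    then have t1: "norm ?t = 1" by (simp add: approx_tangent_def)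
    have "\<bar>?D x ?t \<bullet> ?t\<bar> \<le> norm (?D x ?t) * norm ?t" by (rule Cauchy_Schwarz_ineq2)
    then show "\<bar>tangential_div S X x\<bar> \<le> M"
      unfolding tangential_div_def using X'(4)[of x ?t] t1 by simp
    show "\<exists>i. x \<in> K i" using N2(2) x by blast
    fix i a assume a: "a \<in> K i" and xi: "x \<in> K i"
    have flat: "flat_piece \<delta> (\<tau> i) (K i)" using K by (simp add: flat_cover_def)
    then have \<tau>1: "norm (\<tau> i) = 1" by (simp add: flat_piece_def)
    have "density_zero (S - K i) x" using N2(2) x xi by blast
    then have "\<bar>?D x ?t \<bullet> ?t - ?D x (\<tau> i) \<bullet> \<tau> i\<bar> \<le> 8 * M * \<delta>"
      by (rule approx_tangent_near_flat_piece[OF xi flat _ \<delta> t X'(6,4)])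
    moreover have "\<bar>?D x (\<tau> i) \<bullet> \<tau> i - ?D a (\<tau> i) \<bullet> \<tau> i\<bar> \<le> M * \<delta>"
    proof -
      have "\<bar>(?D x (\<tau> i) - ?D a (\<tau> i)) \<bullet> \<tau> i\<bar> \<le> norm (?D x (\<tau> i) - ?D a (\<tau> i)) * norm (\<tau> i)"
        by (rule Cauchy_Schwarz_ineq2)
      also have "\<dots> \<le> M * norm (x - a)" using X'(5)[of x "\<tau> i" a] \<tau>1 by simp
      also have "\<dots> \<le> M * \<delta>"
        using flat a xi X'(1) by (intro mult_left_mono) (auto simp: flat_piece_def dist_norm)
      finally show ?thesis by (simp add: inner_diff_left)
    qed
    ultimately show "\<bar>tangential_div S X x - ?D a (\<tau> i) \<bullet> \<tau> i\<bar> \<le> 9 * M * \<delta>"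
      unfolding tangential_div_def by linarith
  qed
  then show ?thesis using N0 by blast
qed

section \<open>Measurability and integrability of the tangential divergence\<close>

lemma (in complete_measure) borel_measurable_null_cong:
  fixes f g :: "'a \<Rightarrow> 'b::topological_space"
  assumes f: "f \<in> borel_measurable M" and N: "N \<in> null_sets M"
    and eq: "\<And>x. x \<in> space M - N \<Longrightarrow> g x = f x"
  shows "g \<in> borel_measurable M"
proof (rule measurableI)
  fix B :: "'b set" assume B: "B \<in> sets borel"
  have "g -` B \<inter> N \<in> sets M" using complete[OF _ N, of "g -` B \<inter> N"] by auto
  moreover have "f -` B \<inter> space M \<in> sets M" using f B by (rule measurable_sets)
  ultimately have "(f -` B \<inter> space M - N) \<union> (g -` B \<inter> N) \<in> sets M"
    using N by (auto simp: null_sets_def)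
  moreover have "g -` B \<inter> space M = (f -` B \<inter> space M - N) \<union> (g -` B \<inter> N)"
    using eq sets.sets_into_space[OF null_setsD2[OF N]] by auto
  ultimately show "g -` B \<inter> space M \<in> sets M" by simp
qed simp

lemma complete_measure_hausdorff: "complete_measure (hausdorff_measure k)"
proof
  fix A B :: "'a set" assume "B \<subseteq> A" "A \<in> null_sets (hausdorff_measure k)"
  then have "hausdorff k A = 0" using emeasure_hausdorff_measure[of A k] by (simp add: null_sets_def)
  then show "B \<in> sets (hausdorff_measure k)"
    using hausdorff_null_sets[OF hausdorff_null_subset[OF \<open>B \<subseteq> A\<close>]] by auto
qed

text \<open>The tangent is picked by \<open>SOME\<close>, so nothing is measurable by construction.
  Almost everywhere on \<open>S\<close>, though, the divergence is the limit of the functions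
  \<open>f m\<close>, which depend only on the index of the first piece containing \<open>x\<close>;
  completeness of the measure does the rest.\<close>

lemma set_integrable_tangential_div:
  fixes S :: "'a::euclidean_space set"
  assumes S: "compact S" "connected S" "S \<noteq> {}" "hausdorff 1 S < top" and X: "C11_field M X"
  shows "set_integrable (hausdorff_measure 1) S (tangential_div S X)"
proof -
  let ?H = "hausdorff_measure 1 :: 'a measure" and ?D = "\<lambda>x. frechet_derivative X (at x)"
  define \<delta> where "\<delta> m = inverse (real (Suc (Suc m)))" for m
  have \<delta>: "0 < \<delta> m" "\<delta> m < 1" for m by (simp_all add: \<delta>_def field_simps)
  have \<delta>lim: "\<delta> \<longlonglongrightarrow> 0"
    using LIMSEQ_Suc[OF LIMSEQ_inverse_real_of_nat] by (simp add: \<delta>_def[abs_def])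
  have "\<exists>K \<tau>. flat_cover (\<delta> m) K \<tau> S" for m by (rule continuum_flat_cover[OF S \<delta>])
  then obtain K \<tau> where K: "\<And>m. flat_cover (\<delta> m) (K m) (\<tau> m) S" by metis
  have "\<exists>N. hausdorff 1 N = 0 \<and> (\<forall>x\<in>S - N. \<bar>tangential_div S X x\<bar> \<le> M \<and> (\<exists>i. x \<in> K m i) \<and>
    (\<forall>i. \<forall>a\<in>K m i. x \<in> K m i \<longrightarrow> \<bar>tangential_div S X x - ?D a (\<tau> m i) \<bullet> \<tau> m i\<bar> \<le> 9 * M * \<delta> m))" for m
    by (rule tangential_div_near_flat_cover[OF S X K \<delta>])
  then have "\<exists>N. \<forall>m. hausdorff 1 (N m) = 0 \<and> (\<forall>x\<in>S - N m. \<bar>tangential_div S X x\<bar> \<le> M \<and> (\<exists>i. x \<in> K m i) \<and>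
    (\<forall>i. \<forall>a\<in>K m i. x \<in> K m i \<longrightarrow> \<bar>tangential_div S X x - ?D a (\<tau> m i) \<bullet> \<tau> m i\<bar> \<le> 9 * M * \<delta> m))"
    by (intro choice allI)
  then obtain N where N: "\<And>m. hausdorff 1 (N m) = 0"
      "\<And>m x. x \<in> S - N m \<Longrightarrow> \<bar>tangential_div S X x\<bar> \<le> M"
      "\<And>m x. x \<in> S - N m \<Longrightarrow> \<exists>i. x \<in> K m i"
      "\<And>m x i a. x \<in> S - N m \<Longrightarrow> a \<in> K m i \<Longrightarrow> x \<in> K m i \<Longrightarrow>
         \<bar>tangential_div S X x - ?D a (\<tau> m i) \<bullet> \<tau> m i\<bar> \<le> 9 * M * \<delta> m"
    by blast
  define a where "a m i = (SOME a. a \<in> K m i)" for m i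
  define q where "q m i = ?D (a m i) (\<tau> m i) \<bullet> \<tau> m i" for m i
  \<comment> \<open>The least index makes overlapping pieces act like disjoint ones.\<close>
  define f where "f m x = q m (LEAST i. x \<in> K m i)" for m x
  have mK: "K m i \<in> sets ?H" for m i
    using K by (auto simp: flat_cover_def intro!: borel_subset_hausdorff_measure borel_compact)
  have f: "f m \<in> borel_measurable ?H" for m
  proof -
    have "(\<lambda>x. LEAST i. x \<in> K m i) \<in> measurable ?H (count_space UNIV)"
    proof (rule measurable_Least)
      show "(\<lambda>x. x \<in> K m i) \<in> measurable ?H (count_space UNIV)" for i
        using mK[of m i] by (simp add: pred_sets2[of "K m i" ?H "\<lambda>x. x" ?H, simplified])
    qed
    then have "q m \<circ> (\<lambda>x. LEAST i. x \<in> K m i) \<in> borel_measurable ?H"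
      by (rule measurable_comp) simp
    then show ?thesis by (simp add: f_def[abs_def] comp_def)
  qed
  have mS: "S \<in> sets ?H" using S(1) by (intro borel_subset_hausdorff_measure borel_compact)
  define g where "g x = (if x \<in> S then lim (\<lambda>m. f m x) else 0)" for x
  have g: "g \<in> borel_measurable ?H"
    unfolding g_def
    by (intro measurable_If_set borel_measurable_lim_metric f measurable_const) (simp_all only: space_hausdorff_measure Int_UNIV_right mS space_borel UNIV_I)
  define N' where "N' = (\<Union>m. N m)"
  have N': "hausdorff 1 N' = 0" unfolding N'_def by (rule hausdorff_null_UN[OF N(1)])
  have flim: "(\<lambda>m. f m x) \<longlonglongrightarrow> tangential_div S X x" if x: "x \<in> S - N'" for x
  proof -
    have le: "\<bar>f m x - tangential_div S X x\<bar> \<le> 9 * M * \<delta> m" for m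
    proof -
      have xm: "x \<in> S - N m" using x by (auto simp: N'_def)
      let ?i = "LEAST i. x \<in> K m i"
      have xi: "x \<in> K m ?i" using N(3)[OF xm] by (rule LeastI_ex)
      then have "a m ?i \<in> K m ?i" unfolding a_def by (rule someI)
      from N(4)[OF xm this xi] show ?thesis by (simp add: f_def q_def abs_minus_commute)
    qed
    have "(\<lambda>m. 9 * M * \<delta> m) \<longlonglongrightarrow> 9 * M * 0" by (intro tendsto_intros \<delta>lim)
    then have "(\<lambda>m. 9 * M * \<delta> m) \<longlonglongrightarrow> 0" by simp
    then have "(\<lambda>m. f m x - tangential_div S X x) \<longlonglongrightarrow> 0"
      by (rule Lim_null_comparison[rotated]) (use le in simp)
    then show ?thesis by (rule LIM_zero_cancel)
  qed
  have "(\<lambda>x. indicator S x *\<^sub>R tangential_div S X x) \<in> borel_measurable ?H"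
  proof (rule complete_measure.borel_measurable_null_cong[OF complete_measure_hausdorff g hausdorff_null_sets[OF N']])
    fix x assume "x \<in> space ?H - N'"
    then show "indicator S x *\<^sub>R tangential_div S X x = g x"
      using flim[of x] by (auto simp: g_def indicator_def limI)
  qed
  then show ?thesis
    unfolding set_integrable_def
  proof (rule integrableI_bounded_set[where A = S and B = M, rotated])
    show "emeasure ?H S < \<infinity>" using S(4) emeasure_hausdorff_measure[OF mS] by simp
    show "AE x in ?H. x \<in> S \<longrightarrow> norm (indicator S x *\<^sub>R tangential_div S X x) \<le> M"
      by (rule AE_I'[OF hausdorff_null_sets[OF N(1)[of 0]]]) (use N(2)[of _ 0] in auto)
  qed (use mS in auto)
qed

section \<open>First variation of length\<close>

text \<open>The squares of the norm and of its linearization differ by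
  \<open>\<epsilon>\<^sup>2\<close> times a number between 0 and \<open>M\<^sup>2\<close>; dividing
  by the sum of the two, which is at least \<open>1 / 2\<close>, produces the factor 2.\<close>

lemma norm_unit_perturbation:
  fixes u z :: "'a::real_inner"
  assumes u: "norm u = 1" and z: "norm z \<le> M" and e: "\<bar>\<epsilon>\<bar> * M \<le> 1 / 2"
  shows "\<bar>norm (u + \<epsilon> *\<^sub>R z) - (1 + \<epsilon> * (z \<bullet> u))\<bar> \<le> 2 * M\<^sup>2 * \<epsilon>\<^sup>2"
proof -
  define a where "a = norm (u + \<epsilon> *\<^sub>R z)"
  define b where "b = 1 + \<epsilon> * (z \<bullet> u)"
  have M: "0 \<le> M" using order_trans[OF norm_ge_zero z] .
  have zu: "\<bar>z \<bullet> u\<bar> \<le> norm z" using Cauchy_Schwarz_ineq2[of z u] u by simp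
  have "\<bar>\<epsilon> * (z \<bullet> u)\<bar> \<le> \<bar>\<epsilon>\<bar> * M"
    unfolding abs_mult using zu z by (intro mult_left_mono) auto
  then have b: "1 / 2 \<le> b" using e unfolding b_def by linarith
  have a0: "0 \<le> a" by (simp add: a_def)
  have "u \<bullet> u = 1" using u by (simp add: norm_eq_1)
  then have "a\<^sup>2 - b\<^sup>2 = \<epsilon>\<^sup>2 * ((norm z)\<^sup>2 - (z \<bullet> u)\<^sup>2)"
    unfolding a_def b_def power2_norm_eq_inner
    by (simp add: inner_add_left inner_add_right inner_commute[of u z] power2_eq_square algebra_simps)
  moreover have "\<bar>(norm z)\<^sup>2 - (z \<bullet> u)\<^sup>2\<bar> \<le> M\<^sup>2"
  proof -
    have "(z \<bullet> u)\<^sup>2 \<le> (norm z)\<^sup>2" using zu by (metis abs_ge_zero power2_abs power_mono)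
    moreover have "(norm z)\<^sup>2 \<le> M\<^sup>2" using z by (intro power_mono) auto
    ultimately show ?thesis using zero_le_power2[of "z \<bullet> u"] by linarith
  qed
  ultimately have "\<bar>a\<^sup>2 - b\<^sup>2\<bar> \<le> \<epsilon>\<^sup>2 * M\<^sup>2" by (simp add: abs_mult mult_left_mono)
  moreover have "\<bar>a\<^sup>2 - b\<^sup>2\<bar> = \<bar>a - b\<bar> * (a + b)"
  proof -
    have "a\<^sup>2 - b\<^sup>2 = (a - b) * (a + b)" by (simp add: power2_eq_square algebra_simps)
    then show ?thesis using a0 b by (simp add: abs_mult)
  qed
  moreover have "\<bar>a - b\<bar> * (1 / 2) \<le> \<bar>a - b\<bar> * (a + b)" using a0 b by (intro mult_left_mono) auto
  ultimately have "\<bar>a - b\<bar> * (1 / 2) \<le> \<epsilon>\<^sup>2 * M\<^sup>2" by simp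
  then show ?thesis unfolding a_def b_def by (simp add: mult_ac)
qed

text \<open>Four errors: \<open>M * \<delta>\<close> from freezing the derivative at
  \<open>a\<close>, \<open>C\<close> from the remainder of \<open>\<phi>\<close>,
  \<open>2 * M\<^sup>2\<close> from linearizing the norm, and \<open>4 * M * \<delta>\<close> from
  replacing the direction of the chord by \<open>\<tau>\<close>.\<close>

lemma variation_chord:
  fixes X :: "'a::euclidean_space \<Rightarrow> 'a"
  assumes X: "C11_field M X" and \<phi>: "first_variation S X \<phi> C" and A: "A \<subseteq> S" "flat_piece \<delta> \<tau> A"
    and a: "a \<in> A" and xy: "x \<in> A" "y \<in> A" and e: "\<bar>\<epsilon>\<bar> \<le> 1" "\<bar>\<epsilon>\<bar> * M \<le> 1 / 2" and \<delta>: "0 \<le> \<delta>" "\<delta> \<le> 1"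
  shows "\<bar>norm (\<phi> \<epsilon> y - \<phi> \<epsilon> x) - (1 + \<epsilon> * (frechet_derivative X (at a) \<tau> \<bullet> \<tau>)) * norm (y - x)\<bar>
    \<le> (5 * M * \<delta> * \<bar>\<epsilon>\<bar> + (C + 2 * M\<^sup>2) * \<epsilon>\<^sup>2) * norm (y - x)"
proof (cases "y = x")
  case True
  then show ?thesis by simp
next
  case False
  let ?D = "frechet_derivative X (at a)"
  note X' = C11_fieldD[OF X]
  define n where "n = norm (y - x)"
  define u where "u = (y - x) /\<^sub>R n"
  have n: "0 < n" using False by (simp add: n_def)
  have u1: "norm u = 1" using n by (simp add: u_def n_def)
  have yx: "y - x = n *\<^sub>R u" using n by (simp add: u_def)
  have Ad: "norm (z - a) \<le> \<delta>" if "z \<in> A" for z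
    using A(2) a that unfolding flat_piece_def by (metis dist_norm)
  have 1: "norm (X y - X x - ?D (y - x)) \<le> M * \<delta> * n"
  proof -
    have "norm ((X y - ?D y) - (X x - ?D x)) \<le> (M * \<delta>) * norm (y - x)"
    \<comment> \<open>The mean value inequality asks for a convex set, which \<open>A\<close> need
      not be; the ball contains \<open>A\<close>.\<close>
    proof (rule differentiable_bound[of "cball a \<delta>" "\<lambda>z. X z - ?D z" "\<lambda>z v. frechet_derivative X (at z) v - ?D v"])
      show "((\<lambda>z. X z - ?D z) has_derivative (\<lambda>v. frechet_derivative X (at z) v - ?D v)) (at z within cball a \<delta>)" for z
        by (intro has_derivative_diff has_derivative_at_withinI[OF X'(3)] linear_imp_has_derivative X'(6))
      show "onorm (\<lambda>v. frechet_derivative X (at z) v - ?D v) \<le> M * \<delta>" if "z \<in> cball a \<delta>" for z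
      proof (rule onorm_bound)
        show "0 \<le> M * \<delta>" using X'(1) \<delta> by simp
        fix v :: 'a
        have "M * norm (z - a) * norm v \<le> M * \<delta> * norm v"
          using that X'(1) by (intro mult_right_mono mult_left_mono) (auto simp: dist_norm norm_minus_commute)
        then show "norm (frechet_derivative X (at z) v - ?D v) \<le> M * \<delta> * norm v"
          using X'(5)[of z v a] by linarith
      qed
    qed (use Ad[OF xy(1)] Ad[OF xy(2)] in \<open>simp_all add: dist_norm norm_minus_commute[of a]\<close>)
    then show ?thesis by (simp add: linear_diff[OF X'(6)] n_def algebra_simps)
  qed
  have 2: "norm ((\<phi> \<epsilon> y - (y + \<epsilon> *\<^sub>R X y)) - (\<phi> \<epsilon> x - (x + \<epsilon> *\<^sub>R X x))) \<le> C * \<epsilon>\<^sup>2 * n"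
    using \<phi> xy A(1) e(1) unfolding first_variation_def n_def by blast
  let ?w = "(y - x) + \<epsilon> *\<^sub>R ?D (y - x)"
  have 3: "\<bar>norm (\<phi> \<epsilon> y - \<phi> \<epsilon> x) - norm ?w\<bar> \<le> \<bar>\<epsilon>\<bar> * (M * \<delta> * n) + C * \<epsilon>\<^sup>2 * n"
  proof -
    have "\<phi> \<epsilon> y - \<phi> \<epsilon> x - ?w = \<epsilon> *\<^sub>R (X y - X x - ?D (y - x)) +
        ((\<phi> \<epsilon> y - (y + \<epsilon> *\<^sub>R X y)) - (\<phi> \<epsilon> x - (x + \<epsilon> *\<^sub>R X x)))" by (simp add: algebra_simps)
    then have "norm (\<phi> \<epsilon> y - \<phi> \<epsilon> x - ?w) \<le> \<bar>\<epsilon>\<bar> * norm (X y - X x - ?D (y - x)) +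
        norm ((\<phi> \<epsilon> y - (y + \<epsilon> *\<^sub>R X y)) - (\<phi> \<epsilon> x - (x + \<epsilon> *\<^sub>R X x)))"
      by (metis norm_scaleR norm_triangle_ineq)
    also have "\<dots> \<le> \<bar>\<epsilon>\<bar> * (M * \<delta> * n) + C * \<epsilon>\<^sup>2 * n" using 1 2 by (intro add_mono mult_left_mono) auto
    finally show ?thesis using norm_triangle_ineq3[of "\<phi> \<epsilon> y - \<phi> \<epsilon> x" ?w] by linarith
  qed
  have 4: "\<bar>norm ?w - n * (1 + \<epsilon> * (?D u \<bullet> u))\<bar> \<le> n * (2 * M\<^sup>2 * \<epsilon>\<^sup>2)"
  proof -
    have "?w = n *\<^sub>R (u + \<epsilon> *\<^sub>R ?D u)" unfolding yx by (simp add: linear_scale[OF X'(6)] algebra_simps)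
    then have "norm ?w = n * norm (u + \<epsilon> *\<^sub>R ?D u)" using n by simp
    then have "norm ?w - n * (1 + \<epsilon> * (?D u \<bullet> u)) = n * (norm (u + \<epsilon> *\<^sub>R ?D u) - (1 + \<epsilon> * (?D u \<bullet> u)))"
      by (simp only: right_diff_distrib)
    moreover have "\<bar>norm (u + \<epsilon> *\<^sub>R ?D u) - (1 + \<epsilon> * (?D u \<bullet> u))\<bar> \<le> 2 * M\<^sup>2 * \<epsilon>\<^sup>2"
      using X'(4)[of a u] u1 e(2) by (intro norm_unit_perturbation) auto
    ultimately show ?thesis using n by (simp add: abs_mult)
  qed
  have 5: "\<bar>?D u \<bullet> u - ?D \<tau> \<bullet> \<tau>\<bar> \<le> 4 * M * \<delta>"
  proof (rule quadratic_form_close[OF X'(6,4) u1])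
    show "norm \<tau> = 1" using A(2) by (simp add: flat_piece_def)
    have "norm ((y - x) - ((y - x) \<bullet> \<tau>) *\<^sub>R \<tau>) \<le> \<delta> * norm (y - x)"
      using A(2) xy unfolding flat_piece_def by blast
    then show "norm (u - (u \<bullet> \<tau>) *\<^sub>R \<tau>) \<le> \<delta>"
      using norm_normalized_projection[of "y - x" \<tau> \<delta>] False by (simp add: u_def n_def)
  qed (rule \<delta>)
  have 6: "\<bar>n * (1 + \<epsilon> * (?D u \<bullet> u)) - (1 + \<epsilon> * (?D \<tau> \<bullet> \<tau>)) * n\<bar> \<le> n * (\<bar>\<epsilon>\<bar> * (4 * M * \<delta>))"
  proof -
    have "n * (1 + \<epsilon> * (?D u \<bullet> u)) - (1 + \<epsilon> * (?D \<tau> \<bullet> \<tau>)) * n = n * (\<epsilon> * (?D u \<bullet> u - ?D \<tau> \<bullet> \<tau>))"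
      by (simp add: algebra_simps)
    then show ?thesis using n 5 by (simp add: abs_mult mult_left_mono)
  qed
  have "\<bar>norm (\<phi> \<epsilon> y - \<phi> \<epsilon> x) - (1 + \<epsilon> * (?D \<tau> \<bullet> \<tau>)) * n\<bar> \<le>
      \<bar>\<epsilon>\<bar> * (M * \<delta> * n) + C * \<epsilon>\<^sup>2 * n + n * (2 * M\<^sup>2 * \<epsilon>\<^sup>2) + n * (\<bar>\<epsilon>\<bar> * (4 * M * \<delta>))"
    using 3 4 6 by linarith
  also have "\<dots> = (5 * M * \<delta> * \<bar>\<epsilon>\<bar> + (C + 2 * M\<^sup>2) * \<epsilon>\<^sup>2) * n" by (simp add: algebra_simps)
  finally show ?thesis by (simp add: n_def)
qed

section \<open>From single pieces to the length of the whole image\<close>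

lemma set_integral_close_const:
  fixes f :: "'a \<Rightarrow> real"
  assumes A: "A \<in> sets M" "emeasure M A < top" and f: "set_integrable M A f"
    and close: "AE x in M. x \<in> A \<longrightarrow> \<bar>f x - q\<bar> \<le> e"
  shows "\<bar>(LINT x:A|M. f x) - q * measure M A\<bar> \<le> e * measure M A"
proof -
  have i1: "integrable M (indicator A :: 'a \<Rightarrow> real)" using A by simp
  have i2: "integrable M (\<lambda>x. indicator A x *\<^sub>R f x - q * indicator A x)"
    using f i1 unfolding set_integrable_def by (intro Bochner_Integration.integrable_diff integrable_mult_right)
  have "(LINT x:A|M. f x) - q * measure M A = (LINT x|M. indicator A x *\<^sub>R f x - q * indicator A x)"
    using f i1 A unfolding set_integrable_def set_lebesgue_integral_def
    by (subst Bochner_Integration.integral_diff) auto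
  also have "\<bar>\<dots>\<bar> \<le> (LINT x|M. \<bar>indicator A x *\<^sub>R f x - q * indicator A x\<bar>)"
    by (rule integral_abs_bound)
  also have "\<dots> \<le> (LINT x|M. e * indicator A x)"
  proof (rule integral_mono_AE)
    show "AE x in M. \<bar>indicator A x *\<^sub>R f x - q * indicator A x\<bar> \<le> e * indicator A x"
      using close by eventually_elim (auto simp: indicator_def)
  qed (use i1 i2 in auto)
  also have "\<dots> = e * measure M A" using A by simp
  finally show ?thesis .
qed

lemma sums_abs_le:
  fixes x y :: "nat \<Rightarrow> real"
  assumes "x sums X" "y sums Y" "\<And>i. \<bar>x i\<bar> \<le> e * y i"
  shows "\<bar>X\<bar> \<le> e * Y"
proof -
  have y: "(\<lambda>i. e * y i) sums (e * Y)" by (rule sums_mult[OF assms(2)])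
  have "x i \<le> e * y i" "- (e * y i) \<le> x i" for i using assms(3)[of i] by linarith+
  then have "X \<le> e * Y" "- (e * Y) \<le> X"
    using sums_le[OF _ assms(1) y] sums_le[OF _ sums_minus[OF y] assms(1)] by auto
  then show ?thesis by linarith
qed

lemma first_variation_Lipschitz:
  assumes X: "C11_field M X" and \<phi>: "first_variation S X \<phi> C" and e: "\<bar>\<epsilon>\<bar> \<le> 1" and xy: "x \<in> S" "y \<in> S"
  shows "\<bar>norm (\<phi> \<epsilon> y - \<phi> \<epsilon> x) - norm (y - x)\<bar> \<le> \<bar>\<epsilon>\<bar> * (M + C) * norm (y - x)"
proof -
  let ?R = "(\<phi> \<epsilon> y - (y + \<epsilon> *\<^sub>R X y)) - (\<phi> \<epsilon> x - (x + \<epsilon> *\<^sub>R X x))"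
  have C: "0 \<le> C" using \<phi> by (simp add: first_variation_def)
  have "norm ?R \<le> C * \<epsilon>\<^sup>2 * norm (y - x)" using \<phi> e xy unfolding first_variation_def by blast
  moreover have "C * \<epsilon>\<^sup>2 * norm (y - x) \<le> C * \<bar>\<epsilon>\<bar> * norm (y - x)"
  proof (intro mult_right_mono mult_left_mono C)
    have "\<bar>\<epsilon>\<bar> * \<bar>\<epsilon>\<bar> \<le> \<bar>\<epsilon>\<bar> * 1" using e by (intro mult_left_mono) auto
    then show "\<epsilon>\<^sup>2 \<le> \<bar>\<epsilon>\<bar>" by (simp add: power2_eq_square)
  qed simp
  moreover have "norm (\<epsilon> *\<^sub>R (X y - X x)) \<le> \<bar>\<epsilon>\<bar> * (M * norm (y - x))"
    using C11_field_Lipschitz[OF X, of y x] by (simp add: mult_left_mono)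
  moreover have "\<phi> \<epsilon> y - \<phi> \<epsilon> x - (y - x) = \<epsilon> *\<^sub>R (X y - X x) + ?R" by (simp add: algebra_simps)
  then have "norm (\<phi> \<epsilon> y - \<phi> \<epsilon> x - (y - x)) \<le> norm (\<epsilon> *\<^sub>R (X y - X x)) + norm ?R"
    by (metis norm_triangle_ineq)
  ultimately show ?thesis
    using norm_triangle_ineq3[of "\<phi> \<epsilon> y - \<phi> \<epsilon> x" "y - x"] by (simp add: algebra_simps)
qed

lemma measure_hausdorff:
  "A \<in> sets (hausdorff_measure k) \<Longrightarrow> measure (hausdorff_measure k) A = enn2real (hausdorff k A)"
  by (simp add: measure_def emeasure_hausdorff_measure)

lemma hausdorff_image_close:
  fixes f :: "'a::metric_space \<Rightarrow> 'b::metric_space"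
  assumes fin: "hausdorff 1 A < top" and c: "0 < c - e" "0 \<le> e"
    and f: "\<And>x y. x \<in> A \<Longrightarrow> y \<in> A \<Longrightarrow> \<bar>dist (f x) (f y) - c * dist x y\<bar> \<le> e * dist x y"
  shows "\<bar>enn2real (hausdorff 1 (f ` A)) - c * enn2real (hausdorff 1 A)\<bar> \<le> e * enn2real (hausdorff 1 A)"
proof -
  define h where "h = enn2real (hausdorff 1 A)"
  have h: "hausdorff 1 A = ennreal h" "0 \<le> h" using fin by (auto simp: h_def less_top)
  have "(c + e)-lipschitz_on A f"
    by (rule lipschitz_onI) (use f c in \<open>force simp: abs_le_iff algebra_simps\<close>)+
  then have "hausdorff 1 (f ` A) \<le> ennreal ((c + e) * h)"
    using hausdorff_Lipschitz_image[of "c + e" A f] c h by (simp add: ennreal_mult)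
  moreover have "ennreal ((c - e) * h) \<le> hausdorff 1 (f ` A)"
  proof -
    have "(c - e) * dist x y \<le> dist (f x) (f y)" if "x \<in> A" "y \<in> A" for x y
      using f[OF that] by (simp add: abs_le_iff algebra_simps)
    then have "ennreal (c - e) * hausdorff 1 A \<le> hausdorff 1 (f ` A)" by (rule hausdorff_expand_image[OF c(1)])
    then show ?thesis using c h by (simp add: ennreal_mult)
  qed
  moreover obtain k where k: "hausdorff 1 (f ` A) = ennreal k" "0 \<le> k"
    using calculation(1) by (cases "hausdorff 1 (f ` A)") (auto simp: top_unique)
  ultimately have "k \<le> (c + e) * h" "(c - e) * h \<le> k"
    using h c by (auto simp: ennreal_le_iff)
  then show ?thesis using k h by (simp add: h_def[symmetric] abs_le_iff algebra_simps)
qed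

text \<open>The cover is chosen for the given \<open>\<epsilon>\<close>, with
  \<open>\<delta> = |\<epsilon>|\<close>, so that every error is quadratic: \<open>5 * M\<close> and
  \<open>C + 2 * M\<^sup>2\<close> come from the chords, \<open>9 * M\<close> from replacing the
  divergence by a constant on each piece.\<close>

lemma hausdorff_variation_bound:
  fixes S :: "'a::euclidean_space set"
  assumes S: "compact S" "connected S" "S \<noteq> {}" "hausdorff 1 S < top"
    and X: "C11_field M X" and \<phi>: "first_variation S X \<phi> C"
    and e: "0 < \<bar>\<epsilon>\<bar>" "\<bar>\<epsilon>\<bar> < 1" "\<bar>\<epsilon>\<bar> * (6 * M + C + 2 * M\<^sup>2) \<le> 1 / 2"
  defines "h \<equiv> \<lambda>A::'a set. enn2real (hausdorff 1 A)"
  shows "\<bar>h (\<phi> \<epsilon> ` S) - h S - \<epsilon> * (LINT x:S|hausdorff_measure 1. tangential_div S X x)\<bar>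
    \<le> (14 * M + C + 2 * M\<^sup>2) * \<epsilon>\<^sup>2 * h S"
proof -
  let ?H = "hausdorff_measure 1 :: 'a measure"
  let ?f = "tangential_div S X"
  let ?D = "\<lambda>x. frechet_derivative X (at x)"
  note X' = C11_fieldD[OF X]
  have C: "0 \<le> C" using \<phi> by (simp add: first_variation_def)
  define \<delta> where "\<delta> = \<bar>\<epsilon>\<bar>"
  have \<delta>: "0 < \<delta>" "\<delta> < 1" using e by (auto simp: \<delta>_def)
  have e1: "\<bar>\<epsilon>\<bar> \<le> 1" using e by simp
  define t where "t = \<bar>\<epsilon>\<bar>"
  \<comment> \<open>The smallness of \<open>\<epsilon>\<close> is used three times: for the
    expansion of the norm, to keep the scaling factor of a piece positive after subtracting its
    error, and for injectivity of \<open>\<phi> \<epsilon>\<close> on \<open>S\<close>.\<close>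
  have "t * (6 * M) + t * (C + 2 * M\<^sup>2) \<le> 1 / 2" using e(3) by (simp add: t_def algebra_simps)
  moreover have "0 \<le> t * M" "0 \<le> t * C" "0 \<le> t * (2 * M\<^sup>2)" using X'(1) C by (auto simp: t_def)
  ultimately have tM: "t * M \<le> 1 / 2" "t * (5 * M) + t * M + t * (C + 2 * M\<^sup>2) \<le> 1 / 2" "t * (M + C) \<le> 1 / 2"
    by (auto simp: algebra_simps)
  define err where "err = 5 * M * \<delta> * \<bar>\<epsilon>\<bar> + (C + 2 * M\<^sup>2) * \<epsilon>\<^sup>2"
  have err0: "0 \<le> err" unfolding err_def using X'(1) C \<delta> by simp
  have err_eq: "err = t * (t * (5 * M) + t * (C + 2 * M\<^sup>2))"
    by (simp add: err_def t_def \<delta>_def power2_eq_square algebra_simps)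
  have err1: "err \<le> t * (5 * M) + t * (C + 2 * M\<^sup>2)"
    unfolding err_eq using e1 X'(1) C by (intro mult_left_le_one_le) (auto simp: t_def)
  obtain K \<tau> where K: "flat_cover \<delta> K \<tau> S" using continuum_flat_cover[OF S \<delta>] by blast
  then have K': "compact (K i)" "K i \<subseteq> S" "flat_piece \<delta> (\<tau> i) (K i)" for i by (auto simp: flat_cover_def)
  have Knull: "hausdorff 1 (S - (\<Union>i. K i)) = 0" using K by (simp add: flat_cover_def)
  obtain N where N: "hausdorff 1 N = 0"
    "\<And>x i a. x \<in> S - N \<Longrightarrow> a \<in> K i \<Longrightarrow> x \<in> K i \<Longrightarrow> \<bar>?f x - ?D a (\<tau> i) \<bullet> \<tau> i\<bar> \<le> 9 * M * \<delta>"
    "\<And>x. x \<in> S - N \<Longrightarrow> \<bar>?f x\<bar> \<le> M"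
    using tangential_div_near_flat_cover[OF S X K \<delta>] by blast
  \<comment> \<open>Lengths and integrals add up over disjoint pieces, and subsets inherit the
    estimates for chords.\<close>
  define A where "A = disjointed K"
  have AK: "A i \<subseteq> K i" for i by (simp add: A_def disjointed_subset)
  have UA: "(\<Union>i. A i) = (\<Union>i. K i)" by (simp add: A_def UN_disjointed_eq)
  have disjA: "disjoint_family A" by (simp add: A_def disjoint_family_disjointed)
  have mK: "K i \<in> sets ?H" for i using K' by (intro borel_subset_hausdorff_measure borel_compact)
  have mA: "A i \<in> sets ?H" for i
    unfolding A_def disjointed_def using mK by (intro sets.Diff sets.finite_UN) auto
  have mS: "S \<in> sets ?H" using S(1) by (intro borel_subset_hausdorff_measure borel_compact)
  have AS: "A i \<subseteq> S" for i using AK K' by blast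
  have fin: "hausdorff 1 B < top" if "B \<subseteq> S" for B
    using hausdorff_mono[OF that] S(4) by (rule le_less_trans)
  have Lip: "(1 + \<bar>\<epsilon>\<bar> * (M + C))-lipschitz_on S (\<phi> \<epsilon>)"
  proof (rule lipschitz_onI)
    fix x y assume "x \<in> S" "y \<in> S"
    from first_variation_Lipschitz[OF X \<phi> e1 this(2,1)]
    show "dist (\<phi> \<epsilon> x) (\<phi> \<epsilon> y) \<le> (1 + \<bar>\<epsilon>\<bar> * (M + C)) * dist x y"
      by (simp add: dist_norm algebra_simps abs_le_iff)
  qed (use X'(1) C in simp)
  have cont: "continuous_on S (\<phi> \<epsilon>)" using Lip by (rule lipschitz_on_continuous_on)
  \<comment> \<open>Distances change by at most one half of their size, so images of disjoint pieces
    remain disjoint.\<close>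
  have inj: "inj_on (\<phi> \<epsilon>) S"
  proof (rule inj_onI)
    fix x y assume xy: "x \<in> S" "y \<in> S" "\<phi> \<epsilon> x = \<phi> \<epsilon> y"
    from first_variation_Lipschitz[OF X \<phi> e1 xy(1,2)] xy(3)
    have "norm (y - x) \<le> \<bar>\<epsilon>\<bar> * (M + C) * norm (y - x)" by simp
    also have "\<dots> \<le> 1 / 2 * norm (y - x)" using tM(3) unfolding t_def by (intro mult_right_mono) auto
    finally show "x = y" by simp
  qed
  have mono_fin: "hausdorff 1 (\<phi> \<epsilon> ` B) < top" if "B \<subseteq> S" for B
  proof -
    have "hausdorff 1 (\<phi> \<epsilon> ` B) \<le> ennreal (1 + \<bar>\<epsilon>\<bar> * (M + C)) * hausdorff 1 B"
      using Lip that by (intro hausdorff_Lipschitz_image) (rule lipschitz_on_subset)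
    also have "\<dots> < top" using fin[OF that] by (simp add: ennreal_mult_less_top)
    finally show ?thesis .
  qed
  have mIK: "\<phi> \<epsilon> ` K i \<in> sets ?H" for i
    using K' cont by (intro borel_subset_hausdorff_measure borel_compact compact_continuous_image) (auto intro: continuous_on_subset)
  \<comment> \<open>By injectivity the image of a disjointed piece is a compact set minus finitely
    many compact sets, hence measurable.\<close>
  have IA: "\<phi> \<epsilon> ` A i = \<phi> \<epsilon> ` K i - (\<Union>j\<in>{0..<i}. \<phi> \<epsilon> ` K j)" for i
    unfolding A_def disjointed_def using inj K'(2)
    by (subst inj_on_image_set_diff[of "\<phi> \<epsilon>" S]) (auto simp: image_UN)
  have mIA: "\<phi> \<epsilon> ` A i \<in> sets ?H" for i
    unfolding IA using mIK by (intro sets.Diff sets.finite_UN) auto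
  have disjIA: "disjoint_family (\<lambda>i. \<phi> \<epsilon> ` A i)"
    unfolding disjoint_family_on_def
  proof (intro ballI impI)
    fix i j :: nat assume "i \<noteq> j"
    then have "A i \<inter> A j = {}" using disjA by (auto simp: disjoint_family_on_def)
    then show "\<phi> \<epsilon> ` A i \<inter> \<phi> \<epsilon> ` A j = {}"
      using inj_on_image_Int[OF inj AS AS, of i j] by simp
  qed
  have hS: "h (\<Union>i. A i) = h S"
  proof -
    have "hausdorff 1 S \<le> hausdorff 1 ((\<Union>i. K i) \<union> (S - (\<Union>i. K i)))" by (rule hausdorff_mono) blast
    also have "\<dots> \<le> hausdorff 1 (\<Union>i. K i)" using hausdorff_Un_le[of 1 "\<Union>i. K i" "S - (\<Union>i. K i)"] Knull by simp
    finally have le: "hausdorff 1 S \<le> hausdorff 1 (\<Union>i. K i)" .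
    have "hausdorff 1 (\<Union>i. K i) \<le> hausdorff 1 S" using K'(2) by (intro hausdorff_mono) blast
    then have "hausdorff 1 (\<Union>i. K i) = hausdorff 1 S" using le by (rule antisym)
    then show ?thesis by (simp add: h_def UA)
  qed
  have hIS: "h (\<Union>i. \<phi> \<epsilon> ` A i) = h (\<phi> \<epsilon> ` S)"
  proof -
    have eq: "(\<Union>i. \<phi> \<epsilon> ` A i) = \<phi> \<epsilon> ` (\<Union>i. K i)" unfolding UA[symmetric] by blast
    let ?Z = "S - (\<Union>i. K i)"
    have "hausdorff 1 (\<phi> \<epsilon> ` ?Z) \<le> ennreal (1 + \<bar>\<epsilon>\<bar> * (M + C)) * hausdorff 1 ?Z"
      by (intro hausdorff_Lipschitz_image lipschitz_on_subset[OF Lip]) auto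
    then have Z: "hausdorff 1 (\<phi> \<epsilon> ` ?Z) = 0" unfolding Knull by simp
    have "hausdorff 1 (\<phi> \<epsilon> ` S) \<le> hausdorff 1 (\<phi> \<epsilon> ` (\<Union>i. K i) \<union> \<phi> \<epsilon> ` ?Z)" by (rule hausdorff_mono) blast
    also have "\<dots> \<le> hausdorff 1 (\<phi> \<epsilon> ` (\<Union>i. K i))"
      using hausdorff_Un_le[of 1 "\<phi> \<epsilon> ` (\<Union>i. K i)" "\<phi> \<epsilon> ` ?Z"] Z by simp
    finally have le: "hausdorff 1 (\<phi> \<epsilon> ` S) \<le> hausdorff 1 (\<phi> \<epsilon> ` (\<Union>i. K i))" .
    have "hausdorff 1 (\<phi> \<epsilon> ` (\<Union>i. K i)) \<le> hausdorff 1 (\<phi> \<epsilon> ` S)"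
      using K'(2) by (intro hausdorff_mono image_mono) blast
    then have "hausdorff 1 (\<phi> \<epsilon> ` (\<Union>i. K i)) = hausdorff 1 (\<phi> \<epsilon> ` S)" using le by (rule antisym)
    then show ?thesis by (simp add: h_def eq)
  qed
  have s1: "(\<lambda>i. h (A i)) sums h S"
  proof -
    have "(\<lambda>i. measure ?H (A i)) sums measure ?H (\<Union>i. A i)"
    proof (rule measure_UNION)
      show "emeasure ?H (\<Union>i. A i) \<noteq> \<infinity>"
        using fin[of "\<Union>i. A i"] AS mA by (subst emeasure_hausdorff_measure) (auto simp: less_top)
    qed (use mA disjA in auto)
    moreover have "measure ?H (\<Union>i. A i) = h S"
    proof -
      have "measure ?H (\<Union>i. A i) = h (\<Union>i. A i)"
        unfolding h_def using mA by (intro measure_hausdorff sets.countable_UN) auto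
      then show ?thesis using hS by simp
    qed
    ultimately show ?thesis using mA by (simp add: measure_hausdorff h_def)
  qed
  have s2: "(\<lambda>i. h (\<phi> \<epsilon> ` A i)) sums h (\<phi> \<epsilon> ` S)"
  proof -
    have "(\<lambda>i. measure ?H (\<phi> \<epsilon> ` A i)) sums measure ?H (\<Union>i. \<phi> \<epsilon> ` A i)"
    proof (rule measure_UNION)
      have "(\<Union>i. \<phi> \<epsilon> ` A i) = \<phi> \<epsilon> ` (\<Union>i. A i)" by blast
      then have "hausdorff 1 (\<Union>i. \<phi> \<epsilon> ` A i) < top" using mono_fin[of "\<Union>i. A i"] AS by auto
      then show "emeasure ?H (\<Union>i. \<phi> \<epsilon> ` A i) \<noteq> \<infinity>"
        using mIA by (subst emeasure_hausdorff_measure) (auto simp: less_top)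
    qed (use mIA disjIA in auto)
    moreover have "measure ?H (\<Union>i. \<phi> \<epsilon> ` A i) = h (\<phi> \<epsilon> ` S)"
    proof -
      have "measure ?H (\<Union>i. \<phi> \<epsilon> ` A i) = h (\<Union>i. \<phi> \<epsilon> ` A i)"
        unfolding h_def using mIA by (intro measure_hausdorff sets.countable_UN) auto
      then show ?thesis using hIS by simp
    qed
    ultimately show ?thesis using mIA by (simp add: measure_hausdorff h_def)
  qed
  have intS: "set_integrable ?H S ?f" by (rule set_integrable_tangential_div[OF S X])
  have intA: "set_integrable ?H (A i) ?f" for i using intS mA AS by (rule set_integrable_subset)
  have hA: "measure ?H (A i) = h (A i)" for i using mA by (simp add: measure_hausdorff h_def)
  have eA: "emeasure ?H (A i) < top" for i using fin[OF AS] mA by (simp add: emeasure_hausdorff_measure)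
  have AEN: "AE x in ?H. x \<notin> N" using hausdorff_null_sets[OF N(1)] by (rule AE_not_in)
  define I where "I i = (LINT x:A i|?H. ?f x)" for i
  have s3: "I sums (LINT x:S|?H. ?f x)"
  proof -
    have I_le: "\<bar>I i\<bar> \<le> M * h (A i)" for i
    proof -
      have "AE x in ?H. x \<in> A i \<longrightarrow> \<bar>?f x - 0\<bar> \<le> M" using AEN
      proof eventually_elim
        case (elim x)
        have "x \<in> S - N" if "x \<in> A i" using that elim AS[of i] by blast
        then show ?case using N(3) by simp
      qed
      from set_integral_close_const[OF mA eA intA this] show ?thesis by (simp only: I_def hA mult_zero_left diff_zero)
    qed
    have "summable I"
      by (rule summable_comparison_test'[OF summable_mult[OF sums_summable[OF s1], of M], of 0])
         (simp only: real_norm_def I_le)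
    moreover have "suminf I = (LINT x:(\<Union>i. A i)|?H. ?f x)"
      unfolding I_def
    proof (rule lebesgue_integral_countable_add[symmetric])
      show "set_integrable ?H (\<Union>i. A i) ?f" using intS mA AS by (intro set_integrable_subset[OF intS]) auto
      show "A i \<inter> A j = {}" if "i \<noteq> j" for i j using disjA that by (auto simp: disjoint_family_on_def)
    qed (rule mA)
    moreover have "(LINT x:(\<Union>i. A i)|?H. ?f x) = (LINT x:S|?H. ?f x)"
      unfolding set_lebesgue_integral_def
    proof (rule integral_cong_AE)
      show "(\<lambda>x. indicator (\<Union>i. A i) x *\<^sub>R ?f x) \<in> borel_measurable ?H"
        using set_integrable_subset[OF intS, of "\<Union>i. A i"] mA AS unfolding set_integrable_def
        by (intro borel_measurable_integrable) auto
      show "(\<lambda>x. indicator S x *\<^sub>R ?f x) \<in> borel_measurable ?H"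
        using intS unfolding set_integrable_def by (rule borel_measurable_integrable)
      have "AE x in ?H. x \<notin> S - (\<Union>i. K i)" using hausdorff_null_sets[OF Knull] by (rule AE_not_in)
      then show "AE x in ?H. indicator (\<Union>i. A i) x *\<^sub>R ?f x = indicator S x *\<^sub>R ?f x"
      proof eventually_elim
        case (elim x)
        then have "x \<in> (\<Union>i. A i) \<longleftrightarrow> x \<in> S" using AS unfolding UA[symmetric] by blast
        then show ?case by (simp only: indicator_def)
      qed
    qed
    ultimately show ?thesis by (simp add: sums_iff)
  qed
  have piece: "\<bar>h (\<phi> \<epsilon> ` A i) - h (A i) - \<epsilon> * I i\<bar> \<le> (err + \<bar>\<epsilon>\<bar> * (9 * M * \<delta>)) * h (A i)" for i
  proof (cases "A i = {}")
    case True
    then show ?thesis by (simp add: I_def h_def set_lebesgue_integral_def)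
  next
    case False
    then obtain a where a: "a \<in> K i" using AK by blast
    \<comment> \<open>The constant of the piece: lengths scale by nearly
      \<open>1 + \<epsilon> * q\<close>, and the divergence is nearly \<open>q\<close>.\<close>
    define q where "q = ?D a (\<tau> i) \<bullet> \<tau> i"
    have \<tau>1: "norm (\<tau> i) = 1" using K'(3)[of i] by (simp add: flat_piece_def)
    have q: "\<bar>q\<bar> \<le> M"
      using Cauchy_Schwarz_ineq2[of "?D a (\<tau> i)" "\<tau> i"] X'(4)[of a "\<tau> i"] \<tau>1 by (simp add: q_def)
    have "\<bar>\<epsilon> * q\<bar> \<le> t * M" unfolding abs_mult t_def using q by (intro mult_left_mono) auto
    then have c: "0 < (1 + \<epsilon> * q) - err" using err1 tM(2) by linarith
    have "\<bar>enn2real (hausdorff 1 (\<phi> \<epsilon> ` A i)) - (1 + \<epsilon> * q) * enn2real (hausdorff 1 (A i))\<bar> \<le> err * enn2real (hausdorff 1 (A i))"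
    proof (rule hausdorff_image_close[OF fin[OF AS] c err0])
      fix x y assume "x \<in> A i" "y \<in> A i"
      then have xy: "y \<in> K i" "x \<in> K i" using AK by blast+
      show "\<bar>dist (\<phi> \<epsilon> x) (\<phi> \<epsilon> y) - (1 + \<epsilon> * q) * dist x y\<bar> \<le> err * dist x y"
        unfolding dist_norm q_def err_def
        by (rule variation_chord[OF X \<phi> K'(2,3) a xy e1]) (use tM \<delta> in \<open>auto simp: t_def\<close>)
    qed
    then have 1: "\<bar>h (\<phi> \<epsilon> ` A i) - (1 + \<epsilon> * q) * h (A i)\<bar> \<le> err * h (A i)" by (simp add: h_def)
    have "AE x in ?H. x \<in> A i \<longrightarrow> \<bar>?f x - q\<bar> \<le> 9 * M * \<delta>"
      using AEN
    proof eventually_elim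
      case (elim x)
      have "x \<in> S - N" "x \<in> K i" if "x \<in> A i" using that elim AS[of i] AK[of i] by blast+
      then show ?case using N(2)[OF _ a] unfolding q_def by blast
    qed
    from set_integral_close_const[OF mA eA intA this]
    have "\<bar>I i - q * h (A i)\<bar> \<le> 9 * M * \<delta> * h (A i)" by (simp only: I_def hA)
    then have "\<bar>\<epsilon>\<bar> * \<bar>I i - q * h (A i)\<bar> \<le> \<bar>\<epsilon>\<bar> * (9 * M * \<delta> * h (A i))" by (rule mult_left_mono) simp
    then have 2: "\<bar>\<epsilon> * (I i - q * h (A i))\<bar> \<le> \<bar>\<epsilon>\<bar> * (9 * M * \<delta> * h (A i))" by (simp add: abs_mult)
    have "h (\<phi> \<epsilon> ` A i) - h (A i) - \<epsilon> * I i =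
        (h (\<phi> \<epsilon> ` A i) - (1 + \<epsilon> * q) * h (A i)) - \<epsilon> * (I i - q * h (A i))" by (simp add: algebra_simps)
    then have "\<bar>h (\<phi> \<epsilon> ` A i) - h (A i) - \<epsilon> * I i\<bar> \<le> err * h (A i) + \<bar>\<epsilon>\<bar> * (9 * M * \<delta> * h (A i))"
      using 1 2 by linarith
    then show ?thesis by (simp add: algebra_simps)
  qed
  have "\<bar>h (\<phi> \<epsilon> ` S) - h S - \<epsilon> * (LINT x:S|?H. ?f x)\<bar> \<le> (err + \<bar>\<epsilon>\<bar> * (9 * M * \<delta>)) * h S"
    by (rule sums_abs_le[OF sums_diff[OF sums_diff[OF s2 s1] sums_mult[OF s3]] s1 piece])
  also have "err + \<bar>\<epsilon>\<bar> * (9 * M * \<delta>) = (14 * M + C + 2 * M\<^sup>2) * \<epsilon>\<^sup>2"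
    by (simp add: err_def \<delta>_def power2_eq_square algebra_simps)
  finally show ?thesis .
qed

lemma has_real_derivative_quadratic_error:
  fixes g :: "real \<Rightarrow> real"
  assumes r: "0 < r" and le: "\<And>\<epsilon>. 0 < \<bar>\<epsilon>\<bar> \<Longrightarrow> \<bar>\<epsilon>\<bar> < r \<Longrightarrow> \<bar>g \<epsilon> - g 0 - \<epsilon> * D\<bar> \<le> B * \<epsilon>\<^sup>2" and B: "0 \<le> B"
  shows "(g has_real_derivative D) (at 0)"
  unfolding has_field_derivative_def has_derivative_at_alt
proof (intro conjI allI impI)
  show "bounded_linear (\<lambda>h. D * h)" by (rule bounded_linear_mult_right)
  fix e :: real assume e: "0 < e"
  define d where "d = min r (e / (B + 1))"
  have d: "0 < d" using r e B by (simp add: d_def)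
  show "\<exists>d>0. \<forall>y. norm (y - 0) < d \<longrightarrow> norm (g y - g 0 - D * (y - 0)) \<le> e * norm (y - 0)"
  proof (intro exI[of _ d] conjI d allI impI)
    fix y :: real assume "norm (y - 0) < d"
    then have y: "\<bar>y\<bar> < r" "\<bar>y\<bar> < e / (B + 1)" by (auto simp: d_def)
    show "norm (g y - g 0 - D * (y - 0)) \<le> e * norm (y - 0)"
    proof (cases "y = 0")
      case False
      have "\<bar>y\<bar> * (B + 1) < e" using y(2) B by (simp add: pos_less_divide_eq)
      then have "B * \<bar>y\<bar> \<le> e" by (simp add: algebra_simps)
      then have "B * \<bar>y\<bar> * \<bar>y\<bar> \<le> e * \<bar>y\<bar>" by (rule mult_right_mono) simp
      then have "B * y\<^sup>2 \<le> e * \<bar>y\<bar>" by (simp add: power2_eq_square mult.assoc)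
      then show ?thesis using le[of y] False y(1) by (simp add: mult.commute)
    qed simp
  qed
qed

lemma hausdorff_variation_derivative:
  fixes S :: "'a::euclidean_space set"
  assumes S: "compact S" "connected S" "S \<noteq> {}" "hausdorff 1 S < top"
    and X: "C11_field M X" and \<phi>: "first_variation S X \<phi> C"
  shows "((\<lambda>\<epsilon>. enn2real (hausdorff 1 (\<phi> \<epsilon> ` S))) has_real_derivative - mean_curvature S X) (at 0)"
proof -
  have M: "0 \<le> M" using C11_fieldD(1)[OF X] .
  have C: "0 \<le> C" using \<phi> by (simp add: first_variation_def)
  \<comment> \<open>The quadratic remainder bound at \<open>\<epsilon> = 0\<close> forces the
    identity on \<open>S\<close>.\<close>
  have "\<phi> 0 x = x" if "x \<in> S" for x
  proof -
    have "norm (\<phi> 0 x - (x + 0 *\<^sub>R X x)) \<le> C * 0\<^sup>2"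
      using \<phi> that unfolding first_variation_def by (metis abs_zero zero_le_one)
    then show ?thesis by simp
  qed
  then have 0: "\<phi> 0 ` S = S" by simp
  define T where "T = 6 * M + C + 2 * M\<^sup>2"
  have T: "0 \<le> T" using M C by (simp add: T_def)
  define r where "r = 1 / (2 * (T + 1))"
  have r: "0 < r" "r < 1" "r * T \<le> 1 / 2" using T by (auto simp: r_def field_simps)
  show ?thesis
    unfolding mean_curvature_def minus_minus
  proof (rule has_real_derivative_quadratic_error[OF r(1)])
    fix \<epsilon> :: real assume e: "0 < \<bar>\<epsilon>\<bar>" "\<bar>\<epsilon>\<bar> < r"
    have "\<bar>\<epsilon>\<bar> * T \<le> r * T" using e T by (intro mult_right_mono) auto
    then have "\<bar>\<epsilon>\<bar> * (6 * M + C + 2 * M\<^sup>2) \<le> 1 / 2" using r(3) by (simp add: T_def)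
    from hausdorff_variation_bound[OF S X \<phi> e(1) _ this] e r(2)
    show "\<bar>enn2real (hausdorff 1 (\<phi> \<epsilon> ` S)) - enn2real (hausdorff 1 (\<phi> 0 ` S)) -
        \<epsilon> * (LINT x:S|hausdorff_measure 1. tangential_div S X x)\<bar> \<le>
        ((14 * M + C + 2 * M\<^sup>2) * enn2real (hausdorff 1 S)) * \<epsilon>\<^sup>2"
      unfolding 0 by (simp add: mult_ac)
  qed (use M C in simp)
qed

section \<open>First variation of the average distance functional\<close>

text \<open>Two points of a connected set are no farther apart than its length, so finite length
  implies boundedness.\<close>

lemma finite_length_continuum_compact:
  fixes S :: "'a::euclidean_space set"
  assumes "closed S" "connected S" "hausdorff 1 S < top"
  shows "compact S"
proof (cases "S = {}")
  case False
  then obtain x where x: "x \<in> S" by blast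
  obtain h where h: "hausdorff 1 S = ennreal h" "0 \<le> h" using assms(3) by (cases "hausdorff 1 S") auto
  have "S \<subseteq> cball x h"
  proof
    fix y assume y: "y \<in> S"
    have "ennreal (dist x y) \<le> hausdorff 1 (S \<inter> cball x (dist x y))"
      by (rule hausdorff_connected_ge[OF assms(2) x y]) auto
    also have "\<dots> \<le> ennreal h" unfolding h(1)[symmetric] by (rule hausdorff_mono) auto
    finally show "y \<in> cball x h" using h(2) by (simp add: ennreal_le_iff)
  qed
  then have "bounded S" by (rule bounded_subset[OF bounded_cball])
  then show ?thesis using assms(1) by (simp add: compact_eq_bounded_closed)
qed simp

section \<open>Differentiating the integral of the distance\<close>

lemma infdist_image_close:
  fixes f :: "'a::metric_space \<Rightarrow> 'a"
  assumes "S \<noteq> {}" and f: "\<And>s. s \<in> S \<Longrightarrow> dist (f s) s \<le> e"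
  shows "\<bar>infdist x (f ` S) - infdist x S\<bar> \<le> e"
proof -
  have "infdist x (f ` S) - e \<le> infdist x S"
    unfolding infdist_notempty[OF assms(1)]
  proof (rule cINF_greatest[OF assms(1)])
    fix s assume s: "s \<in> S"
    have "infdist x (f ` S) \<le> dist x (f s)" using s by (intro infdist_le) auto
    also have "\<dots> \<le> dist x s + e" using dist_triangle[of x "f s" s] f[OF s] by (simp add: dist_commute)
    finally show "infdist x (f ` S) - e \<le> dist x s" by simp
  qed
  moreover have "infdist x S - e \<le> infdist x (f ` S)"
  proof -
    have ne: "f ` S \<noteq> {}" using assms(1) by simp
    show ?thesis
      unfolding infdist_notempty[OF ne]
    proof (rule cINF_greatest[OF ne])
      fix y assume "y \<in> f ` S"
      then obtain s where s: "s \<in> S" "y = f s" by blast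
      have "infdist x S \<le> dist x s" using s by (intro infdist_le) auto
      also have "\<dots> \<le> dist x (f s) + e" using dist_triangle[of x s "f s"] f[OF s(1)] by (simp add: dist_commute)
      finally show "infdist x S - e \<le> dist x y" using s by simp
    qed
  qed
  ultimately show ?thesis by linarith
qed

lemma infdist_borel_measurable: "sets \<mu> = sets borel \<Longrightarrow> (\<lambda>x. infdist x T) \<in> borel_measurable \<mu>"
  by (subst measurable_cong_sets[of \<mu> borel borel borel])
     (auto intro!: borel_measurable_continuous_onI continuous_intros)

lemma integrable_infdist:
  fixes \<mu> :: "'a::euclidean_space measure"
  assumes \<mu>: "sets \<mu> = sets borel" "finite_measure \<mu>" "compact K" "emeasure \<mu> (- K) = 0" and T: "T \<noteq> {}"
  shows "integrable \<mu> (\<lambda>x. infdist x T)"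
proof -
  obtain t where t: "t \<in> T" using T by blast
  obtain B where B: "\<And>x. x \<in> K \<Longrightarrow> dist t x \<le> B"
    using compact_imp_bounded[OF \<mu>(3)] by (meson bounded_any_center)
  have "- K \<in> sets \<mu>" unfolding \<mu>(1) by (intro borel_comp borel_compact \<mu>(3))
  with \<mu>(4) have "- K \<in> null_sets \<mu>" by (rule null_setsI)
  then have "AE x in \<mu>. x \<notin> - K" by (rule AE_not_in)
  then have "AE x in \<mu>. norm (infdist x T) \<le> B"
  proof eventually_elim
    case (elim x)
    have "infdist x T \<le> dist x t" by (rule infdist_le[OF t])
    then show ?case using B[of x] elim by (simp add: infdist_nonneg dist_commute)
  qed
  then show ?thesis
    by (rule finite_measure.integrable_const_bound[OF \<mu>(2) _ infdist_borel_measurable[OF \<mu>(1)]])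
qed

lemma avg_distance_finite:
  fixes \<mu> :: "'a::euclidean_space measure"
  assumes \<mu>: "sets \<mu> = sets borel" "finite_measure \<mu>" "compact K" "emeasure \<mu> (- K) = 0"
    and T: "T \<noteq> {}" "hausdorff 1 T < top" and lam: "0 < lam"
  shows "enn2real (avg_distance \<mu> lam T) = (LINT x|\<mu>. infdist x T) + lam * enn2real (hausdorff 1 T)"
    "avg_distance \<mu> lam T < top"
proof -
  have 1: "(\<integral>\<^sup>+ x. ennreal (infdist x T) \<partial>\<mu>) = ennreal (LINT x|\<mu>. infdist x T)"
    by (rule nn_integral_eq_integral[OF integrable_infdist[OF \<mu> T(1)]]) (simp add: infdist_nonneg)
  have 0: "0 \<le> (LINT x|\<mu>. infdist x T)" by (rule integral_nonneg_AE) (simp add: infdist_nonneg)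
  obtain h where h: "hausdorff 1 T = ennreal h" "0 \<le> h" using T(2) by (cases "hausdorff 1 T") auto
  have avg: "avg_distance \<mu> lam T = ennreal ((LINT x|\<mu>. infdist x T) + lam * h)"
    unfolding avg_distance_def 1 h(1) using 0 h(2) lam by (simp add: ennreal_mult)
  show "enn2real (avg_distance \<mu> lam T) = (LINT x|\<mu>. infdist x T) + lam * enn2real (hausdorff 1 T)"
    "avg_distance \<mu> lam T < top"
    unfolding avg h(1) using 0 h(2) lam by (simp_all del: ennreal_plus)
qed

text \<open>The function \<open>g\<close> may contain arbitrary choices on a null set; agreeing
  almost everywhere with the measurable \<open>u\<close>, it is measurable for the
  completion.\<close>

lemma integral_completion_AE:
  fixes u g :: "'a \<Rightarrow> real"
  assumes u: "u \<in> borel_measurable \<mu>" and eq: "AE x in \<mu>. g x = u x"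
  shows "(LINT x|completion \<mu>. g x) = (LINT x|\<mu>. u x)"
proof -
  obtain N where N: "{x \<in> space \<mu>. \<not> g x = u x} \<subseteq> N" "emeasure \<mu> N = 0" "N \<in> sets \<mu>"
    using eq by (rule AE_E)
  then have N0: "N \<in> null_sets (completion \<mu>)" by (intro null_sets_completionI) auto
  have uc: "u \<in> borel_measurable (completion \<mu>)" using u by (rule measurable_completion)
  have "g \<in> borel_measurable (completion \<mu>)"
    by (rule completion.borel_measurable_null_cong[OF uc N0]) (use N(1) in auto)
  moreover have "AE x in completion \<mu>. g x = u x" using eq by (rule AE_completion)
  ultimately have "(LINT x|completion \<mu>. g x) = (LINT x|completion \<mu>. u x)"
    using uc by (intro integral_cong_AE)
  then show ?thesis using integral_completion[OF u] by simp
qed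

lemma closest_point_unique:
  fixes S :: "'a::euclidean_space set"
  assumes S: "closed S" "S \<noteq> {}" "x \<notin> S"
    and uniq: "\<forall>p\<in>nearest_points S x. \<forall>q\<in>nearest_points S x. p = q"
  shows "closest_point S x \<in> S" "closest_point S x \<noteq> x"
    "\<And>s. s \<in> S \<Longrightarrow> s \<noteq> closest_point S x \<Longrightarrow> dist x (closest_point S x) < dist x s"
proof -
  let ?p = "closest_point S x"
  have p: "?p \<in> S" "\<And>s. s \<in> S \<Longrightarrow> dist x ?p \<le> dist x s" using closest_point_exists[OF S(1,2)] by auto
  show "?p \<in> S" by (rule p)
  then show "?p \<noteq> x" using S(3) by auto
  have "infdist x S = dist x ?p"
    unfolding infdist_notempty[OF S(2)] by (rule cInf_eq_minimum) (use p in auto)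
  then have np: "?p \<in> nearest_points S x" and is_p: "infdist x S = dist x ?p" using p by (auto simp: nearest_points_def)
  fix s assume s: "s \<in> S" "s \<noteq> ?p"
  have "dist x s \<noteq> dist x ?p"
  proof
    assume "dist x s = dist x ?p"
    then have "s \<in> nearest_points S x" using s(1) is_p by (simp add: nearest_points_def)
    then show False using uniq np s(2) by blast
  qed
  then show "dist x ?p < dist x s" using p(2)[OF s(1)] by simp
qed

text \<open>Dominated convergence with the constant \<open>M + C\<close>, which bounds all
  difference quotients with \<open>|\<epsilon>| \<le> 1\<close>. The pointwise derivative
  \<open>g\<close> involves a choice of nearest points; a limit \<open>u\<close> of difference
  quotients along a sequence is measurable and equals \<open>g\<close> almost everywhere.\<close>

lemma distance_term_derivative:
  fixes \<mu> :: "'a::euclidean_space measure" and S :: "'a set"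
  assumes \<mu>: "sets \<mu> = sets borel" "finite_measure \<mu>" "compact K" "emeasure \<mu> (- K) = 0"
    and S: "compact S" "S \<noteq> {}"
    and AE: "AE x in \<mu>. x \<notin> S" "AE x in \<mu>. \<forall>p\<in>nearest_points S x. \<forall>q\<in>nearest_points S x. p = q"
    and X: "C11_field M X" and \<phi>: "first_variation S X \<phi> C"
  shows "((\<lambda>\<epsilon>. LINT x|\<mu>. infdist x (\<phi> \<epsilon> ` S)) has_real_derivative projection_term \<mu> S X) (at 0)"
    and "projection_term \<mu> S X = - gradient_term \<mu> S X"
proof -
  let ?p = "closest_point S"
  define g where "g x = X (?p x) \<bullet> ((?p x - x) /\<^sub>R norm (?p x - x))" for x
  have M: "0 \<le> M" using C11_fieldD(1)[OF X] .
  have C: "0 \<le> C" using \<phi> by (simp add: first_variation_def)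
  note p = closest_point_unique[OF compact_imp_closed[OF S(1)] S(2)]
  have deriv: "AE x in \<mu>. ((\<lambda>\<epsilon>. infdist x (\<phi> \<epsilon> ` S)) has_real_derivative g x) (at 0)"
    using AE
  proof eventually_elim
    case (elim x)
    have "((\<lambda>\<epsilon>. infdist x (\<phi> \<epsilon> ` S)) has_real_derivative X (?p x) \<bullet> sgn (?p x - x)) (at 0)"
      by (rule has_derivative_infdist_variation[OF S(1) p(1,2)[OF elim] p(3)[OF elim] \<phi> M])
         (use C11_fieldD(2)[OF X] C11_field_Lipschitz[OF X] in auto)
    then show ?case by (simp add: g_def sgn_div_norm)
  qed
  have close: "\<bar>infdist x (\<phi> \<epsilon> ` S) - infdist x S\<bar> \<le> (M + C) * \<bar>\<epsilon>\<bar>" if "\<bar>\<epsilon>\<bar> \<le> 1" for \<epsilon> x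
  proof (rule infdist_image_close[OF S(2)])
    fix s assume s: "s \<in> S"
    have "norm (\<phi> \<epsilon> s - s) \<le> norm (\<phi> \<epsilon> s - (s + \<epsilon> *\<^sub>R X s)) + norm (\<epsilon> *\<^sub>R X s)"
      using norm_triangle_ineq[of "\<phi> \<epsilon> s - (s + \<epsilon> *\<^sub>R X s)" "\<epsilon> *\<^sub>R X s"] by simp
    also have "\<dots> \<le> C * \<epsilon>\<^sup>2 + \<bar>\<epsilon>\<bar> * M"
      using \<phi> s that C11_fieldD(2)[OF X, of s] unfolding first_variation_def
      by (intro add_mono) (auto intro: mult_left_mono)
    also have "C * \<epsilon>\<^sup>2 \<le> C * \<bar>\<epsilon>\<bar>"
    proof (rule mult_left_mono[OF _ C])
      have "\<bar>\<epsilon>\<bar> * \<bar>\<epsilon>\<bar> \<le> \<bar>\<epsilon>\<bar> * 1" using that by (intro mult_left_mono) auto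
      then show "\<epsilon>\<^sup>2 \<le> \<bar>\<epsilon>\<bar>" by (simp add: power2_eq_square)
    qed
    finally show "dist (\<phi> \<epsilon> s) s \<le> (M + C) * \<bar>\<epsilon>\<bar>" by (simp add: dist_norm algebra_simps)
  qed
  have \<phi>0: "infdist x (\<phi> 0 ` S) = infdist x S" for x using close[of 0 x] by simp
  have meas: "(\<lambda>x. infdist x T) \<in> borel_measurable \<mu>" for T by (rule infdist_borel_measurable[OF \<mu>(1)])
  have int: "integrable \<mu> (\<lambda>x. infdist x (\<phi> \<epsilon> ` S))" for \<epsilon>
    by (rule integrable_infdist[OF \<mu>]) (use S in simp)
  have limseq: "u \<in> borel_measurable \<mu> \<and> (AE x in \<mu>. g x = u x) \<and>
      (\<lambda>n. ((LINT x|\<mu>. infdist x (\<phi> (e n) ` S)) - (LINT x|\<mu>. infdist x (\<phi> 0 ` S))) / e n) \<longlonglongrightarrow> (LINT x|\<mu>. u x)"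
    if e: "\<And>n. e n \<noteq> 0" "\<And>n. \<bar>e n\<bar> \<le> 1" "e \<longlonglongrightarrow> 0"
      and u: "u = (\<lambda>x. lim (\<lambda>n. (infdist x (\<phi> (e n) ` S) - infdist x (\<phi> 0 ` S)) / e n))" for e u
  proof -
    let ?Q = "\<lambda>n x. (infdist x (\<phi> (e n) ` S) - infdist x (\<phi> 0 ` S)) / e n"
    have mQ: "?Q n \<in> borel_measurable \<mu>" for n using meas by measurable
    have mu: "u \<in> borel_measurable \<mu>" unfolding u by (intro borel_measurable_lim_metric mQ)
    have lim: "AE x in \<mu>. (\<lambda>n. ?Q n x) \<longlonglongrightarrow> g x"
      using deriv
    proof eventually_elim
      case (elim x)
      then have "((\<lambda>h. (infdist x (\<phi> (0 + h) ` S) - infdist x (\<phi> 0 ` S)) / h) \<longlongrightarrow> g x) (at 0)"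
        unfolding DERIV_def .
      then have "((\<lambda>h. (infdist x (\<phi> (0 + h) ` S) - infdist x (\<phi> 0 ` S)) / h) \<circ> e) \<longlonglongrightarrow> g x"
        unfolding tendsto_at_iff_sequentially using e by auto
      then show ?case by (simp add: comp_def)
    qed
    then have AEu: "AE x in \<mu>. g x = u x" unfolding u by eventually_elim (simp add: limI)
    have "(\<lambda>n. LINT x|\<mu>. ?Q n x) \<longlonglongrightarrow> (LINT x|\<mu>. u x)"
    proof (rule integral_dominated_convergence[where w = "\<lambda>_. M + C"])
      show "integrable \<mu> (\<lambda>_. M + C)" using \<mu>(2) by (simp add: finite_measure.integrable_const)
      show "AE x in \<mu>. (\<lambda>n. ?Q n x) \<longlonglongrightarrow> u x" using lim AEu by eventually_elim simp
      show "AE x in \<mu>. norm (?Q n x) \<le> M + C" for n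
      proof (rule AE_I2)
        fix x
        show "norm (?Q n x) \<le> M + C"
          using close[OF e(2)[of n], of x] e(1)[of n] by (simp add: \<phi>0 pos_divide_le_eq)
      qed
    qed (use mQ mu in auto)
    moreover have "(LINT x|\<mu>. ?Q n x) = ((LINT x|\<mu>. infdist x (\<phi> (e n) ` S)) - (LINT x|\<mu>. infdist x (\<phi> 0 ` S))) / e n" for n
      using int by simp
    ultimately have "(\<lambda>n. ((LINT x|\<mu>. infdist x (\<phi> (e n) ` S)) - (LINT x|\<mu>. infdist x (\<phi> 0 ` S))) / e n) \<longlonglongrightarrow> (LINT x|\<mu>. u x)"
      by (simp only:)
    then show ?thesis using mu AEu by blast
  qed
  have proj: "projection_term \<mu> S X = (LINT x|completion \<mu>. g x)"
    by (simp add: projection_term_def g_def)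
  show "((\<lambda>\<epsilon>. LINT x|\<mu>. infdist x (\<phi> \<epsilon> ` S)) has_real_derivative projection_term \<mu> S X) (at 0)"
    unfolding DERIV_def tendsto_at_iff_sequentially
  proof (intro allI impI)
    fix e :: "nat \<Rightarrow> real"
    assume e: "\<forall>i. e i \<in> UNIV - {0}" "e \<longlonglongrightarrow> 0"
    have "eventually (\<lambda>n. dist (e n) 0 < 1) sequentially" using e(2) by (rule tendstoD) simp
    then obtain N where N: "\<And>n. N \<le> n \<Longrightarrow> dist (e n) 0 < 1" by (auto simp: eventually_sequentially)
    \<comment> \<open>Dropping finitely many terms ensures \<open>|e' n| \<le> 1\<close>, the range
      in which the variation is controlled.\<close>
    define e' where "e' n = e (n + N)" for n
    have e': "e' n \<noteq> 0" "\<bar>e' n\<bar> \<le> 1" "e' \<longlonglongrightarrow> 0" for n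
      using e(1) N[of "n + N"] LIMSEQ_ignore_initial_segment[OF e(2), of N] by (auto simp: e'_def[abs_def] less_imp_le)
    define u where "u = (\<lambda>x. lim (\<lambda>n. (infdist x (\<phi> (e' n) ` S) - infdist x (\<phi> 0 ` S)) / e' n))"
    note L = limseq[OF e'(1,2,3) u_def]
    have "(LINT x|completion \<mu>. g x) = (LINT x|\<mu>. u x)" using L by (intro integral_completion_AE) auto
    then have "(\<lambda>n. ((LINT x|\<mu>. infdist x (\<phi> (e' n) ` S)) - (LINT x|\<mu>. infdist x (\<phi> 0 ` S))) / e' n) \<longlonglongrightarrow> projection_term \<mu> S X"
      using L proj by simp
    then have "(\<lambda>n. ((LINT x|\<mu>. infdist x (\<phi> (e n) ` S)) - (LINT x|\<mu>. infdist x (\<phi> 0 ` S))) / e n) \<longlonglongrightarrow> projection_term \<mu> S X"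
      unfolding e'_def by (rule LIMSEQ_offset)
    then show "((\<lambda>h. ((LINT x|\<mu>. infdist x (\<phi> (0 + h) ` S)) - (LINT x|\<mu>. infdist x (\<phi> 0 ` S))) / h) \<circ> e) \<longlonglongrightarrow> projection_term \<mu> S X"
      by (simp add: comp_def)
  qed
  \<comment> \<open>One fixed sequence supplies a measurable representative of the integrand, and
    its negative represents the integrand of the gradient term.\<close>
  define e0 where "e0 n = inverse (real (Suc n))" for n
  have e0: "e0 n \<noteq> 0" "\<bar>e0 n\<bar> \<le> 1" "e0 \<longlonglongrightarrow> 0" for n
    using LIMSEQ_inverse_real_of_nat by (auto simp: e0_def[abs_def] field_simps)
  define u where "u = (\<lambda>x. lim (\<lambda>n. (infdist x (\<phi> (e0 n) ` S) - infdist x (\<phi> 0 ` S)) / e0 n))"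
  have u: "u \<in> borel_measurable \<mu>" "AE x in \<mu>. g x = u x" using limseq[OF e0 u_def] by auto
  have "AE x in \<mu>. X (?p x) \<bullet> gradient (\<lambda>y. infdist y S) x = - u x"
    using AE u(2)
  proof eventually_elim
    case (elim x)
    have "gradient (\<lambda>y. infdist y S) x = - sgn (?p x - x)"
      by (rule gradient_infdist[OF S(1) p(1,2)[OF elim(1,2)] p(3)[OF elim(1,2)]])
    then show ?case using elim(3) by (simp add: g_def sgn_div_norm)
  qed
  then have "gradient_term \<mu> S X = (LINT x|\<mu>. - u x)"
    unfolding gradient_term_def by (intro integral_completion_AE) (use u in auto)
  also have "\<dots> = - projection_term \<mu> S X" using integral_completion_AE[OF u] proj by simp
  finally show "projection_term \<mu> S X = - gradient_term \<mu> S X" by simp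
qed

lemma avg_distance_variation_derivative:
  fixes \<mu> :: "'a::euclidean_space measure" and S :: "'a set"
  assumes \<mu>: "sets \<mu> = sets borel" "finite_measure \<mu>" "compact K" "emeasure \<mu> (- K) = 0"
    and S: "compact S" "connected S" "S \<noteq> {}" "hausdorff 1 S < top" and lam: "0 < lam"
    and AE: "AE x in \<mu>. x \<notin> S" "AE x in \<mu>. \<forall>p\<in>nearest_points S x. \<forall>q\<in>nearest_points S x. p = q"
    and X: "C11_field M X" and \<phi>: "first_variation S X \<phi> C"
  shows "((\<lambda>\<epsilon>. enn2real (avg_distance \<mu> lam (\<phi> \<epsilon> ` S))) has_real_derivative
      projection_term \<mu> S X - lam * mean_curvature S X) (at 0)"
    and "\<bar>\<epsilon>\<bar> \<le> 1 \<Longrightarrow> avg_distance \<mu> lam (\<phi> \<epsilon> ` S) < top" and "\<bar>\<epsilon>\<bar> \<le> 1 \<Longrightarrow> continuous_on S (\<phi> \<epsilon>)"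
proof -
  have M: "0 \<le> M" using C11_fieldD(1)[OF X] .
  have C: "0 \<le> C" using \<phi> by (simp add: first_variation_def)
  have Lip: "(1 + \<bar>\<epsilon>\<bar> * (M + C))-lipschitz_on S (\<phi> \<epsilon>)" if "\<bar>\<epsilon>\<bar> \<le> 1" for \<epsilon>
  proof (rule lipschitz_onI)
    fix x y assume "x \<in> S" "y \<in> S"
    from first_variation_Lipschitz[OF X \<phi> that this(2,1)]
    show "dist (\<phi> \<epsilon> x) (\<phi> \<epsilon> y) \<le> (1 + \<bar>\<epsilon>\<bar> * (M + C)) * dist x y"
      by (simp add: dist_norm algebra_simps abs_le_iff)
  qed (use M C in simp)
  have fin: "hausdorff 1 (\<phi> \<epsilon> ` S) < top" if "\<bar>\<epsilon>\<bar> \<le> 1" for \<epsilon>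
    by (rule le_less_trans[OF hausdorff_Lipschitz_image[OF Lip[OF that]]])
       (use S(4) in \<open>simp add: ennreal_mult_less_top\<close>)
  show "continuous_on S (\<phi> \<epsilon>)" if "\<bar>\<epsilon>\<bar> \<le> 1" using Lip[OF that] by (rule lipschitz_on_continuous_on)
  show "avg_distance \<mu> lam (\<phi> \<epsilon> ` S) < top" if "\<bar>\<epsilon>\<bar> \<le> 1"
    using avg_distance_finite(2)[OF \<mu> _ fin[OF that] lam] S(3) by simp
  \<comment> \<open>The functional is split into a real sum where the length of the image is finite,
    which is known for \<open>|\<epsilon>| \<le> 1\<close>; for a derivative at 0 equality near 0
    suffices.\<close>
  have "eventually (\<lambda>\<epsilon>. \<epsilon> \<in> ball 0 1) (nhds (0::real))" by (intro eventually_nhds_in_open) auto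
  then have ev: "eventually (\<lambda>\<epsilon>. enn2real (avg_distance \<mu> lam (\<phi> \<epsilon> ` S)) =
      (LINT x|\<mu>. infdist x (\<phi> \<epsilon> ` S)) + lam * enn2real (hausdorff 1 (\<phi> \<epsilon> ` S))) (nhds 0)"
    by eventually_elim (use avg_distance_finite(1)[OF \<mu> _ fin lam] S(3) in \<open>simp add: less_imp_le\<close>)
  have "((\<lambda>\<epsilon>. (LINT x|\<mu>. infdist x (\<phi> \<epsilon> ` S)) + lam * enn2real (hausdorff 1 (\<phi> \<epsilon> ` S))) has_real_derivative
      projection_term \<mu> S X + lam * (- mean_curvature S X)) (at 0)"
    by (intro DERIV_add DERIV_cmult distance_term_derivative(1)[OF \<mu> S(1,3) AE X \<phi>]
        hausdorff_variation_derivative[OF S X \<phi>])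
  then show "((\<lambda>\<epsilon>. enn2real (avg_distance \<mu> lam (\<phi> \<epsilon> ` S))) has_real_derivative
      projection_term \<mu> S X - lam * mean_curvature S X) (at 0)"
    using DERIV_cong_ev[OF refl ev refl] by simp
qed

theorem theorem2p2:
  fixes \<mu> :: "(real ^ 'n) measure" and S :: "(real ^ 'n) set" and lam :: real
  assumes "CARD('n) \<ge> 2"
    and "lam > 0"
    and "sets \<mu> = sets borel" and "finite_measure \<mu>"
    and "\<exists>K. compact K \<and> emeasure \<mu> (- K) = 0"
    and "\<And>E. E \<in> sets borel \<Longrightarrow> hausdorff (CARD('n) - 1) E < \<infinity> \<Longrightarrow> emeasure \<mu> E = 0"
    and "S \<noteq> {}" and "closed S" and "connected S" and "hausdorff 1 S < \<infinity>"
  shows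
    "(\<forall>X \<phi>. test_field X \<longrightarrow> one_parameter_group \<phi> \<longrightarrow>
        (\<forall>x. (\<lambda>\<epsilon>. norm (\<phi> \<epsilon> x - (x + \<epsilon> *\<^sub>R X x))) \<in> o[at 0](\<lambda>\<epsilon>. \<epsilon>)) \<longrightarrow>
        ((\<lambda>\<epsilon>. enn2real (avg_distance \<mu> lam (\<phi> \<epsilon> ` S))) has_real_derivative
           projection_term \<mu> S X - lam * mean_curvature S X) (at 0) \<and>
        projection_term \<mu> S X - lam * mean_curvature S X =
           - gradient_term \<mu> S X - lam * mean_curvature S X) \<and>
     (avg_distance_minimizer \<mu> lam S \<longrightarrow>
        (\<forall>X. test_field X \<longrightarrow> projection_term \<mu> S X = lam * mean_curvature S X))"
proof -
  have null: "emeasure \<mu> E = 0" if "E \<in> sets borel" "hausdorff (CARD('n) - 1) E < top" for E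
    using assms(6) that by simp
  have fin: "hausdorff 1 S < top" using assms(10) by simp
  obtain K where K: "compact K" "emeasure \<mu> (- K) = 0" using assms(5) by blast
  note \<mu> = assms(3,4) K
  have cS: "compact S" by (rule finite_length_continuum_compact[OF assms(8,9) fin])
  note S = cS assms(9,7) fin
  \<comment> \<open>From \<open>CARD('n) \<ge> 2\<close> it follows that
    \<open>1 \<le> CARD('n) - 1\<close>, so finite length carries over to the dimension in which
    \<open>\<mu>\<close> ignores sets of finite measure.\<close>
  have "hausdorff (CARD('n) - 1) S < top" using assms(1) by (intro hausdorff_finite_dimension_mono[OF fin]) linarith
  then have "emeasure \<mu> S = 0" using assms(8) by (intro null borel_closed)
  then have "S \<in> null_sets \<mu>" using assms(3,8) by (intro null_setsI) auto
  then have AE1: "AE x in \<mu>. x \<notin> S" by (rule AE_not_in)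
  have AE2: "AE x in \<mu>. \<forall>p\<in>nearest_points S x. \<forall>q\<in>nearest_points S x. p = q"
    by (rule AE_unique_nearest_point[OF cS assms(3) null])
  note deriv = avg_distance_variation_derivative[OF \<mu> S assms(2) AE1 AE2]
  show ?thesis
  proof (intro conjI allI impI)
    fix X :: "real ^ 'n \<Rightarrow> real ^ 'n" and \<phi> :: "real \<Rightarrow> real ^ 'n \<Rightarrow> real ^ 'n"
    assume X: "test_field X" and \<phi>: "one_parameter_group \<phi>"
      and exp: "\<forall>x. (\<lambda>\<epsilon>. norm (\<phi> \<epsilon> x - (x + \<epsilon> *\<^sub>R X x))) \<in> o[at 0](\<lambda>\<epsilon>. \<epsilon>)"
    obtain M where M: "C11_field M X" using test_field_C11[OF X] by blast
    obtain C where C: "first_variation S X \<phi> C"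
      using flow_first_variation[OF M, of \<phi> S] \<phi> exp unfolding one_parameter_group_def by blast
    show "((\<lambda>\<epsilon>. enn2real (avg_distance \<mu> lam (\<phi> \<epsilon> ` S))) has_real_derivative
        projection_term \<mu> S X - lam * mean_curvature S X) (at 0)"
      by (rule deriv(1)[OF M C])
    show "projection_term \<mu> S X - lam * mean_curvature S X = - gradient_term \<mu> S X - lam * mean_curvature S X"
      using distance_term_derivative(2)[OF \<mu> S(1,3) AE1 AE2 M C] by simp
  next
    fix X :: "real ^ 'n \<Rightarrow> real ^ 'n"
    assume min: "avg_distance_minimizer \<mu> lam S" and X: "test_field X"
    obtain M where M: "C11_field M X" using test_field_C11[OF X] by blast
    \<comment> \<open>The affine variation has no remainder, hence the constant 0. For
      \<open>|\<epsilon>| \<le> 1\<close> it is continuous on \<open>S\<close>, so the image is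
      again nonempty, compact and connected and may be compared with the minimizer.\<close>
    define \<psi> where "\<psi> \<epsilon> x = x + \<epsilon> *\<^sub>R X x" for \<epsilon> x
    have \<psi>: "first_variation S X \<psi> 0" by (simp add: first_variation_def \<psi>_def)
    have \<psi>0: "\<psi> 0 ` S = S" by (simp add: \<psi>_def)
    have le: "avg_distance \<mu> lam (\<psi> 0 ` S) \<le> avg_distance \<mu> lam (\<psi> \<epsilon> ` S)" if "\<bar>\<epsilon>\<bar> \<le> 1" for \<epsilon>
    proof -
      have c: "continuous_on S (\<psi> \<epsilon>)" by (rule deriv(3)[OF M \<psi> that])
      then have "closed (\<psi> \<epsilon> ` S)" using cS by (intro compact_imp_closed compact_continuous_image)
      moreover have "connected (\<psi> \<epsilon> ` S)" using c assms(9) by (rule connected_continuous_image)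
      ultimately show ?thesis
        using min assms(7) unfolding \<psi>0 avg_distance_minimizer_def by simp
    qed
    have "projection_term \<mu> S X - lam * mean_curvature S X = 0"
    proof (rule DERIV_local_min[OF deriv(1)[OF M \<psi>] zero_less_one], intro allI impI)
      fix \<epsilon> :: real assume "\<bar>0 - \<epsilon>\<bar> < 1"
      then have e: "\<bar>\<epsilon>\<bar> \<le> 1" by simp
      show "enn2real (avg_distance \<mu> lam (\<psi> 0 ` S)) \<le> enn2real (avg_distance \<mu> lam (\<psi> \<epsilon> ` S))"
        using le[OF e] deriv(2)[OF M \<psi> e] by (rule enn2real_mono)
    qed
    then show "projection_term \<mu> S X = lam * mean_curvature S X" by simp
  qed
qed

end
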